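(* In $\mathbb{R}^2$ let $m$ be the line $x=-2$, $P=(-4,-1)$, $Q=(1,2)$, and let $n$ be the line $y=-1$, $R=(0,1)$, $S=(1,0)$. If $l_1,l_2$ are lines in $\mathbb{R}^2$ with $$P^{l_1}\in m,\qquad R^{l_2}\in n,\qquad Q^{l_1}=S^{l_2},$$ then the slope of $l_2$ is a root of the polynomial $$h(y)=y^7+y^6-8y^5+3y^4+y^3-3y^2+2y-1,$$ and $\operatorname{Gal}(h\mid\mathbb{Q})\cong A_7$. Moreover $h$ has exactly three real roots, and these correspond bijectively to the points $G\in\mathbb{R}^2$ for which there exist lines $l_1,l_2$ in $\mathbb{R}^2$ with $P^{l_1}\in m$, $R^{l_2}\in n$ and $Q^{l_1}=G=S^{l_2}$.
   Context: For a line $l\subset\mathbb{R}^2$ and a point $P\in\mathbb{R}^2$, $P^l$ denotes the image of $P$ under reflection across $l$. Finding $l_1,l_2$ from given $P,Q,R,S,m,n$ with the three conditions $P^{l_1}\in m$, $R^{l_2}\in n$, $Q^{l_1}=S^{l_2}$ is the 2-fold origami axiom AL6ab8 of Alperin and Lang. $\operatorname{Gal}(h\mid\mathbb{Q})$ is the Galois group of the splitting field of $h$ over $\mathbb{Q}$. *)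

theory Defs
  imports
    "HOL-Analysis.Analysis"
    "HOL-Algebra.Bij"
    "HOL-Algebra.QuotRing"
    "HOL-Algebra.Generated_Fields"
    "HOL-Algebra.Sym_Groups"
    "HOL-Algebra.Algebraic_Closure_Type"
begin

definition is_line :: "(real^2) set \<Rightarrow> bool" where
  "is_line l \<longleftrightarrow> affine l \<and> aff_dim l = 1"

text \<open>For a line \<open>l\<close>, which is closed and convex, \<open>closest_point l A\<close> is the foot of the
  perpendicular from \<open>A\<close> to \<open>l\<close>; it is the midpoint of \<open>A\<close> and its mirror image.\<close>

definition reflect_across :: "(real^2) set \<Rightarrow> real^2 \<Rightarrow> real^2" where
  "reflect_across l A = 2 *\<^sub>R closest_point l A - A"

text \<open>A relation rather than a function, so that a vertical line has no slope.\<close>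

definition has_slope :: "(real^2) set \<Rightarrow> real \<Rightarrow> bool" where
  "has_slope l t \<longleftrightarrow> (\<exists>b. l = {A. A $ 2 = t * A $ 1 + b})"

text \<open>The 2-fold axiom AL6ab8 of Alperin and Lang, for the pair of fold lines \<open>l1\<close>, \<open>l2\<close>.\<close>

definition AL6ab8 ::
  "real^2 \<Rightarrow> real^2 \<Rightarrow> real^2 \<Rightarrow> real^2 \<Rightarrow> (real^2) set \<Rightarrow> (real^2) set \<Rightarrow>
   (real^2) set \<Rightarrow> (real^2) set \<Rightarrow> bool" where
  "AL6ab8 P Q R S m n l1 l2 \<longleftrightarrow>
     is_line l1 \<and> is_line l2 \<and>
     reflect_across l1 P \<in> m \<and> reflect_across l2 R \<in> n \<and>
     reflect_across l1 Q = reflect_across l2 S"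

definition roots_of :: "rat poly \<Rightarrow> 'a::field_char_0 set" where
  "roots_of p = {x. poly (map_poly of_rat p) x = 0}"

text \<open>The splitting field over the rationals, realised inside the complex numbers.\<close>

definition splitting_field :: "rat poly \<Rightarrow> complex ring" where
  "splitting_field p =
     ring_of_type_algebra
       \<lparr>carrier := generate_field ring_of_type_algebra (\<rat> \<union> roots_of p)\<rparr>"

text \<open>The automorphisms of \<open>L\<close> fixing \<open>k\<close> pointwise. As in \<^const>\<open>AutoGroup\<close>, maps are taken
  extensional, so that each automorphism is represented by exactly one function.\<close>

definition galois_group :: "('a, 'b) ring_scheme \<Rightarrow> 'a set \<Rightarrow> ('a \<Rightarrow> 'a) monoid" where
  "galois_group L k =
     BijGroup (carrier L)
       \<lparr>carrier := {\<sigma> \<in> ring_iso L L \<inter> extensional (carrier L). \<forall>a\<in>k. \<sigma> a = a}\<rparr>"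

definition Gal :: "rat poly \<Rightarrow> (complex \<Rightarrow> complex) monoid" where
  "Gal p = galois_group (splitting_field p) \<rat>"

definition h_poly :: "rat poly" where
  "h_poly = [:-1, 2, -3, 1, 3, -8, 1, 1:]"

end

theory Submission
  imports Defs
begin

text \<open>
  The reflection of \<open>R\<close> across \<open>l2\<close> lies on \<open>n\<close> exactly when \<open>l2\<close> is tangent to the parabola with
  focus \<open>R\<close> and directrix \<open>n\<close>, that is \<open>l2\<close> is \<open>y = t x - t^2\<close> for its slope \<open>t\<close>; likewise \<open>l1\<close> is
  the tangent \<open>x + s y = s^2 - s - 3\<close> of the parabola with focus \<open>P\<close> and directrix \<open>m\<close>
  (\<open>fold1_iff\<close>, \<open>fold2_iff\<close>). Equality of the reflections of \<open>Q\<close> and \<open>S\<close> gives two equations in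
  \<open>s\<close> and \<open>t\<close>. They determine \<open>s\<close> from \<open>t\<close>, and eliminating \<open>s\<close> leaves
  \<open>h(t) = 0\<close> (\<open>half_height_cubic\<close>, \<open>exists_fold1_parameter_iff\<close>). The common point \<open>G\<close> determines
  \<open>t\<close>, so the points correspond to the real roots of \<open>h\<close>. Those are counted by exhibiting, on
  consecutive intervals, either the sign of \<open>h\<close> or the sign of its derivative through an expansion
  with positive coefficients (\<open>bernstein_form_pos\<close>).

  For the Galois group let \<open>L\<close> be the splitting field inside the complex numbers and \<open>H\<close> the group
  of permutations of the seven roots induced by the automorphisms of \<open>L\<close>. Three facts determine \<open>H\<close>.

  Modulo 3 the polynomial \<open>h\<close> has no root, while \<open>x^(3^7) - x\<close> vanishes on its roots; modulo 17 it
  has exactly the four roots 2, 9, 10, 12. A Frobenius element \<open>\<sigma>\<close> of a prime ideal \<open>I\<close> over \<open>p\<close>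
  satisfies \<open>\<sigma> a = a^p\<close> modulo \<open>I\<close> for every root \<open>a\<close>, and for \<open>p = 3\<close> and \<open>p = 17\<close> the roots of \<open>h\<close> remain
  distinct modulo \<open>I\<close>. Hence \<open>H\<close> contains a 7-cycle (\<open>exists_seven_cycle\<close>) and an element moving
  exactly three roots, a 3-cycle (\<open>exists_three_cycle\<close>). A permutation group of prime degree with
  such elements contains every 3-cycle (\<open>all_cycle3_of_prime_degree\<close>), thus the alternating group.
  Conversely the discriminant of \<open>h\<close> is \<open>77872^2\<close>, so the product of the differences of the roots is
  rational and no transposition belongs to \<open>H\<close> (\<open>Gal_h_no_transposition\<close>). An odd element of \<open>H\<close>
  would, together with the alternating group, produce one.

  Two general theorems support this. The field fixed by all automorphisms of \<open>L\<close> is the rational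
  field (\<open>fixed_field_Gal\<close>), because embeddings extend along simple algebraic extensions
  (\<open>hom_on_extend\<close>). Frobenius elements exist (\<open>exists_frobenius\<close>): the product of \<open>T - \<sigma> u\<close> over all
  \<open>\<sigma>\<close>, where \<open>u\<close> is the polynomial in an indeterminate whose coefficients are the roots, has
  rational coefficients, so in characteristic \<open>p\<close> the Frobenius map carries its root \<open>u\<close> to another
  of its roots. The prime ideal is the set of nonunits of a valuation ring of the complex numbers in
  which \<open>p\<close> is not invertible (\<open>exists_prime_over\<close>); such a ring contains all algebraic integers.
\<close>

text \<open>Homonyms of the polynomial and permutation vocabulary used below, coming from the
  record-based algebra, are hidden; the dollar sign is reserved for vector components.\<close>

hide_const (open) Coset.order Divisibility.prime module.smult up_ring.coeff up_ring.monom
  Polynomials.degree Polynomials.lead_coeff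
no_notation fps_nth (infixl "$" 75)

section \<open>Subrings, subfields and homomorphisms\<close>

definition is_subring :: "'a::comm_ring_1 set \<Rightarrow> bool" where
  "is_subring S \<longleftrightarrow> 1 \<in> S \<and> (\<forall>x\<in>S. \<forall>y\<in>S. x - y \<in> S \<and> x * y \<in> S)"

definition is_subfield :: "'a::field set \<Rightarrow> bool" where
  "is_subfield K \<longleftrightarrow> is_subring K \<and> (\<forall>x\<in>K. inverse x \<in> K)"

text \<open>Homomorphisms are total functions of which only the values on the subring matter, so that
  they can be extended step by step without changing type.\<close>

definition hom_on :: "'a::comm_ring_1 set \<Rightarrow> ('a \<Rightarrow> 'b::comm_ring_1) \<Rightarrow> bool" where
  "hom_on S f \<longleftrightarrow> f 1 = 1 \<and> (\<forall>x\<in>S. \<forall>y\<in>S. f (x + y) = f x + f y \<and> f (x * y) = f x * f y)"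

definition polys_in :: "'a::zero set \<Rightarrow> 'a poly set" where
  "polys_in S = {p. \<forall>i. coeff p i \<in> S}"

text \<open>The subring generated by \<open>S\<close> and \<open>a\<close>; when \<open>S\<close> is a field and \<open>a\<close> is algebraic over it,
  this is already the field \<open>S(a)\<close>.\<close>

definition adjoin :: "'a::comm_semiring_0 set \<Rightarrow> 'a \<Rightarrow> 'a set" where
  "adjoin S a = (\<lambda>q. poly q a) ` polys_in S"

lemma subringD:
  assumes "is_subring S"
  shows "1 \<in> S" "0 \<in> S" "x \<in> S \<Longrightarrow> - x \<in> S"
    "x \<in> S \<Longrightarrow> y \<in> S \<Longrightarrow> x + y \<in> S" "x \<in> S \<Longrightarrow> y \<in> S \<Longrightarrow> x - y \<in> S"
    "x \<in> S \<Longrightarrow> y \<in> S \<Longrightarrow> x * y \<in> S"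
proof -
  show 1: "1 \<in> S" and d: "x \<in> S \<Longrightarrow> y \<in> S \<Longrightarrow> x - y \<in> S" and "x \<in> S \<Longrightarrow> y \<in> S \<Longrightarrow> x * y \<in> S" for x y
    using assms by (auto simp: is_subring_def)
  show 0: "0 \<in> S" using d[OF 1 1] by simp
  show m: "x \<in> S \<Longrightarrow> - x \<in> S" for x using d[OF 0, of x] by simp
  show "x \<in> S \<Longrightarrow> y \<in> S \<Longrightarrow> x + y \<in> S" using d[OF _ m, of x y] by simp
qed

lemma subring_sum: "is_subring S \<Longrightarrow> (\<And>i. i \<in> I \<Longrightarrow> f i \<in> S) \<Longrightarrow> sum f I \<in> S"
  by (induction I rule: infinite_finite_induct) (auto simp: subringD)

lemma subring_prod: "is_subring S \<Longrightarrow> (\<And>i. i \<in> I \<Longrightarrow> f i \<in> S) \<Longrightarrow> prod f I \<in> S"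
  by (induction I rule: infinite_finite_induct) (auto simp: subringD)

lemma subring_power: "is_subring S \<Longrightarrow> x \<in> S \<Longrightarrow> x ^ n \<in> S"
  by (induction n) (auto simp: subringD)

lemma subring_of_nat: "is_subring S \<Longrightarrow> of_nat n \<in> S"
  by (induction n) (auto simp: subringD)

lemma subring_of_int: "is_subring S \<Longrightarrow> of_int n \<in> S"
  by (cases n rule: int_cases2) (auto simp: subring_of_nat subringD)

lemma subring_Rats: "is_subring (\<rat> :: 'a::field_char_0 set)"
  by (simp add: is_subring_def)

lemma subfield_Rats: "is_subfield (\<rat> :: 'a::field_char_0 set)"
  by (simp add: is_subfield_def subring_Rats)

lemma subfield_imp_subring: "is_subfield K \<Longrightarrow> is_subring K"
  by (simp add: is_subfield_def)

lemma Rats_subset_subfield: "is_subfield K \<Longrightarrow> (\<rat> :: 'a::field_char_0 set) \<subseteq> K"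
proof
  fix x :: 'a assume K: "is_subfield K" and "x \<in> \<rat>"
  then obtain a b where "x = of_int a / of_int b" by (auto elim: Rats_cases')
  then have "x = of_int a * inverse (of_int b)" by (simp add: divide_inverse)
  then show "x \<in> K" using K subring_of_int[of K] unfolding is_subfield_def
    by (auto intro: subringD)
qed

lemma hom_onD:
  assumes "is_subring S" "hom_on S f"
  shows "f 1 = 1" "f 0 = 0" "x \<in> S \<Longrightarrow> f (- x) = - f x"
    "x \<in> S \<Longrightarrow> y \<in> S \<Longrightarrow> f (x + y) = f x + f y" "x \<in> S \<Longrightarrow> y \<in> S \<Longrightarrow> f (x - y) = f x - f y"
    "x \<in> S \<Longrightarrow> y \<in> S \<Longrightarrow> f (x * y) = f x * f y"
proof -
  show 1: "f 1 = 1" and a: "x \<in> S \<Longrightarrow> y \<in> S \<Longrightarrow> f (x + y) = f x + f y"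
    and "x \<in> S \<Longrightarrow> y \<in> S \<Longrightarrow> f (x * y) = f x * f y" for x y
    using assms by (auto simp: hom_on_def)
  show 0: "f 0 = 0" using a[of 0 0] assms(1) by (simp add: subringD)
  show m: "x \<in> S \<Longrightarrow> f (- x) = - f x" for x
    using a[of x "-x"] assms(1) 0 by (simp add: subringD eq_neg_iff_add_eq_0 add.commute)
  show "x \<in> S \<Longrightarrow> y \<in> S \<Longrightarrow> f (x - y) = f x - f y"
    using a[of x "-y"] m[of y] assms(1) by (simp add: subringD)
qed

lemma hom_on_subset: "hom_on S f \<Longrightarrow> T \<subseteq> S \<Longrightarrow> hom_on T f"
  by (auto simp: hom_on_def)

lemma hom_on_sum:
  assumes "is_subring S" "hom_on S f" "\<And>i. i \<in> I \<Longrightarrow> g i \<in> S"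
  shows "f (sum g I) = (\<Sum>i\<in>I. f (g i))"
  using assms(3)
  by (induction I rule: infinite_finite_induct)
     (auto simp: hom_onD[OF assms(1,2)] subring_sum[OF assms(1)])

lemma hom_on_prod:
  assumes "is_subring S" "hom_on S f" "\<And>i. i \<in> I \<Longrightarrow> g i \<in> S"
  shows "f (prod g I) = (\<Prod>i\<in>I. f (g i))"
  using assms(3)
  by (induction I rule: infinite_finite_induct)
     (auto simp: hom_onD[OF assms(1,2)] subring_prod[OF assms(1)])

lemma hom_on_power:
  assumes "is_subring S" "hom_on S f" "x \<in> S"
  shows "f (x ^ n) = f x ^ n"
  using hom_on_prod[OF assms(1,2), of "{..<n}" "\<lambda>_. x"] assms(3) by simp

lemma hom_on_of_int:
  assumes "is_subring S" "hom_on S f"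
  shows "f (of_int n) = of_int n"
proof -
  have nat: "f (of_nat k) = of_nat k" for k
    by (induction k) (auto simp: hom_onD[OF assms] subring_of_nat[OF assms(1)] subringD[OF assms(1)])
  show ?thesis
    by (cases n rule: int_cases2)
       (auto simp: nat hom_onD[OF assms] subring_of_nat[OF assms(1)])
qed

lemma hom_on_field:
  fixes f :: "'a::field \<Rightarrow> 'b::field"
  assumes "is_subfield K" "hom_on K f" "x \<in> K"
  shows "f (inverse x) = inverse (f x)" and "f x = 0 \<longleftrightarrow> x = 0"
proof -
  note S = subfield_imp_subring[OF assms(1)]
  have inv: "inverse x \<in> K" using assms by (auto simp: is_subfield_def)
  have *: "f x * f (inverse x) = 1" if "x \<noteq> 0"
    using that hom_onD(6)[OF S assms(2) assms(3) inv] hom_onD(1)[OF S assms(2)] by simp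
  show "f x = 0 \<longleftrightarrow> x = 0" using * hom_onD(2)[OF S assms(2)] by fastforce
  show "f (inverse x) = inverse (f x)"
    by (cases "x = 0") (use * hom_onD(2)[OF S assms(2)] in \<open>auto simp: inverse_unique\<close>)
qed

lemma hom_on_inj:
  fixes f :: "'a::field \<Rightarrow> 'b::field"
  assumes "is_subfield K" "hom_on K f"
  shows "inj_on f K"
proof (rule inj_onI)
  fix x y assume "x \<in> K" "y \<in> K" "f x = f y"
  moreover note S = subfield_imp_subring[OF assms(1)]
  ultimately have "f (x - y) = 0" "x - y \<in> K" using hom_onD[OF S assms(2)] subringD[OF S] by auto
  then show "x = y" using hom_on_field(2)[OF assms] by auto
qed

text \<open>A rational number is a quotient of integers, which a homomorphism fixes because they are
  sums of ones and their negatives.\<close>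

lemma hom_on_Rats:
  fixes f :: "'a::field_char_0 \<Rightarrow> 'b::field_char_0"
  assumes "is_subfield K" "hom_on K f"
  shows "f (of_rat r) = of_rat r"
proof -
  note S = subfield_imp_subring[OF assms(1)]
  obtain a b where r: "quotient_of r = (a, b)" by (cases "quotient_of r")
  have of_rat: "(of_rat r :: 'c::field_char_0) = of_int a * inverse (of_int b)"
    using quotient_of_div[OF r] by (metis of_rat_divide of_rat_of_int_eq divide_inverse)
  have i: "of_int b \<in> K" "of_int a \<in> K" using subring_of_int[OF S] by auto
  then have "inverse (of_int b) \<in> K" using assms(1) by (auto simp: is_subfield_def)
  then show ?thesis
    unfolding of_rat using i
    by (simp add: hom_onD(6)[OF S assms(2)] hom_on_field(1)[OF assms] hom_on_of_int[OF S assms(2)])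
qed

lemma polys_inI: "(\<And>i. coeff p i \<in> S) \<Longrightarrow> p \<in> polys_in S"
  by (simp add: polys_in_def)

lemma polys_inD: "p \<in> polys_in S \<Longrightarrow> coeff p i \<in> S"
  by (simp add: polys_in_def)

lemma polys_in_mono: "S \<subseteq> T \<Longrightarrow> polys_in S \<subseteq> polys_in T"
  by (auto simp: polys_in_def)

lemma is_subring_polys_in:
  assumes "is_subring S" shows "is_subring (polys_in S)"
  unfolding is_subring_def
  by (auto simp: polys_in_def coeff_1 coeff_mult intro!: subring_sum[OF assms] subringD[OF assms])

lemma monom_in_polys_in: "is_subring S \<Longrightarrow> c \<in> S \<Longrightarrow> monom c n \<in> polys_in S"
  by (auto simp: polys_in_def subringD)

lemma pCons_in_polys_in: "c \<in> S \<Longrightarrow> p \<in> polys_in S \<Longrightarrow> pCons c p \<in> polys_in S"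
  by (auto simp: polys_in_def coeff_pCons split: nat.splits)

lemma zero_in_polys_in: "is_subring S \<Longrightarrow> 0 \<in> polys_in S"
  by (auto simp: polys_in_def subringD)

lemma poly_in_subring:
  assumes "is_subring S" "p \<in> polys_in S" "x \<in> S"
  shows "poly p x \<in> S"
  unfolding poly_altdef using assms
  by (auto intro!: subring_sum subringD subring_power polys_inD)

lemma coeff_map_poly_hom:
  assumes "is_subring S" "hom_on S f"
  shows "coeff (map_poly f p) i = f (coeff p i)"
  by (simp add: coeff_map_poly hom_onD[OF assms])

lemma hom_on_map_poly:
  assumes "is_subring S" "hom_on S f"
  shows "hom_on (polys_in S) (map_poly f)"
  unfolding hom_on_def
proof (intro conjI ballI)
  show "map_poly f 1 = 1"
    by (simp add: poly_eq_iff coeff_map_poly_hom[OF assms] hom_onD[OF assms] coeff_1)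
  fix x y assume xy: "x \<in> polys_in S" "y \<in> polys_in S"
  then show "map_poly f (x + y) = map_poly f x + map_poly f y"
    by (simp add: poly_eq_iff coeff_map_poly_hom[OF assms] hom_onD[OF assms] polys_inD)
  show "map_poly f (x * y) = map_poly f x * map_poly f y"
    using xy
    by (simp add: poly_eq_iff coeff_map_poly_hom[OF assms] coeff_mult hom_onD[OF assms] polys_inD
        hom_on_sum[OF assms] subringD[OF assms(1)])
qed

lemma poly_sum_upto:
  fixes p :: "'a::comm_semiring_1 poly"
  assumes "degree p \<le> n" shows "poly p x = (\<Sum>i\<le>n. coeff p i * x ^ i)"
  unfolding poly_altdef using assms
  by (intro sum.mono_neutral_left) (auto simp: coeff_eq_0)

lemma hom_on_poly:
  assumes S: "is_subring S" and f: "hom_on S f" and p: "p \<in> polys_in S" and x: "x \<in> S"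
  shows "f (poly p x) = poly (map_poly f p) (f x)"
proof -
  have "degree (map_poly f p) \<le> degree p"
    by (rule degree_le) (simp add: coeff_map_poly_hom[OF S f] hom_onD(2)[OF S f] coeff_eq_0)
  then have "poly (map_poly f p) (f x) = (\<Sum>i\<le>degree p. coeff (map_poly f p) i * f x ^ i)"
    by (rule poly_sum_upto)
  also have "\<dots> = (\<Sum>i\<le>degree p. f (coeff p i) * f x ^ i)"
    by (simp add: coeff_map_poly_hom[OF S f])
  also have "\<dots> = f (poly p x)"
    using p x by (simp add: poly_altdef hom_on_sum[OF S f] hom_onD(6)[OF S f] hom_on_power[OF S f]
        polys_inD subring_power[OF S] subringD[OF S])
  finally show ?thesis by simp
qed


section \<open>Simple algebraic extensions\<close>

lemma is_subring_adjoin: assumes "is_subring S" shows "is_subring (adjoin S a)"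
proof -
  note P = subringD[OF is_subring_polys_in[OF assms]]
  show ?thesis
    unfolding is_subring_def
  proof (intro conjI ballI)
    show "1 \<in> adjoin S a" using P(1) by (force simp: adjoin_def)
    fix x y assume "x \<in> adjoin S a" "y \<in> adjoin S a"
    then obtain p q where "p \<in> polys_in S" "q \<in> polys_in S" "x = poly p a" "y = poly q a"
      by (auto simp: adjoin_def)
    then show "x - y \<in> adjoin S a" "x * y \<in> adjoin S a"
      unfolding adjoin_def using image_eqI[of "x - y" "\<lambda>q. poly q a" "p - q"]
        image_eqI[of "x * y" "\<lambda>q. poly q a" "p * q"] P(5,6)[of p q] by simp_all
  qed
qed

lemma adjoin_superset: "is_subring S \<Longrightarrow> S \<subseteq> adjoin S a"
proof
  fix x assume "is_subring S" "x \<in> S"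
  then have "[:x:] \<in> polys_in S" by (simp add: pCons_in_polys_in zero_in_polys_in)
  then show "x \<in> adjoin S a" unfolding adjoin_def by (rule rev_image_eqI) simp
qed

lemma adjoin_mem: "is_subring S \<Longrightarrow> a \<in> adjoin S a"
proof -
  assume "is_subring S"
  then have "[:0, 1:] \<in> polys_in S" by (simp add: pCons_in_polys_in zero_in_polys_in subringD)
  then show "a \<in> adjoin S a" unfolding adjoin_def by (rule rev_image_eqI) simp
qed

lemma adjoin_least: "is_subring T \<Longrightarrow> S \<subseteq> T \<Longrightarrow> a \<in> T \<Longrightarrow> adjoin S a \<subseteq> T"
  using polys_in_mono[of S T] by (auto simp: adjoin_def intro!: poly_in_subring)

text \<open>The quotient and the remainder keep their coefficients in \<open>K\<close> because only the leading
  coefficient of the divisor is ever inverted.\<close>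

lemma polys_in_division:
  assumes K: "is_subfield K" and m: "m \<in> polys_in K" "m \<noteq> 0" and f: "f \<in> polys_in K"
  shows "\<exists>q\<in>polys_in K. \<exists>r\<in>polys_in K. f = q * m + r \<and> (r = 0 \<or> degree r < degree m)"
  using f
proof (induction "degree f" arbitrary: f rule: less_induct)
  case less
  note S = subfield_imp_subring[OF K]
  note P = subringD[OF is_subring_polys_in[OF S]]
  show ?case
  proof (cases "f = 0 \<or> degree f < degree m")
    case True
    then show ?thesis using less.prems P(2) by (intro bexI[of _ 0] bexI[of _ f]) auto
  next
    case False
    define t where "t = monom (lead_coeff f * inverse (lead_coeff m)) (degree f - degree m)"
    have t: "t \<in> polys_in K" unfolding t_def
      using m f less.prems K by (intro monom_in_polys_in S subringD) (auto simp: polys_in_def is_subfield_def)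
    define g where "g = f - t * m"
    have g: "g \<in> polys_in K" unfolding g_def by (rule P(5)[OF less.prems P(6)[OF t m(1)]])
    have tm: "degree (t * m) = degree f" "lead_coeff (t * m) = lead_coeff f"
    proof -
      have "t \<noteq> 0" using False m by (auto simp: t_def)
      then show "degree (t * m) = degree f" using m False by (simp add: degree_mult_eq t_def degree_monom_eq)
      show "lead_coeff (t * m) = lead_coeff f"
        using m False by (simp add: lead_coeff_mult t_def degree_monom_eq)
    qed
    show ?thesis
    proof (cases "g = 0")
      case True
      then show ?thesis using t P(2) by (intro bexI[of _ t] bexI[of _ 0]) (auto simp: g_def)
    next
      case g0: False
      have "coeff g (degree f) = 0" using tm by (simp add: g_def)
      moreover have "degree g \<le> degree f" unfolding g_def using tm by (intro degree_diff_le) auto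
      ultimately have "degree g < degree f"
        using g0 by (metis leading_coeff_0_iff order_le_less)
      from less.hyps[OF this g] obtain q r where "q \<in> polys_in K" "r \<in> polys_in K" "g = q * m + r"
         "r = 0 \<or> degree r < degree m" by blast
      then show ?thesis using P(4)[OF t, of q]
        by (intro bexI[of _ "t + q"] bexI[of _ r]) (auto simp: g_def algebra_simps)
    qed
  qed
qed

text \<open>The minimal polynomial of \<open>a\<close> over \<open>K\<close> up to a nonzero factor, described by its degree
  alone.\<close>

definition minimal_at :: "'a::field set \<Rightarrow> 'a \<Rightarrow> 'a poly \<Rightarrow> bool" where
  "minimal_at K a m \<longleftrightarrow> m \<in> polys_in K \<and> m \<noteq> 0 \<and> poly m a = 0 \<and>
     (\<forall>q\<in>polys_in K. q \<noteq> 0 \<longrightarrow> poly q a = 0 \<longrightarrow> degree m \<le> degree q)"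

lemma minimal_at_degree: "minimal_at K a m \<Longrightarrow> degree m > 0"
  by (rule ccontr) (auto simp: minimal_at_def elim!: degree_eq_zeroE)

lemma minimal_at_exists:
  assumes "p \<in> polys_in K" "p \<noteq> 0" "poly p a = 0"
  obtains m where "minimal_at K a m"
proof -
  let ?P = "\<lambda>m. m \<in> polys_in K \<and> m \<noteq> 0 \<and> poly m a = 0"
  have "?P (arg_min degree ?P)" "\<forall>q. ?P q \<longrightarrow> degree (arg_min degree ?P) \<le> degree q"
    using arg_min_nat_lemma[of ?P p degree] assms by auto
  then show ?thesis by (intro that) (auto simp: minimal_at_def)
qed

lemma minimal_at_dvd:
  assumes "is_subfield K" "minimal_at K a m" "q \<in> polys_in K" "poly q a = 0"
  obtains s where "s \<in> polys_in K" "q = s * m"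
proof -
  obtain s r where sr: "s \<in> polys_in K" "r \<in> polys_in K" "q = s * m + r" "r = 0 \<or> degree r < degree m"
    using polys_in_division[OF assms(1) _ _ assms(3), of m] assms(2) by (auto simp: minimal_at_def)
  with assms(2,4) have "r = 0" by (fastforce simp: minimal_at_def)
  with sr that show ?thesis by auto
qed

text \<open>The inverse of \<open>q(a)\<close>, where \<open>q\<close> has smaller degree than the minimal polynomial \<open>m\<close>, is
  found by induction on that degree: dividing \<open>m\<close> by \<open>q\<close> with remainder \<open>r\<close> gives
  \<open>s(a) q(a) = - r(a)\<close>, and minimality of \<open>m\<close> prevents \<open>s(a)\<close> and \<open>r(a)\<close> from vanishing.\<close>

lemma is_subfield_adjoin:
  assumes K: "is_subfield K" and m: "minimal_at K a m"
  shows "is_subfield (adjoin K a)"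
proof -
  note S = subfield_imp_subring[OF K]
  note P = subringD[OF is_subring_polys_in[OF S]]
  note A = subringD[OF is_subring_adjoin[OF S, of a]]
  have inv: "inverse (poly q a) \<in> adjoin K a" if "q \<in> polys_in K" "poly q a \<noteq> 0" "degree q < degree m" for q
    using that
  proof (induction "degree q" arbitrary: q rule: less_induct)
    case less
    show ?case
    proof (cases "degree q = 0")
      case True
      then obtain c where "q = [:c:]" by (auto elim: degree_eq_zeroE)
      with less.prems K have "inverse (poly q a) \<in> K"
        using polys_inD[of q K 0] by (auto simp: is_subfield_def)
      then show ?thesis using adjoin_superset[OF S] by blast
    next
      case False
      obtain s r where sr: "s \<in> polys_in K" "r \<in> polys_in K" "m = s * q + r" "r = 0 \<or> degree r < degree q"
        using polys_in_division[OF K less.prems(1), of m] m less.prems(2) unfolding minimal_at_def by (metis poly_0)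
      have s0: "s \<noteq> 0" using sr less.prems(3) by auto
      have "degree s < degree m"
      proof -
        have "degree (s * q) = degree s + degree q" using s0 less.prems by (intro degree_mult_eq) auto
        moreover have "degree r < degree (s * q)" if "r \<noteq> 0" using calculation that sr by linarith
        then have "degree m = degree (s * q)" using sr by (cases "r = 0") (auto simp: degree_add_eq_left)
        ultimately show ?thesis using False by linarith
      qed
      then have "poly s a \<noteq> 0" using m sr s0 by (fastforce simp: minimal_at_def)
      moreover have eq: "poly s a * poly q a = - poly r a"
      proof -
        have "poly s a * poly q a + poly r a = poly m a" using sr(3) by simp
        then show ?thesis using m by (simp add: minimal_at_def eq_neg_iff_add_eq_0)
      qed
      ultimately have r0: "poly r a \<noteq> 0" using less.prems by auto
      with sr have dr: "degree r < degree q" by auto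
      have "inverse (poly r a) \<in> adjoin K a"
        using less.hyps[OF dr sr(2) r0] dr less.prems by simp
      moreover have "inverse (poly q a) = - (poly s a * inverse (poly r a))"
        using eq r0 less.prems by (simp add: field_simps eq_neg_iff_add_eq_0)
      moreover have "poly s a \<in> adjoin K a" using sr by (auto simp: adjoin_def)
      ultimately show ?thesis using A by auto
    qed
  qed
  have "inverse y \<in> adjoin K a" if y: "y \<in> adjoin K a" for y
  proof (cases "y = 0")
    case True then show ?thesis using A by simp
  next
    case False
    obtain q where q: "q \<in> polys_in K" "y = poly q a" using y unfolding adjoin_def by blast
    obtain s r where sr: "r \<in> polys_in K" "q = s * m + r" "r = 0 \<or> degree r < degree m"
      using polys_in_division[OF K _ _ q(1), of m] m by (auto simp: minimal_at_def)
    have "y = poly r a" using q sr m by (simp add: minimal_at_def)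
    then show ?thesis using inv[of r] sr False by auto
  qed
  then show ?thesis using is_subring_adjoin[OF S] by (simp add: is_subfield_def)
qed

text \<open>Sending \<open>q(a)\<close> to the value of the transported polynomial at \<open>b\<close> is well defined, since
  two representations of the same element differ by a multiple of \<open>m\<close>, whose transport vanishes
  at \<open>b\<close>.\<close>

lemma hom_on_extend:
  fixes f :: "'a::field \<Rightarrow> 'b::comm_ring_1"
  assumes K: "is_subfield K" and m: "minimal_at K a m"
    and f: "hom_on K f" and b: "poly (map_poly f m) b = 0"
  obtains g where "hom_on (adjoin K a) g" "\<And>x. x \<in> K \<Longrightarrow> g x = f x" "g a = b"
proof -
  note S = subfield_imp_subring[OF K]
  note P = subringD[OF is_subring_polys_in[OF S]]
  note F = hom_onD[OF is_subring_polys_in[OF S] hom_on_map_poly[OF S f]]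
  define g where "g y = poly (map_poly f (SOME q. q \<in> polys_in K \<and> poly q a = y)) b" for y
  have g: "g (poly q a) = poly (map_poly f q) b" if "q \<in> polys_in K" for q
  proof -
    define q' where "q' = (SOME r. r \<in> polys_in K \<and> poly r a = poly q a)"
    have q': "q' \<in> polys_in K \<and> poly q' a = poly q a"
      unfolding q'_def by (rule someI[of _ q]) (use that in auto)
    then have "q' - q \<in> polys_in K" "poly (q' - q) a = 0" using that by (auto intro: P)
    then obtain s where s: "s \<in> polys_in K" "q' - q = s * m"
      by (rule minimal_at_dvd[OF K m])
    have "map_poly f q' - map_poly f q = map_poly f s * map_poly f m"
      using s q' that m F(5)[of q' q] F(6)[of s m] by (auto simp: minimal_at_def)
    then have "poly (map_poly f q') b - poly (map_poly f q) b = 0"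
      using b by (metis mult_zero_right poly_diff poly_mult)
    then show ?thesis by (simp add: g_def q'_def)
  qed
  have const: "g x = f x" if "x \<in> K" for x
    using g[of "[:x:]"] that
    by (simp add: pCons_in_polys_in zero_in_polys_in[OF S] map_poly_pCons hom_onD[OF S f])
  show ?thesis
  proof (rule that[of g])
    show "hom_on (adjoin K a) g"
      unfolding hom_on_def adjoin_def
      by (auto simp: const[OF subringD(1)[OF S]] hom_onD(1)[OF S f] g P F
               simp flip: poly_add poly_mult)
    show "g a = b" using g[of "[:0,1:]"]
      by (simp add: pCons_in_polys_in zero_in_polys_in[OF S] subringD[OF S] map_poly_pCons hom_onD[OF S f])
  qed (use const in auto)
qed

section \<open>Automorphisms of splitting fields\<close>

lemma carrier_splitting_field:
  "carrier (splitting_field f) = generate_field ring_of_type_algebra (\<rat> \<union> roots_of f)"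
  by (simp add: splitting_field_def)

lemma inv_ring_of_type_algebra:
  fixes x :: "'a::field"
  assumes "x \<noteq> 0" shows "inv\<^bsub>ring_of_type_algebra\<^esub> x = inverse x"
proof -
  interpret field "ring_of_type_algebra :: 'a ring" by (rule field_from_type_algebra)
  show ?thesis
    by (rule comm_inv_char[where y = "inverse x"]) (use assms in \<open>auto simp: ring_of_type_algebra_def\<close>)
qed

lemma minus_ring_of_type_algebra:
  fixes x :: "'a::field"
  shows "\<ominus>\<^bsub>ring_of_type_algebra\<^esub> x = - x"
proof -
  interpret field "ring_of_type_algebra :: 'a ring" by (rule field_from_type_algebra)
  have "\<ominus>\<^bsub>ring_of_type_algebra\<^esub> x \<oplus>\<^bsub>ring_of_type_algebra\<^esub> x = \<zero>\<^bsub>ring_of_type_algebra\<^esub>"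
    by (rule l_neg) (simp add: ring_of_type_algebra_def)
  then show ?thesis by (simp add: ring_of_type_algebra_def eq_neg_iff_add_eq_0)
qed

lemma is_subfield_splitting_field: "is_subfield (carrier (splitting_field f))"
proof -
  let ?L = "generate_field ring_of_type_algebra (\<rat> \<union> roots_of f) :: complex set"
  have add: "x + y \<in> ?L" if "x \<in> ?L" "y \<in> ?L" for x y
    using generate_field.eng_add[OF that] by (simp add: ring_of_type_algebra_def)
  have mult: "x * y \<in> ?L" if "x \<in> ?L" "y \<in> ?L" for x y
    using generate_field.eng_mult[OF that] by (simp add: ring_of_type_algebra_def)
  have minus: "- x \<in> ?L" if "x \<in> ?L" for x
    using generate_field.a_inv[OF that] by (simp add: minus_ring_of_type_algebra)
  have inv: "inverse x \<in> ?L" if "x \<in> ?L" for x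
    using generate_field.m_inv[OF that] that
    by (cases "x = 0") (auto simp: inv_ring_of_type_algebra, simp add: ring_of_type_algebra_def)
  have one: "1 \<in> ?L" using generate_field.one[of ring_of_type_algebra] by (simp add: ring_of_type_algebra_def)
  have "x - y \<in> ?L" if "x \<in> ?L" "y \<in> ?L" for x y
    using add[OF that(1) minus[OF that(2)]] by simp
  with mult inv one show ?thesis
    unfolding carrier_splitting_field is_subfield_def is_subring_def by blast
qed

lemma splitting_field_superset: "\<rat> \<union> roots_of f \<subseteq> carrier (splitting_field f)"
  unfolding carrier_splitting_field by (auto intro: generate_field.incl)

lemma splitting_field_least:
  assumes K: "is_subfield K" and "roots_of f \<subseteq> K"
  shows "carrier (splitting_field f) \<subseteq> K"
proof
  note S = subringD[OF subfield_imp_subring[OF K]]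
  fix x assume "x \<in> carrier (splitting_field f)"
  then show "x \<in> K" unfolding carrier_splitting_field
  proof (induction rule: generate_field.induct)
    case one show ?case using S(1) by (simp add: ring_of_type_algebra_def)
  next
    case (incl h) then show ?case using assms Rats_subset_subfield[OF K] by blast
  next
    case (a_inv h) then show ?case using S(3) by (simp add: minus_ring_of_type_algebra)
  next
    case (m_inv h)
    then have "h \<noteq> 0" by (simp add: ring_of_type_algebra_def)
    then show ?case using K m_inv by (simp add: inv_ring_of_type_algebra is_subfield_def)
  next
    case (eng_add x y) then show ?case using S(4) by (simp add: ring_of_type_algebra_def)
  next
    case (eng_mult x y) then show ?case using S(6) by (simp add: ring_of_type_algebra_def)
  qed
qed

text \<open>Fixing the rational numbers is automatic for a field homomorphism, which leaves
  bijectivity and the homomorphism property.\<close>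

lemma mem_carrier_Gal:
  "\<sigma> \<in> carrier (Gal f) \<longleftrightarrow> \<sigma> \<in> extensional (carrier (splitting_field f)) \<and>
     bij_betw \<sigma> (carrier (splitting_field f)) (carrier (splitting_field f)) \<and>
     hom_on (carrier (splitting_field f)) \<sigma>"
    (is "?l \<longleftrightarrow> ?r")
proof -
  let ?L = "carrier (splitting_field f)"
  have ops: "mult (splitting_field f) = (*)" "add (splitting_field f) = (+)" "one (splitting_field f) = 1"
    by (auto simp: splitting_field_def ring_of_type_algebra_def fun_eq_iff)
  have Q: "\<sigma> a = a" if "hom_on ?L \<sigma>" "a \<in> \<rat>" for a
    using hom_on_Rats[OF is_subfield_splitting_field that(1)] that(2) by (auto elim: Rats_cases)
  have "?l \<longleftrightarrow> \<sigma> \<in> ring_iso (splitting_field f) (splitting_field f) \<and> \<sigma> \<in> extensional ?L \<and> (\<forall>a\<in>\<rat>. \<sigma> a = a)"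
    by (simp add: Gal_def galois_group_def conj_assoc)
  moreover have "\<sigma> \<in> ring_iso (splitting_field f) (splitting_field f) \<longleftrightarrow> bij_betw \<sigma> ?L ?L \<and> hom_on ?L \<sigma>"
    unfolding ring_iso_def ring_hom_def hom_on_def ops
    using bij_betw_imp_funcset[of \<sigma> ?L ?L] by blast
  ultimately show ?thesis using Q by blast
qed

lemma Gal_mult:
  assumes "\<sigma> \<in> carrier (Gal f)" "\<tau> \<in> carrier (Gal f)"
  shows "\<sigma> \<otimes>\<^bsub>Gal f\<^esub> \<tau> = compose (carrier (splitting_field f)) \<sigma> \<tau>"
  using assms unfolding mem_carrier_Gal
  by (simp add: Gal_def galois_group_def BijGroup_def Bij_def)

lemma Gal_compose:
  assumes s: "\<sigma> \<in> carrier (Gal f)" and t: "\<tau> \<in> carrier (Gal f)"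
  shows "compose (carrier (splitting_field f)) \<sigma> \<tau> \<in> carrier (Gal f)"
proof -
  let ?L = "carrier (splitting_field f)"
  note S = subringD[OF subfield_imp_subring[OF is_subfield_splitting_field[of f]]]
  have "\<tau> x \<in> ?L" if "x \<in> ?L" for x using t that by (auto simp: mem_carrier_Gal bij_betw_apply)
  then show ?thesis
    using s t S unfolding mem_carrier_Gal
    by (auto simp: hom_on_def compose_eq intro: bij_betw_compose)
qed

lemma Gal_id: "restrict (\<lambda>x. x) (carrier (splitting_field f)) \<in> carrier (Gal f)"
proof -
  note S = subringD[OF subfield_imp_subring[OF is_subfield_splitting_field[of f]]]
  show ?thesis unfolding mem_carrier_Gal
    by (auto simp: hom_on_def S bij_betw_def inj_on_def)
qed

lemma finite_roots_of: "f \<noteq> 0 \<Longrightarrow> finite (roots_of f :: 'a::field_char_0 set)"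
  unfolding roots_of_def by (intro poly_roots_finite) (simp add: map_poly_eq_0_iff)

lemma map_poly_of_rat_in: "map_poly of_rat f \<in> polys_in (\<rat> :: 'a::field_char_0 set)"
  by (auto simp: polys_in_def coeff_map_poly)

lemma map_poly_hom_of_rat:
  fixes g :: "'a::field_char_0 \<Rightarrow> 'b::field_char_0"
  assumes "is_subfield K" "hom_on K g"
  shows "map_poly g (map_poly of_rat f) = map_poly of_rat f"
  using assms
  by (simp add: poly_eq_iff coeff_map_poly hom_on_Rats
      hom_onD(2)[OF subfield_imp_subring[OF assms(1)] assms(2)])

lemma hom_on_roots_of:
  fixes g :: "'a::field_char_0 \<Rightarrow> 'b::field_char_0"
  assumes K: "is_subfield K" and g: "hom_on K g" and "x \<in> K" "x \<in> roots_of f"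
  shows "g x \<in> roots_of f"
  using hom_on_poly[OF subfield_imp_subring[OF K] g, of "map_poly of_rat f" x]
    map_poly_of_rat_in[of f] polys_in_mono[OF Rats_subset_subfield[OF K]] assms
    hom_onD(2)[OF subfield_imp_subring[OF K] g]
  by (auto simp: roots_of_def map_poly_hom_of_rat)

text \<open>The complex numbers are algebraically closed, so the transported minimal polynomial of
  each new root has a root to which that new root can be sent.\<close>

lemma hom_on_extend_finite:
  fixes g :: "complex \<Rightarrow> complex"
  assumes K: "is_subfield K" and g: "hom_on K g" and "finite T" "T \<subseteq> roots_of f" "f \<noteq> 0"
  shows "\<exists>K' g'. is_subfield K' \<and> K \<subseteq> K' \<and> T \<subseteq> K' \<and> hom_on K' g' \<and> (\<forall>x\<in>K. g' x = g x)"
  using assms(3,4)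
proof (induction T rule: finite_induct)
  case empty then show ?case using K g by blast
next
  case (insert a T)
  then obtain K' g' where K': "is_subfield K'" "K \<subseteq> K'" "T \<subseteq> K'" "hom_on K' g'" "\<forall>x\<in>K. g' x = g x"
    by auto
  note S = subfield_imp_subring[OF K'(1)]
  have "map_poly of_rat f \<in> polys_in K'"
    using map_poly_of_rat_in[of f] polys_in_mono[OF Rats_subset_subfield[OF K'(1)]] by blast
  moreover have "map_poly of_rat f \<noteq> (0 :: complex poly)" using \<open>f \<noteq> 0\<close> by (simp add: map_poly_eq_0_iff)
  moreover have "poly (map_poly of_rat f) a = 0" using insert.prems by (auto simp: roots_of_def)
  ultimately obtain m where m: "minimal_at K' a m" by (rule minimal_at_exists)
  have "degree m \<noteq> 0" using minimal_at_degree[OF m] by simp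
  moreover have "coeff (map_poly g' m) (degree m) \<noteq> 0"
    using m hom_on_field(2)[OF K'(1,4), of "lead_coeff m"]
    by (auto simp: minimal_at_def coeff_map_poly_hom[OF S K'(4)] polys_inD)
  ultimately have "degree (map_poly g' m) \<noteq> 0" by (metis le_degree le_zero_eq)
  then obtain b where b: "poly (map_poly g' m) b = 0"
    using alg_closed_imp_poly_has_root[of "map_poly g' m"] by auto
  obtain h where "hom_on (adjoin K' a) h" "\<And>x. x \<in> K' \<Longrightarrow> h x = g' x"
    using hom_on_extend[OF K'(1) m K'(4) b] by metis
  moreover have "is_subfield (adjoin K' a)" by (rule is_subfield_adjoin[OF K'(1) m])
  ultimately show ?case
    using adjoin_superset[OF S, of a] adjoin_mem[OF S, of a] K'
    by (intro exI[of _ "adjoin K' a"] exI[of _ h]) auto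
qed

text \<open>An embedding permutes the finitely many roots of \<open>f\<close>, hence it maps the field
  generated by them onto itself.\<close>

lemma restrict_hom_in_Gal:
  assumes K: "is_subfield K" "carrier (splitting_field f) \<subseteq> K" and g: "hom_on K g" and "f \<noteq> 0"
  shows "restrict g (carrier (splitting_field f)) \<in> carrier (Gal f)"
proof -
  let ?L = "carrier (splitting_field f)"
  note L = is_subfield_splitting_field[of f]
  note LS = subringD[OF subfield_imp_subring[OF L]]
  have gL: "hom_on ?L g" using g K(2) by (rule hom_on_subset)
  note G = hom_onD[OF subfield_imp_subring[OF L] gL]
  have R: "roots_of f \<subseteq> ?L" using splitting_field_superset by blast
  have inj: "inj_on g ?L" by (rule hom_on_inj[OF L gL])
  have "g ` roots_of f \<subseteq> roots_of f" using hom_on_roots_of[OF L gL] R by blast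
  then have img: "g ` roots_of f = roots_of f"
    using endo_inj_surj[OF finite_roots_of[OF \<open>f \<noteq> 0\<close>]] inj R by (blast intro: inj_on_subset)
  have "is_subfield {x \<in> ?L. g x \<in> ?L}"
    using L LS G hom_on_field(1)[OF L gL] by (auto simp: is_subfield_def is_subring_def)
  then have "?L \<subseteq> {x \<in> ?L. g x \<in> ?L}"
    by (rule splitting_field_least) (use R img in auto)
  then have sub: "g ` ?L \<subseteq> ?L" by blast
  have "is_subfield (g ` ?L)"
    unfolding is_subfield_def is_subring_def
  proof (intro conjI ballI)
    show "1 \<in> g ` ?L" using LS(1) G(1) by (metis imageI)
    fix x assume "x \<in> g ` ?L"
    then obtain u where u: "u \<in> ?L" "x = g u" by blast
    show "inverse x \<in> g ` ?L"
      using u hom_on_field(1)[OF L gL u(1)] L by (metis imageI is_subfield_def)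
    fix y assume "y \<in> g ` ?L"
    then obtain v where v: "v \<in> ?L" "y = g v" by blast
    show "x - y \<in> g ` ?L" using u v G(5)[of u v] LS(5)[of u v] by (metis imageI)
    show "x * y \<in> g ` ?L" using u v G(6)[of u v] LS(6)[of u v] by (metis imageI)
  qed
  then have "?L \<subseteq> g ` ?L"
    by (rule splitting_field_least) (use R img in blast)
  with sub inj have "bij_betw g ?L ?L" by (auto simp: bij_betw_def)
  then have "bij_betw (restrict g ?L) ?L ?L" by (simp cong: bij_betw_cong)
  moreover have "hom_on ?L (restrict g ?L)" using gL LS by (auto simp: hom_on_def)
  ultimately show ?thesis by (simp add: mem_carrier_Gal)
qed

lemma rsquarefree_dvd:
  assumes "rsquarefree p" "q dvd p" shows "rsquarefree (q :: 'a::field_char_0 poly)"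
proof -
  obtain s where s: "p = q * s" using assms(2) by blast
  show ?thesis
    using assms(1) unfolding rsquarefree_roots s by (auto simp: pderiv_mult)
qed

lemma card_roots_rsquarefree:
  assumes "rsquarefree (p :: complex poly)"
  shows "card {z. poly p z = 0} = degree p"
proof -
  have "p \<noteq> 0" using assms by (auto simp: rsquarefree_def)
  have "degree p = degree (smult (lead_coeff p) (\<Prod>z | poly p z = 0. [:- z, 1:]))"
    by (simp add: complex_poly_decompose_rsquarefree[OF assms])
  also have "\<dots> = card {z. poly p z = 0}"
    using \<open>p \<noteq> 0\<close> by (simp add: degree_prod_eq_sum_degree)
  finally show ?thesis by simp
qed

text \<open>A polynomial that takes the value \<open>c\<close> at more points than its degree is constant.\<close>

lemma constant_on_roots_imp_constant_poly:
  fixes m q :: "complex poly"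
  assumes "rsquarefree m" "degree q < degree m" "\<And>b. poly m b = 0 \<Longrightarrow> poly q b = c"
  shows "q = [:c:]"
proof (rule ccontr)
  assume "q \<noteq> [:c:]"
  then have 0: "q - [:c:] \<noteq> 0" by simp
  have "m \<noteq> 0" using assms(2) by auto
  have "degree m = card {b. poly m b = 0}"
    using card_roots_rsquarefree[OF assms(1)] by simp
  also have "\<dots> \<le> card {b. poly (q - [:c:]) b = 0}"
    using assms(3) 0 by (intro card_mono poly_roots_finite) auto
  also have "\<dots> \<le> degree (q - [:c:])" by (rule card_poly_roots_bound[OF 0])
  also have "\<dots> \<le> max (degree q) (degree [:c:])" by (rule degree_diff_le_max)
  finally show False using assms(2) by simp
qed

text \<open>One root \<open>a\<close> is adjoined at a time. Write an element fixed by all embeddings as \<open>q(a)\<close>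
  with \<open>q\<close> of smaller degree than the minimal polynomial \<open>m\<close> of \<open>a\<close> over the previous field \<open>K\<close>.
  For each root \<open>b\<close> of \<open>m\<close> some embedding fixes \<open>K\<close> and sends \<open>a\<close> to \<open>b\<close>, so \<open>q\<close> takes the same
  value at all roots of \<open>m\<close>. These are distinct, whence \<open>q\<close> is constant and the element lies
  in \<open>K\<close>.\<close>

lemma fixed_field_of_roots:
  assumes f: "rsquarefree (map_poly of_rat f :: complex poly)"
    and "finite T" "T \<subseteq> (roots_of f :: complex set)"
  shows "\<exists>K. is_subfield K \<and> T \<subseteq> K \<and>
    (\<forall>x\<in>K. (\<forall>K' g. is_subfield K' \<and> K \<subseteq> K' \<and> roots_of f \<subseteq> K' \<and> hom_on K' g \<longrightarrow> g x = x) \<longrightarrow> x \<in> \<rat>)"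
  using assms(2,3)
proof (induction T rule: finite_induct)
  case empty then show ?case using subfield_Rats by blast
next
  case (insert a T)
  then obtain K where K: "is_subfield K" "T \<subseteq> K" 
    and fixD: "\<And>x. x \<in> K \<Longrightarrow> (\<forall>K' g. is_subfield K' \<and> K \<subseteq> K' \<and> roots_of f \<subseteq> K' \<and> hom_on K' g \<longrightarrow> g x = x) \<Longrightarrow> x \<in> \<rat>"
    by auto
  note S = subfield_imp_subring[OF K(1)]
  have f0: "f \<noteq> 0" using f by (auto simp: rsquarefree_def)
  have fK: "map_poly of_rat f \<in> polys_in K"
    using map_poly_of_rat_in[of f] polys_in_mono[OF Rats_subset_subfield[OF K(1)]] by blast
  have fa: "poly (map_poly of_rat f) a = 0" using insert.prems by (auto simp: roots_of_def)
  obtain m where m: "minimal_at K a m"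
    by (rule minimal_at_exists[OF fK _ fa]) (use f in \<open>auto simp: rsquarefree_def\<close>)
  then have mD: "m \<in> polys_in K" "m \<noteq> 0" "poly m a = 0" by (auto simp: minimal_at_def)
  have "m dvd map_poly of_rat f" using minimal_at_dvd[OF K(1) m fK fa] by (metis dvd_triv_right)
  then have sqf: "rsquarefree m" using f rsquarefree_dvd by blast
  let ?A = "adjoin K a"
  have A: "is_subfield ?A" by (rule is_subfield_adjoin[OF K(1) m])
  have KA: "K \<subseteq> ?A" and aA: "a \<in> ?A" using adjoin_superset[OF S] adjoin_mem[OF S] by auto
  have "x \<in> \<rat>" if x: "x \<in> ?A"
    and fixed: "\<And>K' g. is_subfield K' \<Longrightarrow> ?A \<subseteq> K' \<Longrightarrow> roots_of f \<subseteq> K' \<Longrightarrow> hom_on K' g \<Longrightarrow> g x = x" for x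
  proof -
    obtain p where p: "p \<in> polys_in K" "x = poly p a" using x unfolding adjoin_def by blast
    obtain s q where sq: "q \<in> polys_in K" "p = s * m + q" "q = 0 \<or> degree q < degree m"
      using polys_in_division[OF K(1) mD(1,2) p(1)] by blast
    have xq: "x = poly q a" using p sq mD by simp
    have dq: "degree q < degree m" using sq minimal_at_degree[OF m] by auto
    have "poly q b = x" if b: "poly m b = 0" for b
    proof -
      have idK: "hom_on K (\<lambda>x. x)" by (simp add: hom_on_def)
      obtain g where g: "hom_on ?A g" "\<And>x. x \<in> K \<Longrightarrow> g x = x" "g a = b"
        by (rule hom_on_extend[OF K(1) m idK, of b]) (use b in \<open>auto simp: map_poly_idI\<close>)
      obtain K' g' where K': "is_subfield K'" "?A \<subseteq> K'" "roots_of f \<subseteq> K'" "hom_on K' g'" "\<forall>x\<in>?A. g' x = g x"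
        using hom_on_extend_finite[OF A g(1) finite_roots_of[OF f0] order_refl f0] by blast
      have "map_poly g q = q"
        using g(2) polys_inD[OF sq(1)] subringD(2)[OF S] by (simp add: poly_eq_iff coeff_map_poly)
      moreover have "g x = poly (map_poly g q) (g a)"
        unfolding xq using polys_in_mono[OF KA] sq(1) aA
        by (intro hom_on_poly[OF subfield_imp_subring[OF A] g(1)]) auto
      ultimately show ?thesis using fixed[OF K'(1-4)] K'(5) x g(3) by auto
    qed
    from constant_on_roots_imp_constant_poly[OF sqf dq this] have "q = [:x:]" .
    then have "x \<in> K" using polys_inD[OF sq(1), of 0] by simp
    moreover have "g x = x" if "is_subfield K'" "K \<subseteq> K'" "roots_of f \<subseteq> K'" "hom_on K' g" for K' g
    proof (rule fixed[OF that(1) _ that(3,4)])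
      show "?A \<subseteq> K'" using that insert.prems by (intro adjoin_least subfield_imp_subring) auto
    qed
    ultimately show ?thesis using fixD by blast
  qed
  then show ?case using A KA aA K(2) by (intro exI[of _ ?A]) auto
qed

text \<open>Every embedding of a field containing \<open>L\<close> restricts to an automorphism of \<open>L\<close>, so an
  element fixed by the Galois group is fixed by all embeddings.\<close>

theorem fixed_field_Gal:
  assumes f: "rsquarefree (map_poly of_rat f :: complex poly)"
    and x: "x \<in> carrier (splitting_field f)" "\<And>\<sigma>. \<sigma> \<in> carrier (Gal f) \<Longrightarrow> \<sigma> x = x"
  shows "x \<in> \<rat>"
proof -
  have f0: "f \<noteq> 0" using f by (auto simp: rsquarefree_def)
  obtain K :: "complex set" where K: "is_subfield K" "roots_of f \<subseteq> K"
     "\<And>x. x \<in> K \<Longrightarrow> (\<forall>K' g. is_subfield K' \<and> K \<subseteq> K' \<and> roots_of f \<subseteq> K' \<and> hom_on K' g \<longrightarrow> g x = x) \<Longrightarrow> x \<in> \<rat>"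
    using fixed_field_of_roots[OF f finite_roots_of[OF f0] order_refl] by auto
  have LK: "carrier (splitting_field f) \<subseteq> K" by (rule splitting_field_least[OF K(1,2)])
  show ?thesis
  proof (rule K(3))
    show "x \<in> K" using LK x by blast
    show "\<forall>K' g. is_subfield K' \<and> K \<subseteq> K' \<and> roots_of f \<subseteq> K' \<and> hom_on K' g \<longrightarrow> g x = x"
    proof (intro allI impI)
      fix K' and g :: "complex \<Rightarrow> complex" assume *: "is_subfield K' \<and> K \<subseteq> K' \<and> roots_of f \<subseteq> K' \<and> hom_on K' g"
      then have "restrict g (carrier (splitting_field f)) \<in> carrier (Gal f)"
        using LK f0 by (intro restrict_hom_in_Gal[of K']) auto
      from x(2)[OF this] show "g x = x" using x(1) by simp
    qed
  qed
qed

section \<open>Valuation rings\<close>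

definition valuation_ring :: "'a::field set \<Rightarrow> bool" where
  "valuation_ring B \<longleftrightarrow> is_subring B \<and> (\<forall>x. x \<in> B \<or> inverse x \<in> B)"

text \<open>Stated for a subring of a commutative ring, so that it applies both to rings of complex
  numbers and to rings of polynomials over them.\<close>

definition prime_ideal_of :: "'a::comm_ring_1 set \<Rightarrow> 'a set \<Rightarrow> bool" where
  "prime_ideal_of B I \<longleftrightarrow> I \<subseteq> B \<and> 0 \<in> I \<and> 1 \<notin> I \<and> (\<forall>x\<in>I. \<forall>y\<in>I. x + y \<in> I) \<and>
     (\<forall>r\<in>B. \<forall>x\<in>I. r * x \<in> I) \<and> (\<forall>x\<in>B. \<forall>y\<in>B. x * y \<in> I \<longrightarrow> x \<in> I \<or> y \<in> I)"

lemma degree_less_if_coeff_0: "degree p \<le> n \<Longrightarrow> coeff p n = 0 \<Longrightarrow> n > 0 \<Longrightarrow> degree p < n"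
  by (metis leading_coeff_0_iff degree_0 order_le_less)

text \<open>If \<open>w = 1 - c b\<close> were not invertible in \<open>B\<close>, then by maximality \<open>1/c\<close> would be a
  polynomial in \<open>1/w\<close> over \<open>B\<close>; clearing denominators, some power of \<open>w\<close> would be a multiple of \<open>c\<close>.
  But every power of \<open>w\<close> is 1 minus a multiple of \<open>c\<close>, so \<open>1/c\<close> would lie in \<open>B\<close>.\<close>

lemma maximal_without_inverse_unit:
  fixes c :: "'a::field"
  assumes B: "is_subring B" and c: "c \<in> B" "inverse c \<notin> B"
    and max: "\<And>C. is_subring C \<Longrightarrow> B \<subseteq> C \<Longrightarrow> inverse c \<notin> C \<Longrightarrow> C = B"
    and b: "b \<in> B"
  shows "inverse (1 - c * b) \<in> B" "1 - c * b \<noteq> 0"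
proof -
  note S = subringD[OF B]
  have c0: "c \<noteq> 0" using c S by auto
  define w where "w = 1 - c * b"
  have no: "c * s \<noteq> 1" if "s \<in> B" for s using c(2) that by (metis inverse_unique)
  show w0: "1 - c * b \<noteq> 0" using no[OF b] by auto
  have wn: "\<exists>t\<in>B. w ^ n = 1 - c * t" for n
  proof (induction n)
    case 0 then show ?case using S(2) by (intro bexI[of _ 0]) auto
  next
    case (Suc n)
    then obtain t where t: "t \<in> B" "w ^ n = 1 - c * t" by blast
    have "w ^ Suc n = (1 - c * b) * (1 - c * t)"
      using t by (simp add: w_def)
    also have "\<dots> = 1 - c * (b + t - c * b * t)" by (simp add: algebra_simps)
    finally have "w ^ Suc n = 1 - c * (b + t - c * b * t)" .
    moreover have "b + t - c * b * t \<in> B" by (intro S b t c)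
    ultimately show ?case by blast
  qed
  show "inverse (1 - c * b) \<in> B"
  proof (rule ccontr)
    assume *: "inverse (1 - c * b) \<notin> B"
    let ?C = "adjoin B (inverse w)"
    have "?C \<noteq> B" using adjoin_mem[OF B, of "inverse w"] * by (auto simp: w_def)
    then have "inverse c \<in> ?C" using max[OF is_subring_adjoin[OF B] adjoin_superset[OF B]] by blast
    then obtain f where f: "f \<in> polys_in B" "inverse c = poly f (inverse w)" unfolding adjoin_def by blast
    let ?n = "degree f"
    have "w ^ ?n * inverse c = (\<Sum>i\<le>?n. coeff f i * w ^ (?n - i))"
      unfolding f(2) poly_altdef sum_distrib_left
    proof (rule sum.cong)
      fix i assume "i \<in> {..?n}"
      then have "w ^ ?n = w ^ (?n - i) * w ^ i" by (simp flip: power_add)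
      then show "w ^ ?n * (coeff f i * inverse w ^ i) = coeff f i * w ^ (?n - i)"
        using w0 by (simp add: w_def field_simps)
    qed simp
    moreover have "(\<Sum>i\<le>?n. coeff f i * w ^ (?n - i)) \<in> B"
      unfolding w_def by (intro subring_sum[OF B] S subring_power[OF B] polys_inD[OF f(1)] c b)
    moreover obtain t where "t \<in> B" "w ^ ?n = 1 - c * t" using wn by blast
    ultimately have "(1 - c * t) * inverse c + t \<in> B" using S by auto
    moreover have "(1 - c * t) * inverse c + t = inverse c" using c0 by (simp add: field_simps)
    ultimately show False using c by simp
  qed
qed

text \<open>The degree reduction in Chevalley's theorem on the existence of valuation rings: the
  relation for \<open>1/y\<close>, multiplied by \<open>y^k\<close>, expresses \<open>y^k\<close> by lower powers of \<open>y\<close>, and this replaces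
  the leading term of the relation for \<open>y\<close>.\<close>

lemma maximal_without_inverse_reduce:
  fixes c :: "'a::field"
  assumes B: "is_subring B" and c: "c \<in> B" "inverse c \<notin> B"
    and max: "\<And>C. is_subring C \<Longrightarrow> B \<subseteq> C \<Longrightarrow> inverse c \<notin> C \<Longrightarrow> C = B"
    and f: "f \<in> polys_in B" "poly f y = inverse c"
    and g: "g \<in> polys_in B" "poly g (inverse y) = inverse c" "degree g \<le> degree f"
    and y: "y \<noteq> 0"
  obtains f' where "f' \<in> polys_in B" "poly f' y = inverse c" "degree f' < degree f"
proof -
  note S = subringD[OF B]
  note P = subringD[OF is_subring_polys_in[OF B]]
  have c0: "c \<noteq> 0" using c S by auto
  define n k where "n = degree f" and "k = degree g"
  define b where "b = coeff g 0"
  have b: "b \<in> B" using g(1) by (simp add: b_def polys_in_def)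
  note unit = maximal_without_inverse_unit[OF B c max b]
  have k0: "k > 0"
  proof (rule ccontr)
    assume "\<not> k > 0"
    then have "g = [:b:]" by (auto simp: k_def b_def elim!: degree_eq_zeroE)
    then show False using g(2) b c by simp
  qed
  \<comment> \<open>so that \<open>y^k / c = b y^k + r(y)\<close>\<close>
  define r where "r = reflect_poly g - monom b k"
  have rB: "r \<in> polys_in B"
  proof -
    have "reflect_poly g \<in> polys_in B"
      using g(1) S(2) by (auto simp: polys_in_def coeff_reflect_poly)
    then show ?thesis unfolding r_def by (intro P monom_in_polys_in[OF B b])
  qed
  have "degree r \<le> k"
    unfolding r_def using degree_reflect_poly_le[of g] degree_monom_le[of b k]
    by (intro degree_diff_le) (auto simp: k_def)
  moreover have "coeff r k = 0" by (simp add: r_def coeff_reflect_poly k_def b_def)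
  ultimately have dr: "degree r < k" using k0 by (rule degree_less_if_coeff_0)
  have "poly (reflect_poly g) y = y ^ k * inverse c"
    using y g(2) by (simp add: poly_reflect_poly_nz k_def)
  then have "c * poly r y = y ^ k * (1 - c * b)"
    using c0 by (simp add: r_def poly_monom algebra_simps)
  then have yk: "y ^ k = inverse (1 - c * b) * c * poly r y"
    using unit(2) by (simp add: field_simps)
  define G where "G = [:inverse (1 - c * b) * c:] * r"
  have "G \<in> polys_in B"
    unfolding G_def by (intro P(6) pCons_in_polys_in zero_in_polys_in S B unit c rB)
  moreover have "degree G < k" "poly G y = y ^ k"
    unfolding G_def using dr yk by (auto intro: le_less_trans[OF degree_smult_le])
  ultimately have G: "G \<in> polys_in B" "degree G < k" "poly G y = y ^ k" by auto
  define a where "a = lead_coeff f"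
  have a: "a \<in> B" using f(1) by (simp add: a_def polys_in_def)
  \<comment> \<open>the leading term \<open>a y^n\<close> is rewritten as \<open>a y^(n-k) G(y)\<close>\<close>
  define f' where "f' = (f - monom a n) + monom a (n - k) * G"
  have kn: "k \<le> n" using g(3) by (simp add: k_def n_def)
  show ?thesis
  proof (rule that[of f'])
    show "f' \<in> polys_in B" unfolding f'_def by (intro P f G monom_in_polys_in[OF B a])
    have "y ^ n = y ^ (n - k) * y ^ k" using kn by (simp flip: power_add)
    then show "poly f' y = inverse c" by (simp add: f'_def f(2) poly_monom G(3))
    have "degree (f - monom a n) < n"
    proof (rule degree_less_if_coeff_0)
      show "degree (f - monom a n) \<le> n" using degree_monom_le[of a n] by (intro degree_diff_le) (auto simp: n_def)
    qed (use k0 kn in \<open>auto simp: a_def n_def\<close>)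
    moreover have "degree (monom a (n - k) * G) < n"
      using degree_mult_le[of "monom a (n - k)" G] degree_monom_le[of a "n - k"] G(2) kn by linarith
    ultimately show "degree f' < degree f" unfolding f'_def by (simp add: degree_add_less n_def)
  qed
qed

text \<open>A subring that is maximal among those avoiding \<open>1/c\<close> is a valuation ring: if neither \<open>y\<close>
  nor \<open>1/y\<close> belonged to it, then \<open>1/c\<close> would be a polynomial in each of them, and of two such
  polynomials of least degree one could be shortened by the other.\<close>

lemma exists_valuation_ring:
  fixes c :: "'a::field"
  assumes A: "is_subring A" "c \<in> A" "inverse c \<notin> A"
  obtains B where "valuation_ring B" "A \<subseteq> B" "inverse c \<notin> B"
proof -
  define F where "F = {B. is_subring B \<and> A \<subseteq> B \<and> inverse c \<notin> B}"
  have "\<exists>M\<in>F. \<forall>U\<in>F. M \<subseteq> U \<longrightarrow> U = M"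
  proof (rule subset_Zorn_nonempty)
    show "F \<noteq> {}" using A by (auto simp: F_def)
    fix Ch assume ne: "Ch \<noteq> {}" and ch: "subset.chain F Ch"
    have C: "\<And>B. B \<in> Ch \<Longrightarrow> is_subring B \<and> A \<subseteq> B \<and> inverse c \<notin> B"
      using ch by (auto simp: subset.chain_def F_def)
    have "x - y \<in> \<Union>Ch \<and> x * y \<in> \<Union>Ch" if xy: "x \<in> \<Union>Ch" "y \<in> \<Union>Ch" for x y
    proof -
      obtain U Y where "U \<in> Ch" "x \<in> U" "Y \<in> Ch" "y \<in> Y" using xy by blast
      moreover from this have "U \<subseteq> Y \<or> Y \<subseteq> U" using ch by (auto simp: subset_chain_def)
      ultimately obtain Z where Z: "Z \<in> Ch" "x \<in> Z" "y \<in> Z" by blast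
      have "is_subring Z" using C[OF Z(1)] by blast
      from subringD(5,6)[OF this Z(2,3)] Z(1) show ?thesis by blast
    qed
    moreover have "1 \<in> \<Union>Ch" using ne C by (auto simp: is_subring_def)
    ultimately have "is_subring (\<Union>Ch)" by (simp add: is_subring_def)
    then show "\<Union>Ch \<in> F" using ne C by (auto simp: F_def)
  qed
  then obtain B where "B \<in> F" and max: "\<And>C. C \<in> F \<Longrightarrow> B \<subseteq> C \<Longrightarrow> C = B"
    by blast
  then have B: "is_subring B" "A \<subseteq> B" "inverse c \<notin> B" by (auto simp: F_def)
  have cB: "c \<in> B" using A B by blast
  have max': "C = B" if "is_subring C" "B \<subseteq> C" "inverse c \<notin> C" for C
    using max[of C] that B(2) by (auto simp: F_def)
  have ex: "\<exists>f. f \<in> polys_in B \<and> poly f y = inverse c" if "y \<notin> B" for y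
  proof -
    have "adjoin B y \<noteq> B" using adjoin_mem[OF B(1)] that by blast
    then have "inverse c \<in> adjoin B y" using max'[OF is_subring_adjoin adjoin_superset] B(1) by blast
    then show ?thesis unfolding adjoin_def by (metis imageE)
  qed
  have "y \<in> B \<or> inverse y \<in> B" for y
  proof (rule ccontr)
    assume *: "\<not> ?thesis"
    have y0: "y \<noteq> 0" using * subringD(2)[OF B(1)] by auto
    have least: "\<exists>f. f \<in> polys_in B \<and> poly f z = inverse c \<and>
       (\<forall>f'. f' \<in> polys_in B \<and> poly f' z = inverse c \<longrightarrow> degree f \<le> degree f')" if "z \<notin> B" for z
      using ex_has_least_nat[of "\<lambda>f. f \<in> polys_in B \<and> poly f z = inverse c" _ degree] ex[OF that] by blast
    obtain f where f: "f \<in> polys_in B" "poly f y = inverse c"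
      "\<And>f'. f' \<in> polys_in B \<Longrightarrow> poly f' y = inverse c \<Longrightarrow> degree f \<le> degree f'" using least[of y] * by blast
    obtain g where g: "g \<in> polys_in B" "poly g (inverse y) = inverse c"
      "\<And>f'. f' \<in> polys_in B \<Longrightarrow> poly f' (inverse y) = inverse c \<Longrightarrow> degree g \<le> degree f'"
      using least[of "inverse y"] * by blast
    show False
    proof (cases "degree g \<le> degree f")
      case True
      obtain f' where "f' \<in> polys_in B" "poly f' y = inverse c" "degree f' < degree f"
        by (rule maximal_without_inverse_reduce[OF B(1) cB B(3) max' f(1,2) g(1,2) True y0])
      then show False using f(3)[of f'] by simp
    next
      case False
      obtain f' where "f' \<in> polys_in B" "poly f' (inverse y) = inverse c" "degree f' < degree g"
        by (rule maximal_without_inverse_reduce[OF B(1) cB B(3) max' g(1,2) f(1), of ])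
           (use f(2) False y0 in auto)
      then show False using g(3)[of f'] by simp
    qed
  qed
  then have "valuation_ring B" using B(1) by (simp add: valuation_ring_def)
  with B that show ?thesis by blast
qed

text \<open>If \<open>1/x\<close> belongs to the ring, then dividing the monic equation of \<open>x\<close> by a power of \<open>x\<close>
  expresses \<open>x\<close> as a polynomial in \<open>1/x\<close>.\<close>

lemma algebraic_int_in_valuation_ring:
  assumes B: "valuation_ring B" and x: "algebraic_int (x :: 'a::field_char_0)"
  shows "x \<in> B"
proof (rule ccontr)
  assume xB: "x \<notin> B"
  have R: "is_subring B" using B by (simp add: valuation_ring_def)
  note S = subringD[OF R]
  have x0: "x \<noteq> 0" and ix: "inverse x \<in> B" using xB S B by (auto simp: valuation_ring_def)
  obtain p where p: "lead_coeff p = 1" "\<forall>i. coeff p i \<in> \<int>" "poly p x = 0"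
    using x by (auto simp: algebraic_int.simps)
  have pB: "coeff p i \<in> B" for i using p(2) subring_of_int[OF R] by (metis Ints_cases)
  obtain n where n: "degree p = Suc n"
    using p by (cases "degree p") (auto elim!: degree_eq_zeroE)
  have "x ^ Suc n = - (\<Sum>i\<le>n. coeff p i * x ^ i)"
    using p(1,3) n by (simp add: poly_altdef eq_neg_iff_add_eq_0 add.commute)
  then have "inverse x ^ n * x ^ Suc n = - (\<Sum>i\<le>n. inverse x ^ n * (coeff p i * x ^ i))"
    by (simp add: sum_distrib_left)
  also have "inverse x ^ n * x ^ Suc n = x" using x0 by (simp add: field_simps)
  also have "(\<Sum>i\<le>n. inverse x ^ n * (coeff p i * x ^ i)) = (\<Sum>i\<le>n. coeff p i * inverse x ^ (n - i))"
  proof (rule sum.cong)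
    fix i assume "i \<in> {..n}"
    then have "inverse x ^ n = inverse x ^ (n - i) * inverse x ^ i" by (simp flip: power_add)
    then show "inverse x ^ n * (coeff p i * x ^ i) = coeff p i * inverse x ^ (n - i)"
      using x0 by (simp add: field_simps)
  qed simp
  also have "- \<dots> \<in> B"
    by (intro S subring_sum[OF R] pB subring_power[OF R] ix)
  finally show False using xB by simp
qed

text \<open>Of two nonzero nonunits one divides the other, so their sum is again a multiple of a
  nonunit.\<close>

lemma prime_ideal_nonunits:
  fixes B :: "'a::field set"
  assumes B: "valuation_ring B"
  shows "prime_ideal_of B {x \<in> B. x = 0 \<or> inverse x \<notin> B}" (is "prime_ideal_of B ?m")
proof -
  have R: "is_subring B" and V: "\<And>x. x \<in> B \<or> inverse x \<in> B" using B by (auto simp: valuation_ring_def)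
  note S = subringD[OF R]
  have mult: "r * x \<in> ?m" if "r \<in> B" "x \<in> ?m" for r x
  proof -
    have "inverse x = r * inverse (r * x)" if "r * x \<noteq> 0" using that by (simp add: field_simps)
    then show ?thesis using that S by (metis (mono_tags, lifting) mem_Collect_eq mult_zero_right)
  qed
  have add: "x + y \<in> ?m" if xy: "x \<in> ?m" "y \<in> ?m" for x y
  proof (cases "x = 0 \<or> y = 0")
    case False
    have *: "u + v \<in> ?m" if "u \<in> B" "v \<in> ?m" "v \<noteq> 0" "u * inverse v \<in> B" for u v
    proof -
      have "u + v = (u * inverse v + 1) * v" using that by (simp add: field_simps)
      then show ?thesis using mult[of "u * inverse v + 1" v] that S by simp
    qed
    have "x * inverse y \<in> B \<or> y * inverse x \<in> B" using V[of "x * inverse y"] by (simp add: mult.commute)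
    then show ?thesis using *[of x y] *[of y x] xy False by (auto simp: add.commute)
  qed (use xy in auto)
  have prime: "x \<in> ?m \<or> y \<in> ?m" if "x \<in> B" "y \<in> B" "x * y \<in> ?m" for x y
    using that S(6)[of "inverse x" "inverse y"] by (auto simp: mult.commute)
  show ?thesis unfolding prime_ideal_of_def
    using mult add prime S by auto
qed

theorem exists_prime_over:
  assumes p: "prime (p::nat)"
  obtains B m :: "'a::field_char_0 set" where "is_subring B" "prime_ideal_of B m" "of_nat p \<in> m"
    "\<And>x. algebraic_int x \<Longrightarrow> x \<in> B"
proof -
  have Z: "is_subring (\<int> :: 'a set)" by (simp add: is_subring_def)
  have "inverse (of_nat p) \<notin> (\<int> :: 'a set)"
  proof
    assume "inverse (of_nat p) \<in> (\<int> :: 'a set)"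
    then obtain k where "inverse (of_nat p) = (of_int k :: 'a)" by (auto elim: Ints_cases)
    then have "of_int (int p * k) = (of_int 1 :: 'a)" using p by (simp add: field_simps prime_gt_0_nat)
    then have "int p * k = 1" by (metis of_int_eq_iff)
    then have "int p dvd 1" by (metis dvd_triv_left)
    then show False using p not_prime_unit[of "int p"] by simp
  qed
  then obtain B :: "'a set" where B: "valuation_ring B" "\<int> \<subseteq> B" "inverse (of_nat p) \<notin> B"
    using exists_valuation_ring[OF Z, of "of_nat p"] by auto
  show ?thesis
    by (rule that[of B "{x \<in> B. x = 0 \<or> inverse x \<notin> B}"])
       (use B prime_ideal_nonunits[OF B(1)] algebraic_int_in_valuation_ring[OF B(1)] in \<open>auto simp: valuation_ring_def\<close>)
qed

section \<open>Prime ideals and the Frobenius map\<close>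

text \<open>The elements on which two automorphisms agree form a subfield.\<close>

lemma Gal_eqI:
  assumes s: "\<sigma> \<in> carrier (Gal f)" and t: "\<tau> \<in> carrier (Gal f)"
    and eq: "\<And>a. a \<in> roots_of f \<Longrightarrow> \<sigma> a = \<tau> a"
  shows "\<sigma> = \<tau>"
proof -
  let ?L = "carrier (splitting_field f)"
  note L = is_subfield_splitting_field[of f]
  note LS = subringD[OF subfield_imp_subring[OF L]]
  have hs: "hom_on ?L \<sigma>" and ht: "hom_on ?L \<tau>" using s t by (auto simp: mem_carrier_Gal)
  note H = hom_onD[OF subfield_imp_subring[OF L] hs] hom_onD[OF subfield_imp_subring[OF L] ht]
    hom_on_field(1)[OF L hs] hom_on_field(1)[OF L ht]
  have "is_subfield {x \<in> ?L. \<sigma> x = \<tau> x}"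
    using L LS H by (auto simp: is_subfield_def is_subring_def)
  then have "?L \<subseteq> {x \<in> ?L. \<sigma> x = \<tau> x}"
    by (rule splitting_field_least) (use eq splitting_field_superset in blast)
  then show ?thesis using s t by (intro extensionalityI[of \<sigma> ?L]) (auto simp: mem_carrier_Gal)
qed

lemma Gal_root:
  assumes "\<sigma> \<in> carrier (Gal f)" "a \<in> roots_of f" shows "\<sigma> a \<in> roots_of f"
  using assms hom_on_roots_of[OF is_subfield_splitting_field, of f \<sigma> a f] splitting_field_superset[of f]
  by (auto simp: mem_carrier_Gal)

lemma finite_Gal:
  assumes "f \<noteq> 0" shows "finite (carrier (Gal f))"
proof (rule finite_imageD)
  let ?R = "roots_of f :: complex set"
  show "finite ((\<lambda>\<sigma>. restrict \<sigma> ?R) ` carrier (Gal f))"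
    using finite_roots_of[OF assms] Gal_root
    by (intro finite_subset[OF _ finite_PiE[of ?R "\<lambda>_. ?R"]]) auto
  show "inj_on (\<lambda>\<sigma>. restrict \<sigma> ?R) (carrier (Gal f))"
  proof (rule inj_onI)
    fix \<sigma> \<tau> assume "\<sigma> \<in> carrier (Gal f)" "\<tau> \<in> carrier (Gal f)" "restrict \<sigma> ?R = restrict \<tau> ?R"
    then show "\<sigma> = \<tau>" by (intro Gal_eqI[of \<sigma> f \<tau>]) (auto dest: fun_cong simp: restrict_def, metis)
  qed
qed

lemma prime_idealD:
  assumes "is_subring B" "prime_ideal_of B I"
  shows "0 \<in> I" "1 \<notin> I" "x \<in> I \<Longrightarrow> x \<in> B" "x \<in> I \<Longrightarrow> y \<in> I \<Longrightarrow> x + y \<in> I" "x \<in> I \<Longrightarrow> - x \<in> I"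
    "x \<in> I \<Longrightarrow> y \<in> I \<Longrightarrow> x - y \<in> I"
    "r \<in> B \<Longrightarrow> x \<in> I \<Longrightarrow> r * x \<in> I" "r \<in> B \<Longrightarrow> x \<in> I \<Longrightarrow> x * r \<in> I"
    "x \<in> B \<Longrightarrow> y \<in> B \<Longrightarrow> x * y \<in> I \<Longrightarrow> x \<in> I \<or> y \<in> I"
proof -
  show "0 \<in> I" "1 \<notin> I" "x \<in> I \<Longrightarrow> x \<in> B" and a: "x \<in> I \<Longrightarrow> y \<in> I \<Longrightarrow> x + y \<in> I"
    and m: "r \<in> B \<Longrightarrow> x \<in> I \<Longrightarrow> r * x \<in> I"
    and "x \<in> B \<Longrightarrow> y \<in> B \<Longrightarrow> x * y \<in> I \<Longrightarrow> x \<in> I \<or> y \<in> I" for x y r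
    using assms(2) by (auto simp: prime_ideal_of_def)
  then show "r \<in> B \<Longrightarrow> x \<in> I \<Longrightarrow> x * r \<in> I" by (simp add: mult.commute)
  have n: "- x \<in> I" if "x \<in> I" for x
    using m[OF subringD(3)[OF assms(1) subringD(1)[OF assms(1)]] that] by simp
  show "x \<in> I \<Longrightarrow> - x \<in> I" by (rule n)
  show "x \<in> I \<Longrightarrow> y \<in> I \<Longrightarrow> x - y \<in> I" using a[OF _ n, of x y] by simp
qed

lemma prime_ideal_sum:
  assumes "is_subring B" "prime_ideal_of B I" "\<And>i. i \<in> A \<Longrightarrow> g i \<in> I"
  shows "sum g A \<in> I"
  using assms(3)
  by (induction A rule: infinite_finite_induct) (auto simp: prime_idealD(1,4)[OF assms(1,2)])

lemma prime_ideal_prod: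
  assumes "is_subring B" "prime_ideal_of B I" "finite A" "\<And>i. i \<in> A \<Longrightarrow> g i \<in> B" "prod g A \<in> I"
  shows "\<exists>i\<in>A. g i \<in> I"
  using assms(3-)
proof (induction A rule: finite_induct)
  case empty then show ?case using prime_idealD(2)[OF assms(1,2)] by simp
next
  case (insert x A)
  then show ?case
    using prime_idealD(9)[OF assms(1,2), of "g x" "prod g A"] subring_prod[OF assms(1), of A g] by auto
qed

lemma prime_ideal_power:
  assumes "is_subring B" "prime_ideal_of B I" "x \<in> B" "x ^ n \<in> I"
  shows "x \<in> I"
  using prime_ideal_prod[OF assms(1,2), of "{..<n}" "\<lambda>_. x"] assms(3,4) by auto

lemma prime_ideal_diff_mult:
  assumes B: "is_subring B" and I: "prime_ideal_of B I"
    and "x \<in> B" "y' \<in> B" "x - x' \<in> I" "y - y' \<in> I"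
  shows "x * y - x' * y' \<in> I"
proof -
  have "x * y - x' * y' = x * (y - y') + (x - x') * y'" by (simp add: algebra_simps)
  then show ?thesis using assms prime_idealD(4,7,8)[OF B I] by simp
qed

lemma prime_ideal_diff_power:
  assumes B: "is_subring B" and I: "prime_ideal_of B I" and "x \<in> B" "x' \<in> B" "x - x' \<in> I"
  shows "x ^ n - x' ^ n \<in> I"
  using assms(3-)
  by (induction n) (auto intro!: prime_ideal_diff_mult[OF B I] subring_power[OF B] prime_idealD(1)[OF B I])

text \<open>The inner binomial coefficients are divisible by \<open>p\<close>.\<close>

lemma frobenius_add:
  assumes B: "is_subring B" and I: "prime_ideal_of B I" and p: "prime (p::nat)" "of_nat p \<in> I"
    and xy: "x \<in> B" "y \<in> B"
  shows "(x + y) ^ p - (x ^ p + y ^ p) \<in> I"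
proof -
  have p0: "p > 0" using p(1) by (rule prime_gt_0_nat)
  have "(x + y) ^ p = (\<Sum>k\<in>{0..p}. of_nat (p choose k) * x ^ k * y ^ (p - k))"
    by (simp add: binomial_ring atLeast0AtMost)
  also have "{0..p} = insert 0 (insert p {1..<p})" using p0 by auto
  finally have "(x + y) ^ p - (x ^ p + y ^ p) = (\<Sum>k=1..<p. of_nat (p choose k) * x ^ k * y ^ (p - k))"
    using p0 by simp
  moreover have "of_nat (p choose k) * x ^ k * y ^ (p - k) \<in> I" if "k \<in> {1..<p}" for k
  proof -
    have "p dvd p choose k" using that p(1) by (intro dvd_choose_prime) auto
    then obtain q where "p choose k = p * q" by blast
    then have "of_nat (p choose k) * x ^ k * y ^ (p - k) = of_nat p * (of_nat q * x ^ k * y ^ (p - k))"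
      by (simp add: mult.assoc)
    moreover have "of_nat q * x ^ k * y ^ (p - k) \<in> B"
      by (intro subringD(6)[OF B] subring_power[OF B] subring_of_nat[OF B] xy)
    ultimately show ?thesis using prime_idealD(8)[OF B I _ p(2)] by metis
  qed
  ultimately show ?thesis
    using prime_ideal_sum[OF B I, of "{1..<p}" "\<lambda>k. of_nat (p choose k) * x ^ k * y ^ (p - k)"] by simp
qed

lemma frobenius_sum:
  assumes B: "is_subring B" and I: "prime_ideal_of B I" and p: "prime (p::nat)" "of_nat p \<in> I"
    and "finite A" "\<And>i. i \<in> A \<Longrightarrow> g i \<in> B"
  shows "(\<Sum>i\<in>A. g i) ^ p - (\<Sum>i\<in>A. g i ^ p) \<in> I"
  using assms(5-)
proof (induction A rule: finite_induct)
  case empty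
  then show ?case using prime_idealD(1)[OF B I] prime_gt_0_nat[OF p(1)] by (simp add: zero_power)
next
  case (insert a A)
  have "(g a + sum g A) ^ p - (g a ^ p + sum g A ^ p) \<in> I"
    using insert.prems by (intro frobenius_add[OF B I p] subring_sum[OF B]) auto
  moreover have "sum g A ^ p - (\<Sum>i\<in>A. g i ^ p) \<in> I" using insert by auto
  ultimately have "((g a + sum g A) ^ p - (g a ^ p + sum g A ^ p)) + (sum g A ^ p - (\<Sum>i\<in>A. g i ^ p)) \<in> I"
    by (rule prime_idealD(4)[OF B I])
  then show ?case using insert by (simp add: algebra_simps)
qed

lemma of_int_in_prime_ideal:
  assumes B: "is_subring B" and I: "prime_ideal_of B I" and p: "prime (p::nat)" "of_nat p \<in> I"
  shows "of_int k \<in> I \<longleftrightarrow> int p dvd k"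
proof
  assume "int p dvd k"
  then obtain q where "k = int p * q" by blast
  then show "of_int k \<in> I" using prime_idealD(8)[OF B I subring_of_int[OF B] p(2)] by simp
next
  assume k: "of_int k \<in> I"
  show "int p dvd k"
  proof (rule ccontr)
    assume "\<not> int p dvd k"
    then have "coprime (int p) k" using p(1) by (intro prime_imp_coprime) auto
    then obtain u v where "u * int p + v * k = 1" using bezout_int[of "int p" k] by auto
    then have "of_int (u * int p + v * k) = (1::'a)" by simp
    then have "(1::'a) = of_int u * of_nat p + of_int v * of_int k" by simp
    also have "\<dots> \<in> I" by (intro prime_idealD(4,7)[OF B I] subring_of_int[OF B] p k)
    finally show False using prime_idealD(2)[OF B I] by simp
  qed
qed

lemma frobenius_of_int:
  assumes B: "is_subring B" and I: "prime_ideal_of B I" and p: "prime (p::nat)" "of_nat p \<in> I"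
  shows "of_int k ^ p - of_int k \<in> I"
proof -
  have nat: "of_nat n ^ p - of_nat n \<in> I" for n
  proof (induction n)
    case 0 then show ?case using prime_idealD(1)[OF B I] prime_gt_0_nat[OF p(1)] by (simp add: zero_power)
  next
    case (Suc n)
    have "(of_nat n + 1) ^ p - (of_nat n ^ p + 1 ^ p) \<in> I"
      by (intro frobenius_add[OF B I p] subring_of_nat[OF B] subringD[OF B])
    from prime_idealD(4)[OF B I this Suc] show ?case by (simp add: algebra_simps)
  qed
  define n where "n = nat (k mod int p)"
  have n: "int n = k mod int p" using prime_gt_0_nat[OF p(1)] by (simp add: n_def)
  have "k - int n = int p * (k div int p)" by (simp add: n minus_mod_eq_mult_div)
  then have "of_int (k - int n) \<in> I"
    unfolding of_int_in_prime_ideal[OF assms] by simp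
  then have d: "of_int k - of_nat n \<in> I" by simp
  have "of_int k ^ p - of_nat n ^ p \<in> I"
    by (intro prime_ideal_diff_power[OF B I] subring_of_int[OF B] subring_of_nat[OF B] d)
  from prime_idealD(6)[OF B I prime_idealD(4)[OF B I this nat[of n]] d] show ?thesis by (simp add: algebra_simps)
qed

text \<open>The denominator of \<open>c\<close> in lowest terms is a unit modulo \<open>I\<close>, because otherwise both
  numerator and denominator would be divisible by \<open>p\<close>. Fermat's congruence for integers can
  therefore be divided by it.\<close>

lemma frobenius_Rats:
  fixes c :: "'a::field_char_0"
  assumes B: "is_subring B" and I: "prime_ideal_of B I" and p: "prime (p::nat)" "of_nat p \<in> I"
    and c: "c \<in> B" "c \<in> \<rat>"
  shows "c ^ p - c \<in> I"
proof -
  obtain a b where ab: "b > 0" "coprime a b" "c = of_int a / of_int b"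
    using c(2) by (elim Rats_cases')
  then have bc: "of_int b * c = of_int a" by simp
  have bB: "of_int b \<in> B" by (rule subring_of_int[OF B])
  have b: "of_int b \<notin> I"
  proof
    assume *: "of_int b \<in> I"
    then have "of_int a \<in> I" using prime_idealD(8)[OF B I c(1), of "of_int b"] bc by simp
    with * have "int p dvd a" "int p dvd b" using of_int_in_prime_ideal[OF B I p] by auto
    then have "is_unit (int p)" by (rule coprime_common_divisor[OF ab(2)])
    then show False using p(1) not_prime_unit[of "int p"] by simp
  qed
  have "(of_int a ^ p - of_int a) - (of_int b ^ p - of_int b) * c \<in> I"
    by (intro prime_idealD(6,8)[OF B I] frobenius_of_int[OF B I p] c)
  moreover have "(of_int a ^ p - of_int a) - (of_int b ^ p - of_int b) * c = of_int b ^ p * (c ^ p - c)"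
    by (simp flip: bc add: algebra_simps power_mult_distrib)
  ultimately have "of_int b ^ p \<in> I \<or> c ^ p - c \<in> I"
    using c bB by (intro prime_idealD(9)[OF B I] subring_power[OF B] subringD(5)[OF B]) auto
  then show ?thesis using b prime_ideal_power[OF B I bB] by blast
qed

text \<open>The coefficient of a product at the sum of the least indices at which the factors leave
  \<open>I\<close> is congruent to the product of the two coefficients there.\<close>

lemma prime_ideal_polys_in:
  assumes B: "is_subring B" and I: "prime_ideal_of B I"
  shows "prime_ideal_of (polys_in B) (polys_in I)"
proof -
  note D = prime_idealD[OF B I]
  have "p \<in> polys_in I \<or> q \<in> polys_in I" if pq: "p \<in> polys_in B" "q \<in> polys_in B" "p * q \<in> polys_in I" for p q
  proof (rule ccontr)
    assume "\<not> ?thesis"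
    then have e: "\<exists>i. coeff p i \<notin> I" "\<exists>j. coeff q j \<notin> I" by (auto simp: polys_in_def)
    define i where "i = (LEAST i. coeff p i \<notin> I)"
    define j where "j = (LEAST j. coeff q j \<notin> I)"
    have i: "coeff p i \<notin> I" "\<And>k. k < i \<Longrightarrow> coeff p k \<in> I"
      unfolding i_def using LeastI_ex[OF e(1)] not_less_Least by blast+
    have j: "coeff q j \<notin> I" "\<And>k. k < j \<Longrightarrow> coeff q k \<in> I"
      unfolding j_def using LeastI_ex[OF e(2)] not_less_Least by blast+
    have "coeff (p * q) (i + j) = coeff p i * coeff q j + (\<Sum>k\<in>{..i+j} - {i}. coeff p k * coeff q (i + j - k))"
      by (subst coeff_mult, subst sum.remove[of _ i]) auto
    moreover have "(\<Sum>k\<in>{..i+j} - {i}. coeff p k * coeff q (i + j - k)) \<in> I"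
    proof (rule prime_ideal_sum[OF B I])
      fix k assume "k \<in> {..i+j} - {i}"
      then consider "k < i" | "i + j - k < j" by force
      then show "coeff p k * coeff q (i + j - k) \<in> I"
        using i(2) j(2) D(7,8) polys_inD[OF pq(1)] polys_inD[OF pq(2)] by cases auto
    qed
    ultimately have "coeff p i * coeff q j \<in> I"
      using D(6)[OF polys_inD[OF pq(3), of "i + j"],
          of "\<Sum>k\<in>{..i+j} - {i}. coeff p k * coeff q (i + j - k)"] by simp
    then show False using D(9) i(1) j(1) polys_inD[OF pq(1)] polys_inD[OF pq(2)] by blast
  qed
  moreover have "coeff 1 0 \<notin> I" using D(2) by simp
  then have "1 \<notin> polys_in I" by (metis polys_inD)
  moreover have "r * x \<in> polys_in I" if "r \<in> polys_in B" "x \<in> polys_in I" for r x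
    by (rule polys_inI, subst coeff_mult)
       (intro prime_ideal_sum[OF B I] D(7) polys_inD[OF that(1)] polys_inD[OF that(2)])
  moreover have "x + y \<in> polys_in I" if "x \<in> polys_in I" "y \<in> polys_in I" for x y
    using that D(4) by (auto simp: polys_in_def)
  moreover have "polys_in I \<subseteq> polys_in B" using D(3) by (intro polys_in_mono) auto
  moreover have "0 \<in> polys_in I" using D(1) by (simp add: polys_in_def)
  ultimately show ?thesis unfolding prime_ideal_of_def by blast
qed

section \<open>Existence of Frobenius elements\<close>

text \<open>Substitution of \<open>x^p\<close> for \<open>x\<close>.\<close>

definition spread :: "nat \<Rightarrow> 'a::comm_ring_1 poly \<Rightarrow> 'a poly" where
  "spread p f = pcompose f (monom 1 p)"

lemma spread_sum_monom:
  "spread p (\<Sum>i\<in>A. monom (c i) i) = (\<Sum>i\<in>A. monom (c i) (p * i))"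
  unfolding spread_def pcompose_sum
proof (rule sum.cong)
  fix i
  have "pcompose (monom b i) (monom 1 p) = smult b (monom 1 p ^ i)" for b :: 'a
    by (induction i) (simp_all add: monom_0 monom_Suc pcompose_pCons)
  then show "pcompose (monom (c i) i) (monom 1 p) = monom (c i) (p * i)"
    by (simp add: monom_power smult_monom mult.commute)
qed simp

lemma hom_on_spread: "hom_on UNIV (spread p)"
  by (simp add: hom_on_def spread_def pcompose_add pcompose_mult pcompose_1)

lemma coeff_sum_monom_mult:
  assumes "p > 0" "k \<in> A" "finite A"
  shows "coeff (\<Sum>i\<in>A. monom (c i) (p * i)) (p * k) = c k"
  using assms by (simp add: coeff_sum coeff_monom sum.delta if_distrib cong: if_cong)

text \<open>In characteristic \<open>p\<close> the \<open>p\<close>-th power of a polynomial raises the coefficients and the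
  variable to the power \<open>p\<close> separately; here the coefficients are unchanged.\<close>

lemma frobenius_spread:
  assumes B: "is_subring B" and I: "prime_ideal_of B I" and p: "prime (p::nat)" "of_nat p \<in> I"
    and f: "f \<in> polys_in B" "\<And>i. coeff f i ^ p - coeff f i \<in> I"
  shows "f ^ p - spread p f \<in> polys_in I"
proof -
  note PB = is_subring_polys_in[OF B] and PI = prime_ideal_polys_in[OF B I]
  let ?A = "{..degree f}"
  have f_eq: "f = (\<Sum>i\<in>?A. monom (coeff f i) i)" by (simp add: poly_as_sum_of_monoms)
  have pI: "of_nat p \<in> polys_in I" 
    using p(2) prime_idealD(1)[OF B I] by (simp add: of_nat_poly polys_in_def coeff_pCons split: nat.splits)
  have "(\<Sum>i\<in>?A. monom (coeff f i) i) ^ p - (\<Sum>i\<in>?A. monom (coeff f i) i ^ p) \<in> polys_in I"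
    by (intro frobenius_sum[OF PB PI p(1) pI] monom_in_polys_in[OF B] polys_inD[OF f(1)]) auto
  then have 1: "f ^ p - (\<Sum>i\<in>?A. monom (coeff f i) i ^ p) \<in> polys_in I" by (simp flip: f_eq)
  have "monom (coeff f i) i ^ p - monom (coeff f i) (p * i) \<in> polys_in I" for i
  proof -
    have "monom (coeff f i) i ^ p - monom (coeff f i) (p * i) = monom (coeff f i ^ p - coeff f i) (p * i)"
      by (simp add: monom_power diff_monom mult.commute)
    then show ?thesis using f(2)[of i] prime_idealD(1)[OF B I] by (simp add: polys_in_def)
  qed
  then have "(\<Sum>i\<in>?A. monom (coeff f i) i ^ p - monom (coeff f i) (p * i)) \<in> polys_in I"
    by (intro prime_ideal_sum[OF PB PI])
  moreover have "spread p f = (\<Sum>i\<in>?A. monom (coeff f i) (p * i))"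
    by (subst f_eq, rule spread_sum_monom)
  ultimately have "(\<Sum>i\<in>?A. monom (coeff f i) i ^ p) - spread p f \<in> polys_in I"
    by (simp add: sum_subtractf)
  from prime_idealD(4)[OF PB PI 1 this] show ?thesis by simp
qed

text \<open>Let \<open>u\<close> be the polynomial \<open>\<Sum>i. \<alpha> i * x^i\<close> formed with the roots \<open>\<alpha> i\<close>, and \<open>P\<close> the product of
  the factors \<open>T - \<sigma> u\<close> over the Galois group. The coefficients of \<open>P\<close> are fixed by the group, hence
  rational, hence equal to their own \<open>p\<close>-th powers modulo \<open>m\<close>. Raising \<open>P(u) = 0\<close> to the power \<open>p\<close>
  thus shows that the polynomial \<open>W = \<Sum>i. \<alpha> i^p * x^(p i)\<close> is, modulo \<open>m\<close>, a root of \<open>P\<close> with \<open>x\<close>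
  replaced by \<open>x^p\<close>. Since \<open>m\<close> is prime, \<open>W\<close> is congruent to \<open>\<sigma> u\<close> with \<open>x\<close> replaced by \<open>x^p\<close> for some \<open>\<sigma>\<close>, and comparing
  coefficients treats all the \<open>\<alpha> i\<close> with the same \<open>\<sigma>\<close>. The indeterminate \<open>x\<close> is what keeps the
  roots apart in this comparison.\<close>

theorem exists_frobenius:
  fixes f :: "rat poly" and B m :: "complex set"
  assumes f: "rsquarefree (map_poly of_rat f :: complex poly)"
    and alg: "\<And>a. a \<in> roots_of f \<Longrightarrow> algebraic_int (a :: complex)"
    and p: "prime (p::nat)"
    and B: "is_subring B" "prime_ideal_of B m" "of_nat p \<in> m" "\<And>x. algebraic_int x \<Longrightarrow> x \<in> B"
  obtains \<sigma> where "\<sigma> \<in> carrier (Gal f)" "\<And>a. a \<in> roots_of f \<Longrightarrow> \<sigma> a - a ^ p \<in> m"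
proof -
  let ?L = "carrier (splitting_field f)" and ?G = "carrier (Gal f)"
  have f0: "f \<noteq> 0" using f by (auto simp: rsquarefree_def)
  note L = is_subfield_splitting_field[of f]
  note LS = subfield_imp_subring[OF L]
  note PB = is_subring_polys_in[OF B(1)] and PI = prime_ideal_polys_in[OF B(1,2)]
  note PPB = is_subring_polys_in[OF PB]
  have p0: "p > 0" using p by (rule prime_gt_0_nat)
  have fin: "finite ?G" by (rule finite_Gal[OF f0])
  obtain \<alpha>s :: "complex list" where as: "set \<alpha>s = roots_of f"
    using finite_list[OF finite_roots_of[OF f0]] by blast
  define n \<alpha> where "n = length \<alpha>s" and "\<alpha> i = \<alpha>s ! i" for i
  have \<alpha>: "\<alpha> i \<in> roots_of f" if "i < n" for i 
    using nth_mem[of i \<alpha>s] that unfolding as \<alpha>_def n_def by simp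
  have \<alpha>L: "\<alpha> i \<in> ?L" if "i < n" for i using \<alpha>[OF that] splitting_field_superset by blast
  have \<sigma>B: "\<sigma> (\<alpha> i) \<in> B" "\<sigma> (\<alpha> i) \<in> ?L" if "i < n" "\<sigma> \<in> ?G" for i \<sigma>
    using Gal_root[OF that(2) \<alpha>[OF that(1)]] B(4)[OF alg] splitting_field_superset[of f] by auto
  define u where "u \<sigma> = (\<Sum>i<n. monom (\<sigma> (\<alpha> i)) i)" for \<sigma> :: "complex \<Rightarrow> complex"
  define P where "P = (\<Prod>\<sigma>\<in>?G. [:- u \<sigma>, 1:])"
  have uB: "u \<sigma> \<in> polys_in B" and uL: "u \<sigma> \<in> polys_in ?L" if "\<sigma> \<in> ?G" for \<sigma>
    unfolding u_def using \<sigma>B that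
    by (auto intro!: subring_sum[OF PB] monom_in_polys_in[OF B(1)]
        subring_sum[OF is_subring_polys_in[OF LS]] monom_in_polys_in[OF LS])
  have linear: "[:- v, 1:] \<in> polys_in S" if "is_subring S" "v \<in> S" for v and S :: "complex poly set"
    using that by (auto intro!: pCons_in_polys_in zero_in_polys_in intro: subringD)
  have PinB: "P \<in> polys_in (polys_in B)"
    unfolding P_def using uB PB by (intro subring_prod[OF PPB] linear) auto
  have PinL: "P \<in> polys_in (polys_in ?L)"
    unfolding P_def using uL is_subring_polys_in[OF LS]
    by (intro subring_prod[OF is_subring_polys_in[OF is_subring_polys_in[OF LS]]] linear) auto
  \<comment> \<open>an automorphism only permutes the factors of \<open>P\<close>\<close>
  have rat: "coeff (coeff P j) i \<in> \<rat>" for i j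
  proof (rule fixed_field_Gal[OF f])
    show "coeff (coeff P j) i \<in> ?L" using PinL by (simp add: polys_in_def)
    fix \<tau> assume \<tau>: "\<tau> \<in> ?G"
    have h0: "hom_on ?L \<tau>" using \<tau> by (simp add: mem_carrier_Gal)
    note h1 = hom_on_map_poly[OF LS h0] and S1 = is_subring_polys_in[OF LS]
    note h2 = hom_on_map_poly[OF S1 h1] and S2 = is_subring_polys_in[OF S1]
    have tu: "map_poly \<tau> (u \<sigma>) = u (compose ?L \<tau> \<sigma>)" if "\<sigma> \<in> ?G" for \<sigma>
    proof -
      have "map_poly \<tau> (u \<sigma>) = (\<Sum>i<n. map_poly \<tau> (monom (\<sigma> (\<alpha> i)) i))"
        unfolding u_def using \<sigma>B(2) that by (intro hom_on_sum[OF S1 h1] monom_in_polys_in[OF LS]) auto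
      also have "\<dots> = u (compose ?L \<tau> \<sigma>)"
        unfolding u_def using \<alpha>L hom_onD(2)[OF LS h0]
        by (intro sum.cong) (auto simp: map_poly_monom compose_eq)
      finally show ?thesis .
    qed
    have "map_poly (map_poly \<tau>) P = (\<Prod>\<sigma>\<in>?G. map_poly (map_poly \<tau>) [:- u \<sigma>, 1:])"
      unfolding P_def using uL S1 by (intro hom_on_prod[OF S2 h2] linear) auto
    also have "\<dots> = (\<Prod>\<sigma>\<in>?G. [:- u (compose ?L \<tau> \<sigma>), 1:])"
      using uL by (intro prod.cong)
        (simp_all add: map_poly_pCons hom_onD[OF S1 h1] tu)
    also have "\<dots> = P"
      unfolding P_def
    proof (rule prod.reindex_bij_betw[where h = "compose ?L \<tau>" and g = "\<lambda>\<sigma>. [:- u \<sigma>, 1:]"])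
      have "inj_on (compose ?L \<tau>) ?G"
      proof (rule inj_onI)
        fix \<sigma> \<sigma>' assume s: "\<sigma> \<in> ?G" "\<sigma>' \<in> ?G" "compose ?L \<tau> \<sigma> = compose ?L \<tau> \<sigma>'"
        show "\<sigma> = \<sigma>'"
        proof (rule Gal_eqI[OF s(1,2)])
          fix a :: complex assume a: "a \<in> roots_of f"
          then have aL: "a \<in> ?L" using splitting_field_superset by blast
          have "\<tau> (\<sigma> a) = \<tau> (\<sigma>' a)" using fun_cong[OF s(3), of a] aL by (simp add: compose_eq)
          moreover have "\<sigma> a \<in> ?L" "\<sigma>' a \<in> ?L"
            using s(1,2) aL by (auto simp: mem_carrier_Gal bij_betw_apply)
          moreover have "inj_on \<tau> ?L" using \<tau> by (simp add: mem_carrier_Gal bij_betw_def)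
          ultimately show "\<sigma> a = \<sigma>' a" by (auto dest: inj_onD)
        qed
      qed
      moreover have "compose ?L \<tau> ` ?G \<subseteq> ?G" using Gal_compose[OF \<tau>] by blast
      ultimately show "bij_betw (compose ?L \<tau>) ?G ?G"
        using endo_inj_surj[OF fin] by (auto simp: bij_betw_def)
    qed
    finally have "map_poly (map_poly \<tau>) P = P" .
    then have "coeff (coeff (map_poly (map_poly \<tau>) P) j) i = coeff (coeff P j) i" by simp
    then show "\<tau> (coeff (coeff P j) i) = coeff (coeff P j) i"
      by (simp add: coeff_map_poly_hom[OF S1 h1] coeff_map_poly_hom[OF LS h0])
  qed
  \<comment> \<open>the identity automorphism, extensional as required\<close>
  define \<iota> where "\<iota> = restrict (\<lambda>x. x) ?L"
  have \<iota>: "\<iota> \<in> ?G" unfolding \<iota>_def by (rule Gal_id)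
  have \<iota>\<alpha>: "\<iota> (\<alpha> i) = \<alpha> i" if "i < n" for i using \<alpha>L[OF that] by (simp add: \<iota>_def)
  define W where "W = (\<Sum>i<n. monom (\<alpha> i ^ p) (p * i))"
  have \<alpha>B: "\<alpha> i \<in> B" if "i < n" for i using \<sigma>B(1)[OF that \<iota>] \<iota>\<alpha>[OF that] by simp
  have WB: "W \<in> polys_in B"
    unfolding W_def using \<alpha>B by (intro subring_sum[OF PB] monom_in_polys_in[OF B(1)] subring_power[OF B(1)]) auto
  have pI: "of_nat p \<in> polys_in m" 
    using B(3) prime_idealD(1)[OF B(1,2)] by (simp add: of_nat_poly polys_in_def coeff_pCons split: nat.splits)
  have uW: "u \<iota> ^ p - W \<in> polys_in m"
  proof -
    have "(\<Sum>i<n. monom (\<alpha> i) i) ^ p - (\<Sum>i<n. monom (\<alpha> i) i ^ p) \<in> polys_in m"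
      using \<alpha>B by (intro frobenius_sum[OF PB PI p pI] monom_in_polys_in[OF B(1)]) auto
    moreover have "(\<Sum>i<n. monom (\<alpha> i) i ^ p) = W" by (simp add: W_def monom_power mult.commute)
    moreover have "(\<Sum>i<n. monom (\<alpha> i) i) = u \<iota>" by (simp add: u_def \<iota>\<alpha>)
    ultimately show ?thesis by simp
  qed
  let ?d = "degree P"
  have spreadB: "spread p g \<in> polys_in B" if "g \<in> polys_in B" for g
  proof -
    have "spread p g = (\<Sum>i\<le>degree g. monom (coeff g i) (p * i))"
      using spread_sum_monom[of p "coeff g" "{..degree g}"] by (simp add: poly_as_sum_of_monoms)
    then show ?thesis using that
      by (auto intro!: subring_sum[OF PB] monom_in_polys_in[OF B(1)] polys_inD)
  qed
  \<comment> \<open>the \<open>p\<close>-th power of the equation \<open>P(u) = 0\<close>\<close>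
  have "(\<Sum>j\<le>?d. spread p (coeff P j) * W ^ j) \<in> polys_in m"
  proof -
    have "poly P (u \<iota>) = 0" unfolding P_def poly_prod using fin \<iota> by (intro prod_zero) auto
    then have 0: "(\<Sum>j\<le>?d. coeff P j * u \<iota> ^ j) ^ p = 0" using p0 by (simp add: poly_altdef)
    have "(\<Sum>j\<le>?d. coeff P j * u \<iota> ^ j) ^ p - (\<Sum>j\<le>?d. (coeff P j * u \<iota> ^ j) ^ p) \<in> polys_in m"
      using PinB uB[OF \<iota>]
      by (intro frobenius_sum[OF PB PI p pI] subringD(6)[OF PB] subring_power[OF PB]) (auto simp: polys_in_def)
    moreover have "(\<Sum>j\<le>?d. (coeff P j * u \<iota> ^ j) ^ p - spread p (coeff P j) * W ^ j) \<in> polys_in m"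
    proof (rule prime_ideal_sum[OF PB PI])
      fix j
      have cj: "coeff P j \<in> polys_in B" by (rule polys_inD[OF PinB])
      have "coeff P j ^ p - spread p (coeff P j) \<in> polys_in m"
        by (rule frobenius_spread[OF B(1,2) p B(3) cj])
           (intro frobenius_Rats[OF B(1,2) p B(3)] rat polys_inD[OF cj])
      moreover have "(u \<iota> ^ p) ^ j - W ^ j \<in> polys_in m"
        by (intro prime_ideal_diff_power[OF PB PI] subring_power[OF PB] uB \<iota> WB uW)
      ultimately have "coeff P j ^ p * (u \<iota> ^ p) ^ j - spread p (coeff P j) * W ^ j \<in> polys_in m"
        by (intro prime_ideal_diff_mult[OF PB PI] subring_power[OF PB] cj WB)
      then show "(coeff P j * u \<iota> ^ j) ^ p - spread p (coeff P j) * W ^ j \<in> polys_in m"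
        by (simp add: power_mult_distrib flip: power_mult) (simp add: mult.commute)
    qed
    ultimately have "((\<Sum>j\<le>?d. coeff P j * u \<iota> ^ j) ^ p - (\<Sum>j\<le>?d. (coeff P j * u \<iota> ^ j) ^ p))
       + (\<Sum>j\<le>?d. (coeff P j * u \<iota> ^ j) ^ p - spread p (coeff P j) * W ^ j) \<in> polys_in m"
      by (rule prime_idealD(4)[OF PB PI])
    then have "- (\<Sum>j\<le>?d. spread p (coeff P j) * W ^ j) \<in> polys_in m"
      unfolding 0 by (simp add: sum_subtractf)
    from prime_idealD(5)[OF PB PI this] show ?thesis by simp
  qed
  also have "(\<Sum>j\<le>?d. spread p (coeff P j) * W ^ j) = (\<Prod>\<sigma>\<in>?G. W - spread p (u \<sigma>))"
  proof -
    have U: "is_subring (UNIV :: complex poly set)" by (simp add: is_subring_def)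
    note hs = hom_on_spread[of p, where ?'a = complex]
    have "degree (map_poly (spread p) P) \<le> ?d"
      by (rule degree_le) (simp add: coeff_map_poly_hom[OF U hs] hom_onD(2)[OF U hs] coeff_eq_0)
    then have "(\<Sum>j\<le>?d. spread p (coeff P j) * W ^ j) = poly (map_poly (spread p) P) W"
      by (simp add: poly_sum_upto coeff_map_poly_hom[OF U hs])
    also have "map_poly (spread p) P = (\<Prod>\<sigma>\<in>?G. map_poly (spread p) [:- u \<sigma>, 1:])"
      unfolding P_def by (intro hom_on_prod[OF is_subring_polys_in[OF U] hom_on_map_poly[OF U hs]])
        (auto simp: polys_in_def)
    also have "poly \<dots> W = (\<Prod>\<sigma>\<in>?G. W - spread p (u \<sigma>))"
      unfolding poly_prod
      by (intro prod.cong) (simp_all add: map_poly_pCons hom_onD[OF U hs])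
    finally show ?thesis .
  qed
  finally have "\<exists>\<sigma>\<in>?G. W - spread p (u \<sigma>) \<in> polys_in m"
    by (intro prime_ideal_prod[OF PB PI fin] subringD(5)[OF PB] WB spreadB uB)
  then obtain \<sigma> where \<sigma>: "\<sigma> \<in> ?G" "W - spread p (u \<sigma>) \<in> polys_in m" by blast
  show ?thesis
  proof (rule that[OF \<sigma>(1)])
    fix a :: complex assume "a \<in> roots_of f"
    then obtain k where k: "k < n" "a = \<alpha> k" using as by (metis \<alpha>_def in_set_conv_nth n_def)
    have "coeff (W - spread p (u \<sigma>)) (p * k) = \<alpha> k ^ p - \<sigma> (\<alpha> k)"
      unfolding W_def u_def spread_sum_monom using p0 k
      by (simp add: coeff_sum_monom_mult)
    then have "- (\<sigma> a - a ^ p) \<in> m" using polys_inD[OF \<sigma>(2), of "p * k"] k by simp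
    from prime_idealD(5)[OF B(1,2) this] show "\<sigma> a - a ^ p \<in> m" by simp
  qed
qed

section \<open>Permutation groups of prime degree\<close>

text \<open>A group of permutations as a bare set of functions; the identity is implied as soon as the
  set is nonempty.\<close>

definition perm_group_on :: "'a set \<Rightarrow> ('a \<Rightarrow> 'a) set \<Rightarrow> bool" where
  "perm_group_on \<Omega> H \<longleftrightarrow> (\<forall>g\<in>H. g permutes \<Omega> \<and> inv' g \<in> H) \<and> (\<forall>g\<in>H. \<forall>h\<in>H. g \<circ> h \<in> H)"

abbreviation cycle3 :: "'a \<Rightarrow> 'a \<Rightarrow> 'a \<Rightarrow> 'a \<Rightarrow> 'a" where
  "cycle3 a b c \<equiv> cycle_of_list [a, b, c]"

lemma cycle3_apply:
  assumes "distinct [a, b, c]"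
  shows "cycle3 a b c a = b" "cycle3 a b c b = c" "cycle3 a b c c = a"
    "x \<noteq> a \<Longrightarrow> x \<noteq> b \<Longrightarrow> x \<noteq> c \<Longrightarrow> cycle3 a b c x = x"
  using assms by (auto simp: transpose_def)

lemma cycle3_rotate:
  assumes "distinct [a, b, c]" shows "cycle3 a b c = cycle3 b c a"
proof
  fix x
  have "distinct [b, c, a]" using assms by auto
  then show "cycle3 a b c x = cycle3 b c a x"
    using cycle3_apply[OF assms] cycle3_apply[of b c a]
    by (cases "x = a \<or> x = b \<or> x = c") (auto simp del: cycle_of_list.simps)
qed

lemma cycle3_square:
  assumes "distinct [a, b, c]" shows "cycle3 a b c \<circ> cycle3 a b c = cycle3 a c b"
proof
  fix x
  have "distinct [a, c, b]" using assms by auto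
  then show "(cycle3 a b c \<circ> cycle3 a b c) x = cycle3 a c b x"
    using cycle3_apply[OF assms] cycle3_apply[of a c b]
    by (cases "x = a \<or> x = b \<or> x = c") (auto simp del: cycle_of_list.simps)
qed

lemma perm_group_on_conj:
  assumes H: "perm_group_on \<Omega> H" and g: "g \<in> H" and c: "cycle3 a b c \<in> H" "distinct [a, b, c]"
  shows "cycle3 (g a) (g b) (g c) \<in> H" "distinct [g a, g b, g c]"
proof -
  have gp: "g permutes \<Omega>" and gi: "inv' g \<in> H" using H g by (auto simp: perm_group_on_def)
  then have bij: "bij g" by (simp add: permutes_bij)
  have "g \<circ> cycle3 a b c \<circ> inv' g = cycle3 (g a) (g b) (g c)"
    using conjugation_of_cycle[OF c(2) bij] by simp
  moreover have "g \<circ> cycle3 a b c \<circ> inv' g \<in> H" using H g gi c by (auto simp: perm_group_on_def)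
  ultimately show "cycle3 (g a) (g b) (g c) \<in> H" by simp
  show "distinct [g a, g b, g c]" using bij c(2) by (auto dest: bij_is_inj injD)
qed

definition all_cycle3 :: "('a \<Rightarrow> 'a) set \<Rightarrow> 'a set \<Rightarrow> bool" where
  "all_cycle3 H \<Delta> \<longleftrightarrow> (\<forall>a\<in>\<Delta>. \<forall>b\<in>\<Delta>. \<forall>c\<in>\<Delta>. distinct [a, b, c] \<longrightarrow> cycle3 a b c \<in> H)"

lemma two_others:
  assumes "card \<Delta> \<ge> 3" obtains d e where "d \<in> \<Delta>" "e \<in> \<Delta>" "distinct [a, d, e]"
proof -
  have fin: "finite \<Delta>" using assms by (metis card.infinite not_numeral_le_zero)
  have "card (\<Delta> - {a}) \<ge> 2" using assms fin by (cases "a \<in> \<Delta>") auto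
  then obtain T where "T \<subseteq> \<Delta> - {a}" "card T = 2" by (metis obtain_subset_with_card_n)
  then show ?thesis using that by (auto simp: card_2_iff)
qed

lemma third_element:
  assumes "card \<Delta> \<ge> 3" obtains e where "e \<in> \<Delta>" "e \<noteq> a" "e \<noteq> b"
  using two_others[OF assms, of a] by (metis distinct_length_2_or_more)

text \<open>If \<open>e\<close> is outside \<open>\<Delta>\<close>, the given 3-cycle conjugates a 3-cycle over \<open>\<Delta>\<close> through \<open>a\<close> into one
  through \<open>b\<close> and two points of \<open>\<Delta>\<close>; otherwise it is already of this kind. Conjugation by 3-cycles
  over \<open>\<Delta>\<close> then moves these two points to any other two, and squaring exchanges them.\<close>

lemma all_cycle3_insert:
  assumes H: "perm_group_on \<Omega> H" and \<Delta>: "all_cycle3 H \<Delta>" "card \<Delta> \<ge> 3"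
    and c: "cycle3 a b e \<in> H" "distinct [a, b, e]" "a \<in> \<Delta>" "b \<notin> \<Delta>"
  shows "all_cycle3 H (insert b \<Delta>)"
proof -
  have \<Delta>D: "cycle3 x y z \<in> H" if "x \<in> \<Delta>" "y \<in> \<Delta>" "z \<in> \<Delta>" "distinct [x, y, z]" for x y z
    using \<Delta>(1) that by (simp add: all_cycle3_def del: cycle_of_list.simps)
  define E where "E x y \<longleftrightarrow> cycle3 b x y \<in> H" for x y
  have "\<exists>u v. u \<in> \<Delta> \<and> v \<in> \<Delta> \<and> u \<noteq> v \<and> E u v"
  proof (cases "e \<in> \<Delta>")
    case True
    then show ?thesis using c cycle3_rotate[OF c(2)] by (intro exI[of _ e] exI[of _ a]) (auto simp: E_def)
  next
    case False
    obtain d f where df: "d \<in> \<Delta>" "f \<in> \<Delta>" "distinct [a, d, f]" using two_others[OF \<Delta>(2)] .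
    have "cycle3 a b e d = d" "cycle3 a b e f = f"
      using df False c by (auto intro!: cycle3_apply(4)[OF c(2)] simp del: cycle_of_list.simps)
    then have "E d f"
      using perm_group_on_conj(1)[OF H c(1) \<Delta>D[OF c(3) df(1,2,3)] df(3)] cycle3_apply(1)[OF c(2)]
      by (simp add: E_def del: cycle_of_list.simps)
    then show ?thesis using df by auto
  qed
  then obtain u v where uv: "u \<in> \<Delta>" "v \<in> \<Delta>" "u \<noteq> v" "E u v" by blast
  have sym: "E y x" if "E x y" "x \<in> \<Delta>" "y \<in> \<Delta>" "x \<noteq> y" for x y
  proof -
    have d: "distinct [b, x, y]" using that c by auto
    have "cycle3 b x y \<circ> cycle3 b x y \<in> H" using that H unfolding E_def perm_group_on_def by blast
    then show ?thesis unfolding E_def cycle3_square[OF d] .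
  qed
  have step: "E y w" if "E x y" "x \<in> \<Delta>" "y \<in> \<Delta>" "w \<in> \<Delta>" "x \<noteq> y" "w \<noteq> x" "w \<noteq> y" for x y w
  proof -
    have d: "distinct [b, x, y]" and d': "distinct [x, y, w]" using that c by auto
    have "cycle3 x y w b = b" using that c by (intro cycle3_apply(4)[OF d']) auto
    then show ?thesis
      using perm_group_on_conj(1)[OF H \<Delta>D[OF that(2-4) d'] _ d] that(1) cycle3_apply(1,2)[OF d']
      by (simp add: E_def del: cycle_of_list.simps)
  qed
  have E: "E x y" if "x \<in> \<Delta>" "y \<in> \<Delta>" "x \<noteq> y" for x y
  proof -
    have from_uv: "E v w" "E u w" if "w \<in> \<Delta>" "w \<noteq> u" "w \<noteq> v" for w
      using step[OF uv(4,1,2) that(1)] step[OF sym[OF uv(4,1,2,3)] uv(2,1) that(1)] uv(3) that by auto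
    show ?thesis
    proof (cases "x = u \<or> x = v")
      case True
      then show ?thesis using from_uv[of y] uv sym[OF uv(4,1,2,3)] that by (cases "y = u \<or> y = v") auto
    next
      case xn: False
      show ?thesis
      proof (cases "y = u \<or> y = v")
        case True
        then show ?thesis using from_uv[of x] xn that uv sym[of u x] sym[of v x] by auto
      next
        case False
        then show ?thesis using step[OF from_uv(1)[OF that(1)] uv(2) that(1,2)] xn that by auto
      qed
    qed
  qed
  show ?thesis
    unfolding all_cycle3_def
  proof (intro ballI impI)
    fix x y z assume xyz: "x \<in> insert b \<Delta>" "y \<in> insert b \<Delta>" "z \<in> insert b \<Delta>" and d: "distinct [x, y, z]"
    have d': "distinct [y, z, x]" using d by auto
    consider "x = b" | "y = b" | "z = b" | "x \<in> \<Delta>" "y \<in> \<Delta>" "z \<in> \<Delta>" using xyz by blast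
    then show "cycle3 x y z \<in> H"
    proof cases
      case 1 then show ?thesis using E[of y z] xyz d by (auto simp: E_def simp del: cycle_of_list.simps)
    next
      case 2 then show ?thesis unfolding cycle3_rotate[OF d]
        using E[of z x] xyz d by (auto simp: E_def simp del: cycle_of_list.simps)
    next
      case 3 then show ?thesis unfolding cycle3_rotate[OF d] cycle3_rotate[OF d']
        using E[of x y] xyz d by (auto simp: E_def simp del: cycle_of_list.simps)
    next
      case 4 then show ?thesis using \<Delta>D d by blast
    qed
  qed
qed

lemma funpow_fixed_mult:
  assumes "(c ^^ n) x = x" shows "(c ^^ (n * k)) x = x"
  using assms by (induction k) (auto simp: funpow_add)

text \<open>By Bezout's identity \<open>c\<close> itself is a combination of the two powers.\<close>

lemma funpow_fixed_coprime:
  assumes "(c ^^ a) x = x" "(c ^^ b) x = x" "coprime a b" "a \<noteq> 0"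
  shows "c x = x"
proof -
  obtain u v where "a * u = b * v + gcd a b" using bezout_nat[OF assms(4), of b] by blast
  then have "a * u = b * v + 1" using assms(3) by simp
  then have "(c ^^ (a * u)) x = c ((c ^^ (b * v)) x)" by simp
  then show ?thesis using funpow_fixed_mult[OF assms(1)] funpow_fixed_mult[OF assms(2)] by simp
qed

lemma prime_cycle_transitive:
  assumes fin: "finite \<Omega>" and pr: "prime (card \<Omega>)" and c: "c permutes \<Omega>"
    "\<And>x. x \<in> \<Omega> \<Longrightarrow> (c ^^ card \<Omega>) x = x" "\<And>x. x \<in> \<Omega> \<Longrightarrow> c x \<noteq> x"
    and x: "x \<in> \<Omega>"
  shows "(\<lambda>k. (c ^^ k) x) ` {..<card \<Omega>} = \<Omega>"
proof -
  have mem: "(c ^^ k) y \<in> \<Omega>" if "y \<in> \<Omega>" for k y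
    using that by (induction k) (auto simp: permutes_in_image[OF c(1)])
  have "inj_on (\<lambda>k. (c ^^ k) x) {..<card \<Omega>}"
  proof (rule linorder_inj_onI')
    fix i j assume ij: "i \<in> {..<card \<Omega>}" "j \<in> {..<card \<Omega>}" "i < j"
    show "(c ^^ i) x \<noteq> (c ^^ j) x"
    proof
      assume eq: "(c ^^ i) x = (c ^^ j) x"
      let ?y = "(c ^^ i) x"
      have "(c ^^ (j - i + i)) x = (c ^^ (j - i)) ?y" by (simp only: funpow_add o_apply)
      then have "(c ^^ (j - i)) ?y = ?y" using eq ij by simp
      moreover have "coprime (j - i) (card \<Omega>)"
      proof -
        have "\<not> card \<Omega> dvd j - i" using ij by (auto dest: dvd_imp_le)
        then have "coprime (card \<Omega>) (j - i)" by (rule prime_imp_coprime[OF pr])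
        then show ?thesis by (rule coprime_imp_coprime) auto
      qed
      ultimately have "c ?y = ?y"
        using c(2)[OF mem[OF x]] ij by (intro funpow_fixed_coprime[of "j - i" c ?y "card \<Omega>"]) auto
      then show False using c(3)[OF mem[OF x]] by blast
    qed
  qed
  then have "card ((\<lambda>k. (c ^^ k) x) ` {..<card \<Omega>}) = card \<Omega>" by (simp add: card_image)
  then show ?thesis using fin mem[OF x] by (intro card_subset_eq) auto
qed

text \<open>A special case of Jordan's theorem on primitive groups. Take a largest set \<open>\<Delta>\<close> all of whose
  3-cycles belong to \<open>H\<close>. A translate of \<open>\<Delta>\<close> meeting \<open>\<Delta>\<close> is contained in \<open>\<Delta>\<close>, since otherwise a
  3-cycle over the translate would enlarge \<open>\<Delta>\<close>. Some power \<open>c^k\<close> with \<open>0 < k < card \<Omega>\<close> moves one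
  element of \<open>\<Delta>\<close> to another and so preserves \<open>\<Delta>\<close>; as the degree is prime, \<open>c\<close> is a power of \<open>c^k\<close>.
  Thus \<open>\<Delta>\<close> is stable under the transitive element \<open>c\<close> and is everything.\<close>

theorem all_cycle3_of_prime_degree:
  assumes fin: "finite \<Omega>" and pr: "prime (card \<Omega>)" and H: "perm_group_on \<Omega> H"
    and c: "c \<in> H" "\<And>x. x \<in> \<Omega> \<Longrightarrow> (c ^^ card \<Omega>) x = x" "\<And>x. x \<in> \<Omega> \<Longrightarrow> c x \<noteq> x"
    and t: "cycle3 u v w \<in> H" "distinct [u, v, w]" "{u, v, w} \<subseteq> \<Omega>"
  shows "all_cycle3 H \<Omega>"
proof -
  have cp: "c permutes \<Omega>" using H c(1) by (auto simp: perm_group_on_def)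
  have cH: "(c ^^ k) \<in> H" if "k > 0" for k
    using that
  proof (induction k)
    case (Suc k)
    then have "k > 0 \<Longrightarrow> c \<circ> (c ^^ k) \<in> H" using H c(1) by (auto simp: perm_group_on_def simp del: o_apply)
    moreover have "c ^^ Suc k = c \<circ> (c ^^ k)" by (simp add: fun_eq_iff)
    ultimately show ?case using c(1) by (cases "k = 0") (simp, metis neq0_conv)
  qed simp
  \<comment> \<open>the requirement of three points excludes sets without any 3-cycle\<close>
  let ?P = "\<lambda>\<Delta>. \<Delta> \<subseteq> \<Omega> \<and> all_cycle3 H \<Delta> \<and> card \<Delta> \<ge> 3"
  have "?P {u, v, w}"
  proof (intro conjI t)
    have "cycle3 u v w \<circ> cycle3 u v w \<in> H" using t(1) H unfolding perm_group_on_def by blast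
    then have "cycle3 u w v \<in> H" unfolding cycle3_square[OF t(2)] .
    moreover have "distinct [u, w, v]" "distinct [w, v, u]" "distinct [v, w, u]" using t(2) by auto
    ultimately show "all_cycle3 H {u, v, w}"
      unfolding all_cycle3_def
      using t(1,2) cycle3_rotate[of u v w] cycle3_rotate[of v w u] cycle3_rotate[of u w v] cycle3_rotate[of w v u]
      by (auto simp del: cycle_of_list.simps)
    show "card {u, v, w} \<ge> 3" using t(2) by simp
  qed
  moreover have "\<forall>\<Delta>. ?P \<Delta> \<longrightarrow> card \<Delta> < Suc (card \<Omega>)" using fin by (auto intro: card_mono le_imp_less_Suc)
  ultimately obtain \<Delta> where \<Delta>: "?P \<Delta>" and max: "\<And>\<Delta>'. ?P \<Delta>' \<Longrightarrow> card \<Delta>' \<le> card \<Delta>"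
    using ex_has_greatest_nat[of ?P "{u, v, w}" card "Suc (card \<Omega>)"] by auto
  have fin\<Delta>: "finite \<Delta>" using \<Delta> fin by (auto intro: finite_subset)
  have block: "g ` \<Delta> \<subseteq> \<Delta>" if g: "g \<in> H" and meet: "p \<in> \<Delta>" "g p \<in> \<Delta>" for g p
  proof (rule ccontr)
    assume "\<not> ?thesis"
    then obtain q where q: "q \<in> \<Delta>" "g q \<notin> \<Delta>" by blast
    obtain r where r: "r \<in> \<Delta>" "r \<noteq> p" "r \<noteq> q" using third_element \<Delta> by metis
    have d: "distinct [p, q, r]" using q meet r by auto
    then have "cycle3 p q r \<in> H" using \<Delta> q meet r by (simp add: all_cycle3_def del: cycle_of_list.simps)
    note conj = perm_group_on_conj[OF H g this d]
    have "all_cycle3 H (insert (g q) \<Delta>)"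
      using all_cycle3_insert[OF H _ _ conj meet(2) q(2)] \<Delta> by blast
    moreover have "g q \<in> \<Omega>" using permutes_in_image[of g \<Omega> q] H g q \<Delta> unfolding perm_group_on_def by blast
    ultimately have "card (insert (g q) \<Delta>) \<le> card \<Delta>" using \<Delta> q fin\<Delta> by (intro max) auto
    then show False using q fin\<Delta> by simp
  qed
  obtain x y where xy: "x \<in> \<Delta>" "y \<in> \<Delta>" "x \<noteq> y" using two_others \<Delta> by (metis distinct_length_2_or_more)
  then have x\<Omega>: "x \<in> \<Omega>" "y \<in> \<Omega>" using \<Delta> by auto
  have orbit: "(\<lambda>k. (c ^^ k) x) ` {..<card \<Omega>} = \<Omega>"
    by (rule prime_cycle_transitive[OF fin pr cp]) (use c x\<Omega> in auto)
  then obtain k where k: "k < card \<Omega>" "y = (c ^^ k) x" using x\<Omega>(2) by blast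
  have k0: "k > 0" using k xy by (cases k) auto
  have stable: "(c ^^ (k * j)) ` \<Delta> \<subseteq> \<Delta>" for j
  proof (induction j)
    case (Suc j)
    have "(c ^^ k) ` \<Delta> \<subseteq> \<Delta>" using block[OF cH[OF k0] xy(1)] k xy by blast
    then show ?case using Suc by (fastforce simp: funpow_add)
  qed simp
  have "\<not> card \<Omega> dvd k" using k k0 by (auto dest: dvd_imp_le)
  then have "coprime k (card \<Omega>)" using prime_imp_coprime[OF pr] by (simp add: coprime_commute)
  moreover obtain i j where "k * j = card \<Omega> * i + gcd k (card \<Omega>)"
    using bezout_nat[of k "card \<Omega>"] k0 by blast
  ultimately have ij: "k * j = card \<Omega> * i + 1" by simp
  have "(c ^^ (k * j)) z = c z" if "z \<in> \<Omega>" for z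
    unfolding ij using funpow_fixed_mult[OF c(2)[OF that], of i] by simp
  then have c\<Delta>: "c z \<in> \<Delta>" if "z \<in> \<Delta>" for z using stable[of j] that \<Delta> by (metis image_subset_iff subsetD)
  have "(c ^^ k) x \<in> \<Delta>" for k by (induction k) (use xy c\<Delta> in auto)
  then have "(\<lambda>k. (c ^^ k) x) ` {..<card \<Omega>} \<subseteq> \<Delta>" by (rule image_subsetI)
  then have "\<Omega> \<subseteq> \<Delta>" unfolding orbit .
  then show ?thesis using \<Delta> by (metis subset_antisym)
qed

lemma card_moved_3_imp_cycle3:
  assumes g: "g permutes \<Omega>" and card: "card {x \<in> \<Omega>. g x \<noteq> x} = 3"
  obtains u v w where "g = cycle3 u v w" "distinct [u, v, w]" "{u, v, w} \<subseteq> \<Omega>"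
proof -
  let ?M = "{x \<in> \<Omega>. g x \<noteq> x}"
  obtain u v w where M: "?M = {u, v, w}" "u \<noteq> v" "v \<noteq> w" "u \<noteq> w" using card by (auto simp: card_3_iff)
  have inj: "inj g" using g by (rule permutes_inj)
  have img: "g x \<in> ?M" if "x \<in> ?M" for x
    using that g inj by (auto simp: permutes_in_image dest: injD)
  have fix': "g x = x" if "x \<notin> {u, v, w}" for x
  proof -
    have "x \<notin> ?M" using that M(1) by simp
    then show ?thesis using permutes_not_in[OF g] by blast
  qed
  have ne: "g u \<noteq> u" "g v \<noteq> v" "g w \<noteq> w" and
    mem: "g u \<in> {u, v, w}" "g v \<in> {u, v, w}" "g w \<in> {u, v, w}" and sub: "{u, v, w} \<subseteq> \<Omega>"
    using img M(1) by blast+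
  have ne2: "g u \<noteq> g v" "g v \<noteq> g w" "g u \<noteq> g w" using inj M by (auto dest: injD)
  have d: "distinct [u, v, w]" "distinct [u, w, v]" using M by auto
  have "g = cycle3 u v w \<or> g = cycle3 u w v"
  proof (cases "g u = v")
    case True
    then have "g v = w" "g w = u" using ne mem ne2 M by auto
    then have "g x = cycle3 u v w x" for x
      using True fix'[of x] cycle3_apply[OF d(1)] by (cases "x \<in> {u, v, w}") (auto simp del: cycle_of_list.simps)
    then show ?thesis by blast
  next
    case False
    then have "g u = w" "g w = v" "g v = u" using ne mem ne2 M by auto
    then have "g x = cycle3 u w v x" for x
      using fix'[of x] cycle3_apply[OF d(2)] by (cases "x \<in> {u, v, w}") (auto simp del: cycle_of_list.simps)
    then show ?thesis by blast
  qed
  then show ?thesis using that[of u v w] that[of u w v] d sub by (metis insert_commute)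
qed

section \<open>Resultants\<close>

text \<open>The resultant of two complex polynomials, in terms of their roots counted with
  multiplicity.\<close>

definition root_resultant :: "complex poly \<Rightarrow> complex poly \<Rightarrow> complex" where
  "root_resultant f g = lead_coeff f ^ degree g * (\<Prod>x\<in>#proots f. poly g x)"

lemma poly_proots:
  fixes g :: "complex poly"
  shows "poly g x = lead_coeff g * (\<Prod>y\<in>#proots g. x - y)"
proof -
  have "poly g x = poly (smult (lead_coeff g) (\<Prod>y\<in>#proots g. [:-y, 1:])) x"
    by (simp only: complex_poly_decompose_multiset)
  also have "\<dots> = lead_coeff g * (\<Prod>y\<in>#proots g. x - y)"
    by (simp add: poly_prod_mset image_mset.compositionality o_def)
  finally show ?thesis .
qed

lemma root_resultant_expand:
  "root_resultant f g = lead_coeff f ^ degree g * lead_coeff g ^ degree f * (\<Prod>x\<in>#proots f. \<Prod>y\<in>#proots g. x - y)"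
proof -
  have "poly g = (\<lambda>x. lead_coeff g * (\<Prod>y\<in>#proots g. x - y))" by (rule ext) (rule poly_proots)
  then show ?thesis
    unfolding root_resultant_def by (simp only: prod_mset.distrib prod_mset_constant size_proots_complex mult.assoc)
qed

lemma root_resultant_swap: "root_resultant f g = (- 1) ^ (degree f * degree g) * root_resultant g f"
proof -
  have "(\<Prod>x\<in>#proots f. \<Prod>y\<in>#proots g. x - y) = (\<Prod>x\<in>#proots f. \<Prod>y\<in>#proots g. (- 1) * (y - x))"
    by simp
  also have "\<dots> = (- 1) ^ (degree g * degree f) * (\<Prod>x\<in>#proots f. \<Prod>y\<in>#proots g. y - x)"
    by (simp only: prod_mset.distrib prod_mset_constant size_proots_complex power_mult)
  also have "(\<Prod>x\<in>#proots f. \<Prod>y\<in>#proots g. y - x) = (\<Prod>y\<in>#proots g. \<Prod>x\<in>#proots f. y - x)"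
    by (rule prod_mset.swap)
  finally show ?thesis by (simp add: root_resultant_expand mult_ac)
qed

text \<open>One step of the Euclidean algorithm. The factors \<open>l\<close> and \<open>d\<close> allow integer coefficients with
  common factors removed.\<close>

lemma root_resultant_step:
  assumes "smult l f = q * g + smult d r" "degree r \<le> degree f" "g \<noteq> 0"
  shows "root_resultant f g * l ^ degree g =
    (- 1) ^ (degree f * degree g) * d ^ degree g * lead_coeff g ^ (degree f - degree r) * root_resultant g r"
proof -
  have "l ^ degree g * (\<Prod>y\<in>#proots g. poly f y) = (\<Prod>y\<in>#proots g. poly (smult l f) y)"
    by (simp add: prod_mset.distrib size_proots_complex)
  also have "\<dots> = (\<Prod>y\<in>#proots g. d * poly r y)"
    unfolding assms(1) using assms(3) by (intro arg_cong[of _ _ prod_mset] image_mset_cong) auto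
  also have "\<dots> = d ^ degree g * (\<Prod>y\<in>#proots g. poly r y)"
    by (simp add: prod_mset.distrib size_proots_complex)
  finally have "l ^ degree g * (\<Prod>y\<in>#proots g. poly f y) = d ^ degree g * (\<Prod>y\<in>#proots g. poly r y)" .
  moreover have "lead_coeff g ^ degree f = lead_coeff g ^ (degree f - degree r) * lead_coeff g ^ degree r"
    using assms(2) by (simp flip: power_add)
  ultimately show ?thesis
    by (subst root_resultant_swap) (simp add: root_resultant_def mult_ac)
qed

lemma root_resultant_const: "root_resultant f [:c:] = c ^ degree f"
  by (simp add: root_resultant_def size_proots_complex)
abbreviation h_complex :: "complex poly" where "h_complex \<equiv> [:-1, 2, -3, 1, 3, -8, 1, 1:]"

text \<open>The Euclidean algorithm for \<open>h\<close> and its derivative, run with primitive integer remainders;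
  the values are accumulated from the constant remainder backwards.\<close>

lemma root_resultant_h: "root_resultant h_complex (pderiv h_complex) = - (77872 ^ 2)"
proof -
  let ?f0 = "h_complex"
  let ?f1 = "[:2, -6, 3, 12, -40, 6, 7:] :: complex poly"
  let ?f2 = "[:-51, 90, -108, 16, 103, -118:] :: complex poly"
  let ?f3 = "[:-919, 60, -780, 2056, -8093:] :: complex poly"
  let ?f4 = "[:-139451, 244462, -272619, 108010:] :: complex poly"
  let ?f5 = "[:-4388393, 5555596, -5135377:] :: complex poly"
  let ?f6 = "[:-736, -1899:] :: complex poly"
  let ?f7 = "[:-1:] :: complex poly"
  have "root_resultant ?f6 ?f7 = -1" by (simp add: root_resultant_const)
  moreover have "root_resultant ?f5 ?f6 * 3606201 ^ 1 = (- 1) ^ 2 * 26372096932129 ^ 1 * (-1899) ^ 2 * root_resultant ?f6 ?f7"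
    using root_resultant_step[of 3606201 ?f5 "[:-14329714276, 9752080923:]" ?f6 26372096932129 ?f7] by simp
  ultimately have "root_resultant ?f5 ?f6 = -26372096932129" by simp
  moreover have "root_resultant ?f4 ?f5 * 26372096932129 ^ 2 = (- 1) ^ 6 * 227116804826800 ^ 2 * (-5135377) ^ 2 * root_resultant ?f5 ?f6"
    using root_resultant_step[of 26372096932129 ?f4 "[:799941418403, -554672069770:]" ?f5 227116804826800 ?f6] by simp
  ultimately have "root_resultant ?f4 ?f5 = -51582043034734763777998240000" by simp
  moreover have "root_resultant ?f3 ?f4 * 11666160100 ^ 3 = (- 1) ^ 12 * 65496649 ^ 3 * (108010) ^ 2 * root_resultant ?f4 ?f5"
    using root_resultant_step[of 11666160100 ?f3 "[:-1984237007, -874124930:]" ?f4 65496649 ?f5] by simp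
  ultimately have "root_resultant ?f3 ?f4 = -106487815383491794771694332085776" by simp
  moreover have "root_resultant ?f2 ?f3 * 65496649 ^ 4 = (- 1) ^ 20 * 27848 ^ 4 * (-8093) ^ 2 * root_resultant ?f3 ?f4"
    using root_resultant_step[of 65496649 ?f2 "[:-590971, 954974:]" ?f3 27848 ?f4] by simp
  ultimately have "root_resultant ?f2 ?f3 = -227939040736382871415619584" by simp
  moreover have "root_resultant ?f1 ?f2 * 13924 ^ 5 = (- 1) ^ 30 * 49 ^ 5 * (-118) ^ 2 * root_resultant ?f2 ?f3"
    using root_resultant_step[of 13924 ?f1 "[:-1429, -826:]" ?f2 49 ?f3] by simp
  ultimately have "root_resultant ?f1 ?f2 = -1712943577218447616" by simp
  moreover have "root_resultant ?f0 ?f1 * 49 ^ 6 = (- 1) ^ 42 * 1 ^ 6 * (7) ^ 2 * root_resultant ?f1 ?f2"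
    using root_resultant_step[of 49 ?f0 "[:1, 7:]" ?f1 1 ?f2] by simp
  ultimately have "root_resultant ?f0 ?f1 = -6064048384" by simp
  then show ?thesis by (simp add: pderiv_pCons)
qed

section \<open>Integer polynomials and roots modulo a prime ideal\<close>

definition int_eval :: "int poly \<Rightarrow> 'a::comm_ring_1 \<Rightarrow> 'a" where
  "int_eval P x = poly (map_poly of_int P) x"

lemma hom_of_int_poly: "hom_on UNIV (map_poly of_int :: int poly \<Rightarrow> 'a::comm_ring_1 poly)"
proof -
  have "hom_on (polys_in UNIV) (map_poly of_int :: int poly \<Rightarrow> 'a poly)"
    by (rule hom_on_map_poly) (auto simp: is_subring_def hom_on_def)
  then show ?thesis by (simp add: polys_in_def)
qed

lemma int_eval_simps:
  "int_eval (P + Q) x = int_eval P x + int_eval Q x" "int_eval (P * Q) x = int_eval P x * int_eval Q x" "int_eval (P ^ n) x = int_eval P x ^ n"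
  "int_eval (smult c P) x = of_int c * int_eval P x" "int_eval (pCons c P) x = of_int c + x * int_eval P x" "int_eval 0 x = 0"
proof -
  have U: "is_subring (UNIV :: int poly set)" by (simp add: is_subring_def)
  note H = hom_onD[OF U hom_of_int_poly]
  show "int_eval (P + Q) x = int_eval P x + int_eval Q x" "int_eval (P * Q) x = int_eval P x * int_eval Q x" by (simp_all add: int_eval_def H)
  show "int_eval (P ^ n) x = int_eval P x ^ n" by (simp add: int_eval_def hom_on_power[OF U hom_of_int_poly])
  show pc: "int_eval (pCons c P) x = of_int c + x * int_eval P x" for c P
    by (simp add: int_eval_def map_poly_pCons)
  show z: "int_eval 0 x = 0" by (simp add: int_eval_def)
  have "int_eval ([:c:] * P) x = of_int c * int_eval P x"
    by (simp only: int_eval_def H(6)[OF UNIV_I UNIV_I]) (simp add: map_poly_pCons)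
  then show "int_eval (smult c P) x = of_int c * int_eval P x" by simp
qed

lemma int_eval_of_int: "int_eval P (of_int k) = of_int (poly P k)"
  by (induction P) (simp_all add: int_eval_simps)

lemma int_eval_in_subring: "is_subring B \<Longrightarrow> x \<in> B \<Longrightarrow> int_eval P x \<in> B"
  by (induction P) (simp_all add: int_eval_simps subringD subring_of_int)

lemma int_eval_diff_in_prime_ideal:
  assumes B: "is_subring B" and I: "prime_ideal_of B I" and xy: "x \<in> B" "y \<in> B" "x - y \<in> I"
  shows "int_eval P x - int_eval P y \<in> I"
proof (induction P)
  case 0 then show ?case using prime_idealD(1)[OF B I] by (simp add: int_eval_simps)
next
  case (pCons c P)
  have "x * int_eval P x - y * int_eval P y \<in> I"
    by (intro prime_ideal_diff_mult[OF B I] xy int_eval_in_subring[OF B] pCons)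
  then show ?case by (simp add: int_eval_simps)
qed

lemma dvd_poly_diff: "n dvd a - b \<Longrightarrow> n dvd poly P a - poly P b" for n :: int
proof (induction P)
  case (pCons c P)
  have "poly (pCons c P) a - poly (pCons c P) b = a * (poly P a - poly P b) + (a - b) * poly P b"
    by (simp add: algebra_simps)
  then show ?case using pCons by simp
qed simp


text \<open>The bound on the number of roots over a domain, applied to the residue ring without forming
  it: a root is split off by synthetic division, and the remaining points are roots of the quotient
  since their differences are nonzero modulo the prime ideal.\<close>

lemma many_roots_mod_prime_ideal:
  assumes B: "is_subring B" and I: "prime_ideal_of B I"
    and "f \<in> polys_in B" "degree f \<le> n" "finite S" "card S > n" "S \<subseteq> B"
    and "\<And>s. s \<in> S \<Longrightarrow> poly f s \<in> I" "\<And>s t. s \<in> S \<Longrightarrow> t \<in> S \<Longrightarrow> s - t \<in> I \<Longrightarrow> s = t"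
  shows "f \<in> polys_in I"
  using assms(3-)
proof (induction n arbitrary: f S)
  case 0
  then obtain s where "s \<in> S" by fastforce
  moreover obtain c where "f = [:c:]" using 0 by (auto elim: degree_eq_zeroE)
  ultimately show ?case using 0 prime_idealD(1)[OF B I]
    by (auto simp: polys_in_def coeff_pCons split: nat.splits)
next
  case (Suc n)
  note PB = is_subring_polys_in[OF B] and PI = prime_ideal_polys_in[OF B I]
  obtain s where s: "s \<in> S" using Suc.prems by fastforce
  define g where "g = synthetic_div f s"
  have f: "f = [:- s, 1:] * g + [:poly f s:]"
    using synthetic_div_correct'[of s f] by (simp add: g_def)
  have gB: "g \<in> polys_in B"
  proof -
    have "synthetic_div p s \<in> polys_in B" if "p \<in> polys_in B" for p
      using that
    proof (induction p)
      case 0 then show ?case by (simp add: zero_in_polys_in[OF B])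
    next
      case (pCons a p)
      have p: "p \<in> polys_in B"
      proof (rule polys_inI)
        fix i show "coeff p i \<in> B" using polys_inD[OF pCons.prems, of "Suc i"] by simp
      qed
      then have "poly p s \<in> B" using Suc.prems(5) s by (intro poly_in_subring[OF B]) auto
      then show ?case using pCons.IH[OF p] by (simp add: pCons_in_polys_in)
    qed
    then show ?thesis using Suc.prems(1) by (simp add: g_def)
  qed
  have "g \<in> polys_in I"
  proof (rule Suc.IH[OF gB])
    show "degree g \<le> n" using Suc.prems(2) by (simp add: g_def degree_synthetic_div)
    show "card (S - {s}) > n" using Suc.prems s by (simp add: card_Diff_singleton)
    fix t assume t: "t \<in> S - {s}"
    have "(t - s) * poly g t = poly f t - poly f s" by (subst f) (simp add: algebra_simps)
    also have "\<dots> \<in> I" using Suc.prems(6) s t prime_idealD(6)[OF B I] by simp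
    finally have "t - s \<in> I \<or> poly g t \<in> I"
      using t s Suc.prems(5) by (intro prime_idealD(9)[OF B I] subringD(5)[OF B] poly_in_subring[OF B gB]) auto
    then show "poly g t \<in> I" using Suc.prems(7)[of t s] t s by auto
  qed (use Suc.prems in auto)
  then have "[:- s, 1:] * g \<in> polys_in I"
    using Suc.prems(5) s subringD[OF B]
    by (intro prime_idealD(7)[OF PB PI] pCons_in_polys_in zero_in_polys_in[OF B]) auto
  moreover have "[:poly f s:] \<in> polys_in I"
  proof (rule polys_inI)
    fix i show "coeff [:poly f s:] i \<in> I"
      using Suc.prems(6)[OF s] prime_idealD(1)[OF B I] by (cases i) auto
  qed
  ultimately show ?case by (subst f) (rule prime_idealD(4)[OF PB PI])
qed

text \<open>The polynomial \<open>x^p - x\<close> already has the \<open>p\<close> roots \<open>0, \<dots>, p - 1\<close> modulo \<open>I\<close>.\<close>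

lemma fixed_by_frobenius:
  assumes B: "is_subring B" and I: "prime_ideal_of B I" and p: "prime (p::nat)" "of_nat p \<in> I"
    and x: "x \<in> B" "x ^ p - x \<in> I"
  obtains k where "k < p" "x - of_nat k \<in> I"
proof (rule ccontr)
  assume "\<not> thesis"
  then have no: "x - of_nat k \<notin> I" if "k < p" for k using that \<open>\<And>k. k < p \<Longrightarrow> x - of_nat k \<in> I \<Longrightarrow> thesis\<close> by blast
  have eq: "j = k" if "of_nat j - of_nat k \<in> I" "j < p" "k < p" for j k
  proof -
    have "of_int (int j - int k) \<in> I" using that(1) by simp
    then have "int p dvd int j - int k" using of_int_in_prime_ideal[OF B I p] by blast
    then have "int j mod int p = int k mod int p" by (simp add: mod_eq_dvd_iff)
    then show ?thesis using that(2,3) by simp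
  qed
  define f where "f = monom 1 p - monom (1::'a) 1"
  let ?S = "insert x (of_nat ` {..<p})"
  have fB: "f \<in> polys_in B" unfolding f_def
    by (intro subringD(5)[OF is_subring_polys_in[OF B]] monom_in_polys_in[OF B] subringD[OF B])
  have p1: "p > 1" using p(1) by (rule prime_gt_1_nat)
  have "f \<in> polys_in I"
  proof (rule many_roots_mod_prime_ideal[OF B I fB])
    show "degree f \<le> p" unfolding f_def using p1
      by (intro degree_diff_le) (auto intro: order_trans[OF degree_monom_le])
    have "inj_on (of_nat :: nat \<Rightarrow> 'a) {..<p}"
      using eq prime_idealD(1)[OF B I] by (auto intro!: inj_onI)
    moreover have "x \<notin> of_nat ` {..<p}" using no prime_idealD(1)[OF B I] by fastforce
    ultimately show "card ?S > p" by (simp add: card_image)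
    show "?S \<subseteq> B" using x subring_of_nat[OF B] by auto
    fix s assume s: "s \<in> ?S"
    show "poly f s \<in> I"
    proof (cases "s = x")
      case True then show ?thesis using x by (simp add: f_def poly_monom)
    next
      case False
      then obtain k where "s = of_int (int k)" using s by auto
      then show ?thesis using frobenius_of_int[OF B I p, of "int k"] by (simp add: f_def poly_monom)
    qed
    fix t assume t: "t \<in> ?S" and st: "s - t \<in> I"
    have "t - s \<in> I" using prime_idealD(5)[OF B I st] by simp
    then show "s = t" using s t st no eq by auto
  qed simp
  then have "coeff f p \<in> I" by (rule polys_inD)
  then show False using p1 prime_idealD(2)[OF B I] by (simp add: f_def)
qed


section \<open>The polynomial \<open>h\<close> and its roots modulo primes\<close>

abbreviation h_int :: "int poly" where "h_int \<equiv> [:-1, 2, -3, 1, 3, -8, 1, 1:]"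

lemma map_poly_h: "map_poly of_rat h_poly = ([:-1, 2, -3, 1, 3, -8, 1, 1:] :: 'a::field_char_0 poly)"
  by (simp add: h_poly_def map_poly_pCons of_rat_minus)

lemma roots_of_h: "roots_of h_poly = {x :: 'a::field_char_0. int_eval h_int x = 0}"
  unfolding roots_of_def map_poly_h by (simp add: int_eval_simps)

abbreviation "roots_h \<equiv> (roots_of h_poly :: complex set)"

text \<open>The integer combination of \<open>h\<close> and its derivative comes from the extended Euclidean
  algorithm. Its value \<open>38936\<close> is \<open>2^3 * 31 * 157\<close>, so \<open>h\<close> has simple roots, also modulo every
  other prime.\<close>

lemma h_bezout:
  fixes x :: complex
  assumes "x \<in> roots_h"
  shows "int_eval [:2040, 1853, 16562, 7178, -18347, 1163, 1899:] x * poly (pderiv h_complex) x = of_int 38936"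
proof -
  have "[:-34856, -78246, -23798, 97309, -6242, -13293:] * h_int +
      [:2040, 1853, 16562, 7178, -18347, 1163, 1899:] * [:2, -6, 3, 12, -40, 6, 7:] = [:38936:]"
    by simp
  from arg_cong[OF this, of "\<lambda>P. int_eval P x"] have
    "int_eval [:-34856, -78246, -23798, 97309, -6242, -13293:] x * int_eval h_int x +
      int_eval [:2040, 1853, 16562, 7178, -18347, 1163, 1899:] x * int_eval [:2, -6, 3, 12, -40, 6, 7:] x = of_int 38936"
    by (simp only: int_eval_simps) simp
  moreover have "int_eval [:2, -6, 3, 12, -40, 6, 7:] x = poly (pderiv h_complex) x"
    by (simp add: int_eval_simps pderiv_pCons)
  moreover have "int_eval h_int x = 0" using assms by (simp add: roots_of_h)
  ultimately show ?thesis by simp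
qed

lemma rsquarefree_h: "rsquarefree (map_poly of_rat h_poly :: complex poly)"
  unfolding rsquarefree_roots
proof (intro allI notI)
  fix x :: complex assume *: "poly (map_poly of_rat h_poly) x = 0 \<and> poly (pderiv (map_poly of_rat h_poly)) x = 0"
  then have "x \<in> roots_h" by (simp add: roots_of_def)
  from h_bezout[OF this] * show False by (simp add: map_poly_h)
qed

lemma h_complex_prod: "h_complex = (\<Prod>a\<in>roots_h. [:- a, 1:])"
  using complex_poly_decompose_rsquarefree[OF rsquarefree_h] by (simp add: map_poly_h roots_of_def)

lemma finite_roots_h: "finite roots_h"
  by (rule finite_roots_of) (simp add: h_poly_def)

lemma card_roots_h: "card roots_h = 7"
  using card_roots_rsquarefree[OF rsquarefree_h] by (simp add: map_poly_h roots_of_def)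

lemma algebraic_int_root_h:
  assumes "a \<in> roots_h" shows "algebraic_int a"
  by (rule algebraic_int.intros[of h_complex])
     (use assms in \<open>auto simp: roots_of_def map_poly_h coeff_pCons split: nat.splits\<close>)

lemma pderiv_h_root:
  assumes "a \<in> roots_h" shows "poly (pderiv h_complex) a = (\<Prod>b\<in>roots_h - {a}. a - b)"
proof -
  have "poly (pderiv h_complex) a = (\<Sum>c\<in>roots_h. \<Prod>b\<in>roots_h - {c}. a - b)"
    by (subst h_complex_prod) (simp add: pderiv_prod poly_sum poly_prod pderiv_pCons)
  also have "\<dots> = (\<Sum>c\<in>{a}. \<Prod>b\<in>roots_h - {c}. a - b)"
    using assms finite_roots_h by (intro sum.mono_neutral_right) (auto intro!: prod_zero)
  finally show ?thesis by simp
qed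


text \<open>If two roots were congruent, then the derivative of \<open>h\<close> would vanish at one of them modulo
  \<open>m\<close>, and so would the Bezout constant.\<close>

lemma roots_h_distinct_mod:
  assumes B: "is_subring B" "prime_ideal_of B m" "of_nat p \<in> m" "Collect algebraic_int \<subseteq> B"
    and p: "prime (p::nat)" "\<not> int p dvd 38936"
    and ab: "a \<in> roots_h" "b \<in> roots_h" "a - b \<in> m"
  shows "a = b"
proof (rule ccontr)
  assume "a \<noteq> b"
  have R: "c \<in> B" if "c \<in> roots_h" for c using B(4) algebraic_int_root_h[OF that] by blast
  have "poly (pderiv h_complex) a = (a - b) * (\<Prod>c\<in>roots_h - {a} - {b}. a - c)"
    unfolding pderiv_h_root[OF ab(1)] using finite_roots_h ab \<open>a \<noteq> b\<close> by (intro prod.remove) auto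
  also have "\<dots> \<in> m"
    using R ab by (intro prime_idealD(8)[OF B(1,2)] subring_prod[OF B(1)] subringD(5)[OF B(1)]) auto
  finally have "of_int 38936 \<in> m"
    using prime_idealD(7)[OF B(1,2) int_eval_in_subring[OF B(1) R[OF ab(1)]]] h_bezout[OF ab(1)] by metis
  then show False using of_int_in_prime_ideal[OF B(1,2) p(1) B(3)] p(2) by blast
qed

text \<open>Evaluation at \<open>k\<close> of the factorization of \<open>h\<close> into linear factors.\<close>

lemma root_h_near_int:
  assumes B: "is_subring B" "prime_ideal_of B m" "of_nat p \<in> m" "Collect algebraic_int \<subseteq> B"
    and p: "prime (p::nat)" 
  shows "(\<exists>a\<in>roots_h. a - of_int k \<in> m) \<longleftrightarrow> int p dvd poly h_int k"
proof
  assume "\<exists>a\<in>roots_h. a - of_int k \<in> m"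
  then obtain a where a: "a \<in> roots_h" "a - of_int k \<in> m" by blast
  have "int_eval h_int a - int_eval h_int (of_int k) \<in> m"
    using B(4) algebraic_int_root_h[OF a(1)]
    by (intro int_eval_diff_in_prime_ideal[OF B(1,2)] a subring_of_int[OF B(1)]) auto
  then have "- of_int (poly h_int k) \<in> m" using a(1) unfolding int_eval_of_int by (simp add: roots_of_h)
  then have "of_int (poly h_int k) \<in> m"
    using prime_idealD(5)[OF B(1,2)] by (metis minus_minus)
  then show "int p dvd poly h_int k"
    by (rule of_int_in_prime_ideal[OF B(1,2) p B(3), THEN iffD1])
next
  assume "int p dvd poly h_int k"
  then have "of_int (poly h_int k) \<in> m" using of_int_in_prime_ideal[OF B(1,2) p B(3)] by blast
  also have "of_int (poly h_int k) = poly h_complex (of_int k)" by simp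
  also have "\<dots> = (\<Prod>a\<in>roots_h. of_int k - a)" by (subst h_complex_prod) (simp add: poly_prod)
  finally have "\<exists>a\<in>roots_h. of_int k - a \<in> m"
    using B(4) algebraic_int_root_h finite_roots_h
    by (intro prime_ideal_prod[OF B(1,2)] subringD(5)[OF B(1)] subring_of_int[OF B(1)]) auto
  then obtain a where "a \<in> roots_h" "of_int k - a \<in> m" by blast
  then show "\<exists>a\<in>roots_h. a - of_int k \<in> m" using prime_idealD(5)[OF B(1,2), of "of_int k - a"] by auto
qed

lemma frobenius_h:
  assumes p: "prime (p::nat)" "\<not> int p dvd 38936"
  obtains B m \<sigma> where "is_subring B" "prime_ideal_of B m" "of_nat p \<in> m" "Collect algebraic_int \<subseteq> B"
    "\<sigma> \<in> carrier (Gal h_poly)" "\<forall>a\<in>roots_h. \<sigma> a - a ^ p \<in> m"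
proof -
  obtain B m :: "complex set" where B: "is_subring B" "prime_ideal_of B m" "of_nat p \<in> m"
     "\<And>x. algebraic_int x \<Longrightarrow> x \<in> B" using exists_prime_over[OF p(1)] by metis
  obtain \<sigma> where "\<sigma> \<in> carrier (Gal h_poly)" "\<And>a. a \<in> roots_h \<Longrightarrow> \<sigma> a - a ^ p \<in> m"
    using exists_frobenius[OF rsquarefree_h algebraic_int_root_h p(1) B] by metis
  with B that[of B m \<sigma>] show ?thesis by auto
qed

text \<open>The Frobenius element fixes a root exactly if the root is congruent to an element of the
  prime field; the fixed roots are thus counted by the roots of \<open>h\<close> modulo \<open>p\<close>.\<close>

lemma frobenius_h_fixed_iff:
  assumes B: "is_subring B" "prime_ideal_of B m" "of_nat p \<in> m" "Collect algebraic_int \<subseteq> B"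
    and p: "prime (p::nat)" "\<not> int p dvd 38936"
    and s: "\<sigma> \<in> carrier (Gal h_poly)" "\<forall>a\<in>roots_h. \<sigma> a - a ^ p \<in> m"
    and a: "a \<in> roots_h"
  shows "\<sigma> a = a \<longleftrightarrow> (\<exists>k<p. int p dvd poly h_int (int k) \<and> a - of_nat k \<in> m)"
proof
  have aB: "a \<in> B" using B(4) algebraic_int_root_h[OF a] by blast
  note near = root_h_near_int[OF B p(1)]
  { assume "\<sigma> a = a"
    then have "a ^ p - a \<in> m" using prime_idealD(5)[OF B(1,2) bspec[OF s(2) a]] by simp
    then obtain k where k: "k < p" "a - of_nat k \<in> m" by (rule fixed_by_frobenius[OF B(1,2) p(1) B(3) aB])
    then have "int p dvd poly h_int (int k)" using near[of "int k"] a by auto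
    with k show "\<exists>k<p. int p dvd poly h_int (int k) \<and> a - of_nat k \<in> m" by blast }
  assume "\<exists>k<p. int p dvd poly h_int (int k) \<and> a - of_nat k \<in> m"
  then obtain k where k: "a - of_nat k \<in> m" by blast
  have "a ^ p - of_nat k ^ p \<in> m"
    by (intro prime_ideal_diff_power[OF B(1,2) aB _ k] subring_of_nat[OF B(1)])
  note 1 = prime_idealD(4)[OF B(1,2) bspec[OF s(2) a] this]
  have "of_nat k ^ p - of_nat k \<in> m"
    using frobenius_of_int[OF B(1,2) p(1) B(3), of "int k"] by simp
  from prime_idealD(6)[OF B(1,2) prime_idealD(4)[OF B(1,2) 1 this] k]
  have "\<sigma> a - a \<in> m" by simp
  then show "\<sigma> a = a" by (rule roots_h_distinct_mod[OF B p Gal_root[OF s(1) a] a])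
qed

lemma cube_step:
  assumes B: "is_subring B" "prime_ideal_of B m" "(3::complex) \<in> m" "x \<in> B" "x \<in> roots_h"
    and k: "x ^ (3 ^ k) - int_eval r x \<in> m" and cert: "r ^ 3 = h_int * q + smult 3 s + r'"
  shows "x ^ (3 ^ Suc k) - int_eval r' x \<in> m"
proof -
  have "(x ^ (3 ^ k)) ^ 3 - int_eval r x ^ 3 \<in> m"
    by (intro prime_ideal_diff_power[OF B(1,2)] subring_power[OF B(1)] int_eval_in_subring[OF B(1)] B k)
  moreover have "(x ^ (3 ^ k)) ^ 3 = x ^ (3 ^ Suc k)" by (simp flip: power_mult add: mult.commute)
  moreover have "int_eval r x ^ 3 = 3 * int_eval s x + int_eval r' x"
    unfolding int_eval_simps(3)[symmetric] cert using B(5) by (simp add: int_eval_simps(1,2,4) roots_of_h del: mult_pCons_left)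
  moreover have "3 * int_eval s x \<in> m" by (intro prime_idealD(8)[OF B(1,2)] int_eval_in_subring[OF B(1)] B)
  ultimately show ?thesis using prime_idealD(4)[OF B(1,2), of "x ^ (3 ^ Suc k) - int_eval r x ^ 3" "3 * int_eval s x"]
    by simp
qed

text \<open>Repeated cubing modulo \<open>h\<close> and 3. In each step the listed polynomials are the quotient by
  \<open>h\<close>, the multiple of 3, and the remainder with coefficients in \<open>-1, 0, 1\<close>; after seven steps the
  remainder is \<open>x\<close> again, which reflects the irreducibility of \<open>h\<close> modulo 3.\<close>

lemma frobenius_3_power_7:
  assumes B: "is_subring B" "prime_ideal_of B m" "(3::complex) \<in> m" "x \<in> B" "x \<in> roots_h"
  shows "x ^ (3 ^ 7) - x \<in> m"
proof -
  note step = cube_step[OF B]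
  have "x ^ 3 ^ 0 - int_eval [:0, 1:] x \<in> m" using prime_idealD(1)[OF B(1,2)] by (simp add: int_eval_simps)
  from step[OF this, of "0" "0" "[:0, 0, 0, 1:]"]
  have "x ^ 3 ^ Suc 0 - int_eval [:0, 0, 0, 1:] x \<in> m" by (simp add: power3_eq_cube)
  from step[OF this, of "[:9, -1, 1:]" "[:3, -6, 10, -5, -8, 25, -7:]" "[:0, -1, 0, 1, 1, -1, 1:]"]
  have "x ^ 3 ^ Suc (Suc 0) - int_eval [:0, -1, 0, 1, 1, -1, 1:] x \<in> m" by (simp add: power3_eq_cube)
  from step[OF this, of "[:-1308115, 375554, -107241, 30896, -8772, 2551, -712, 212, -57, 18, -4, 1:]" "[:-436038, 997261, -1594231, 893385, 1052168, -3790518, 1523749:]" "[:-1, 1, -1, -1, 0, -1:]"]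
  have "x ^ 3 ^ Suc (Suc (Suc 0)) - int_eval [:-1, 1, -1, -1, 0, -1:] x \<in> m" by (simp add: power3_eq_cube)
  from step[OF this, of "[:-14983, 3986, -1286, 301, -118, 20, -12, 1, -1:]" "[:-4995, 11318, -18071, 9939, 12128, -43129, 16677:]" "[:1, 1, 0, 1, 1, 1, -1:]"]
  have "x ^ 3 ^ Suc (Suc (Suc (Suc 0))) - int_eval [:1, 1, 0, 1, 1, 1, -1:] x \<in> m" by (simp add: power3_eq_cube)
  from step[OF this, of "[:995069, -285110, 81682, -23408, 6703, -1922, 550, -158, 45, -12, 4, -1:]" "[:331690, -758415, 1212371, -679056, -800508, 2882887, -1157692:]" "[:0, 0, -1, 1, 1, -1, 1:]"]
  have "x ^ 3 ^ Suc (Suc (Suc (Suc (Suc 0)))) - int_eval [:0, 0, -1, 1, 1, -1, 1:] x \<in> m" by (simp add: power3_eq_cube)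
  from step[OF this, of "[:-1283092, 368315, -105201, 30296, -8607, 2500, -700, 209, -57, 18, -4, 1:]" "[:-427697, 978166, -1563702, 876245, 1032053, -3717959, 1494466:]" "[:-1, 1, -1, 0, 0, -1, -1:]"]
  have "x ^ 3 ^ Suc (Suc (Suc (Suc (Suc (Suc 0))))) - int_eval [:-1, 1, -1, 0, 0, -1, -1:] x \<in> m" by (simp add: power3_eq_cube)
  from step[OF this, of "[:196207, -60753, 15264, -5385, 1065, -530, 46, -63, -5, -9, -2, -1:]" "[:65402, -151055, 241795, -138124, -156749, 572612, -239445:]" "[:0, 1:]"]
  have "x ^ 3 ^ Suc (Suc (Suc (Suc (Suc (Suc (Suc 0)))))) - int_eval [:0, 1:] x \<in> m" by (simp add: power3_eq_cube)
  moreover have "int_eval [:0, 1:] x = x" by (simp add: int_eval_simps)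
  moreover have "(7::nat) = Suc (Suc (Suc (Suc (Suc (Suc (Suc 0))))))" by simp
  ultimately show ?thesis by (simp only:)
qed

lemma h_no_root_mod_3: "\<not> 3 dvd poly h_int k"
proof
  assume d: "3 dvd poly h_int k"
  have "3 dvd poly h_int k - poly h_int (k mod 3)" by (rule dvd_poly_diff) simp
  from dvd_diff[OF d this] have "3 dvd poly h_int (k mod 3)"
    by (simp only: diff_diff_eq2 add_diff_cancel_left')
  moreover have "k mod 3 = 0 \<or> k mod 3 = 1 \<or> k mod 3 = 2" by presburger
  ultimately show False by (elim disjE) simp_all
qed

lemma exists_seven_cycle:
  obtains \<sigma> where "\<sigma> \<in> carrier (Gal h_poly)" "\<And>a. a \<in> roots_h \<Longrightarrow> (\<sigma> ^^ 7) a = a"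
    "\<And>a. a \<in> roots_h \<Longrightarrow> \<sigma> a \<noteq> a"
proof -
  have p: "prime (3::nat)" "\<not> int 3 dvd 38936" by simp_all
  obtain B m \<sigma> where B: "is_subring B" "prime_ideal_of B m" "of_nat 3 \<in> m" "Collect algebraic_int \<subseteq> B"
    and s: "\<sigma> \<in> carrier (Gal h_poly)" "\<forall>a\<in>roots_h. \<sigma> a - a ^ 3 \<in> m"
    using frobenius_h[OF p] by metis
  have R: "a \<in> B" if "a \<in> roots_h" for a using B(4) algebraic_int_root_h[OF that] by blast
  show ?thesis
  proof (rule that[OF s(1)])
    fix a :: complex assume a: "a \<in> roots_h"
    have "(\<sigma> ^^ k) a \<in> roots_h \<and> (\<sigma> ^^ k) a - a ^ (3 ^ k) \<in> m" for k
    proof (induction k)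
      case 0 then show ?case using a prime_idealD(1)[OF B(1,2)] by simp
    next
      case (Suc k)
      let ?b = "(\<sigma> ^^ k) a"
      have "?b ^ 3 - (a ^ (3 ^ k)) ^ 3 \<in> m"
        using Suc R a by (intro prime_ideal_diff_power[OF B(1,2)] subring_power[OF B(1)]) auto
      then have "(\<sigma> ?b - ?b ^ 3) + (?b ^ 3 - (a ^ (3 ^ k)) ^ 3) \<in> m"
        using s(2) Suc by (intro prime_idealD(4)[OF B(1,2)]) auto
      moreover have "(a ^ (3 ^ k)) ^ 3 = a ^ (3 ^ Suc k)" by (simp flip: power_mult add: mult.commute)
      ultimately show ?case using Gal_root[OF s(1)] Suc by simp
    qed
    note pow = this[of 7]
    have "(\<sigma> ^^ 7) a - a ^ (3 ^ 7) + (a ^ (3 ^ 7) - a) \<in> m"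
      using pow frobenius_3_power_7[OF B(1,2) _ R[OF a] a] B(3) by (intro prime_idealD(4)[OF B(1,2)]) auto
    then have "(\<sigma> ^^ 7) a - a \<in> m" by simp
    then show "(\<sigma> ^^ 7) a = a" using pow by (intro roots_h_distinct_mod[OF B p _ a]) auto
    show "\<sigma> a \<noteq> a" using frobenius_h_fixed_iff[OF B p s a] h_no_root_mod_3 by simp
  qed
qed

lemma h_roots_mod_17: "{k. k < 17 \<and> 17 dvd poly h_int (int k)} = {2, 9, 10, 12}"
proof -
  have "17 dvd poly h_int (int k) \<longleftrightarrow> k \<in> {2, 9, 10, 12}" if "k < 17" for k
  proof -
    have "k = 0 \<or> k = 1 \<or> k = 2 \<or> k = 3 \<or> k = 4 \<or> k = 5 \<or> k = 6 \<or> k = 7 \<or> k = 8 \<or> k = 9 \<or>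
      k = 10 \<or> k = 11 \<or> k = 12 \<or> k = 13 \<or> k = 14 \<or> k = 15 \<or> k = 16"
      using that by presburger
    then show ?thesis by (elim disjE) simp_all
  qed
  then show ?thesis by auto
qed

lemma exists_three_cycle:
  obtains \<sigma> where "\<sigma> \<in> carrier (Gal h_poly)" "card {a \<in> roots_h. \<sigma> a \<noteq> a} = 3"
proof -
  have p: "prime (17::nat)" "\<not> int 17 dvd 38936" by simp_all
  obtain B m \<sigma> where B: "is_subring B" "prime_ideal_of B m" "of_nat 17 \<in> m" "Collect algebraic_int \<subseteq> B"
    and s: "\<sigma> \<in> carrier (Gal h_poly)" "\<forall>a\<in>roots_h. \<sigma> a - a ^ 17 \<in> m"
    using frobenius_h[OF p] by metis
  have R: "a \<in> B" if "a \<in> roots_h" for a using B(4) algebraic_int_root_h[OF that] by blast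
  let ?F = "{a \<in> roots_h. \<sigma> a = a}" and ?K = "{k. k < 17 \<and> 17 dvd poly h_int (int k)}"
  have "\<exists>a\<in>roots_h. a - of_nat k \<in> m" if "k \<in> ?K" for k
    using root_h_near_int[OF B p(1), of "int k"] that by simp
  then have "\<forall>k\<in>?K. \<exists>a. a \<in> roots_h \<and> a - of_nat k \<in> m" by blast
  from bchoice[OF this] obtain \<rho> where \<rho>: "\<And>k. k \<in> ?K \<Longrightarrow> \<rho> k \<in> roots_h \<and> \<rho> k - of_nat k \<in> m"
    by blast
  have "bij_betw \<rho> ?K ?F"
  proof (rule bij_betwI')
    fix j k assume jk: "j \<in> ?K" "k \<in> ?K"
    show "\<rho> j = \<rho> k \<longleftrightarrow> j = k"
    proof
      assume eq: "\<rho> j = \<rho> k"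
      have "(\<rho> j - of_nat k) - (\<rho> j - of_nat j) \<in> m"
        by (rule prime_idealD(6)[OF B(1,2)]) (use \<rho>[OF jk(1)] \<rho>[OF jk(2)] eq in simp_all)
      then have "of_int (int j - int k) \<in> m" by simp
      then have "int 17 dvd int j - int k" using of_int_in_prime_ideal[OF B(1,2) p(1) B(3)] by blast
      then have "int j mod 17 = int k mod 17" by (simp add: mod_eq_dvd_iff)
      then show "j = k" using jk by simp
    qed simp
  next
    fix k assume "k \<in> ?K"
    then show "\<rho> k \<in> ?F" using \<rho>[of k] frobenius_h_fixed_iff[OF B p s, of "\<rho> k"] by auto
  next
    fix a assume a: "a \<in> ?F"
    then obtain k where k: "k \<in> ?K" "a - of_nat k \<in> m" using frobenius_h_fixed_iff[OF B p s, of a] by auto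
    then have "(a - of_nat k) - (\<rho> k - of_nat k) \<in> m"
      using \<rho>[OF k(1)] by (intro prime_idealD(6)[OF B(1,2) k(2)]) blast
    then have "a = \<rho> k" using a \<rho>[OF k(1)] by (intro roots_h_distinct_mod[OF B p]) auto
    with k show "\<exists>k\<in>?K. a = \<rho> k" by blast
  qed
  then have "card ?F = card ?K" by (simp add: bij_betw_same_card)
  also have "\<dots> = 4" unfolding h_roots_mod_17 by simp
  finally have F: "card ?F = 4" .
  have "{a \<in> roots_h. \<sigma> a \<noteq> a} = roots_h - ?F" by auto
  then have "card {a \<in> roots_h. \<sigma> a \<noteq> a} = 3"
    using finite_roots_h card_roots_h F by (simp add: card_Diff_subset)
  with s(1) show ?thesis by (rule that)
qed


section \<open>The discriminant of \<open>h\<close>\<close>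

text \<open>The product of the differences over pairs of list entries; its square is the
  discriminant of the monic polynomial with these roots.\<close>

fun vandermonde_prod :: "'a::comm_ring_1 list \<Rightarrow> 'a" where
  "vandermonde_prod [] = 1"
| "vandermonde_prod (x # xs) = (\<Prod>y\<leftarrow>xs. x - y) * vandermonde_prod xs"

lemma prod_list_set: "distinct xs \<Longrightarrow> prod_list (map f xs) = (\<Prod>x\<in>set xs. f x)"
  by (rule prod.distinct_set_conv_list[symmetric])

text \<open>Each unordered pair contributes both orders of its difference, that is minus a square.\<close>

lemma prod_differences:
  fixes xs :: "'a::comm_ring_1 list"
  assumes "distinct xs"
  shows "(\<Prod>x\<in>set xs. \<Prod>y\<in>set xs - {x}. x - y) =
    (- 1) ^ (\<Sum>i<length xs. i) * vandermonde_prod xs ^ 2"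
  using assms
proof (induction xs)
  case (Cons a xs)
  then have a: "a \<notin> set xs" and d: "distinct xs" by auto
  have "(\<Prod>x\<in>set (a # xs). \<Prod>y\<in>set (a # xs) - {x}. x - y) =
      (\<Prod>y\<in>set xs. a - y) * (\<Prod>x\<in>set xs. \<Prod>y\<in>set (a # xs) - {x}. x - y)"
    using a by simp
  also have "(\<Prod>x\<in>set xs. \<Prod>y\<in>set (a # xs) - {x}. x - y) =
      (\<Prod>x\<in>set xs. (x - a) * (\<Prod>y\<in>set xs - {x}. x - y))"
  proof (rule prod.cong)
    fix x assume "x \<in> set xs"
    then have "set (a # xs) - {x} = insert a (set xs - {x})" using a by auto
    then show "(\<Prod>y\<in>set (a # xs) - {x}. x - y) = (x - a) * (\<Prod>y\<in>set xs - {x}. x - y)"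
      using a by simp
  qed simp
  also have "\<dots> = (\<Prod>x\<in>set xs. (- 1) * (a - x)) * (\<Prod>x\<in>set xs. \<Prod>y\<in>set xs - {x}. x - y)"
    by (simp add: prod.distrib)
  also have "(\<Prod>x\<in>set xs. (- 1) * (a - x)) = (- 1) ^ length xs * (\<Prod>x\<in>set xs. a - x)"
    using d by (simp only: prod.distrib prod_constant distinct_card)
  finally show ?case
    unfolding Cons.IH[OF d] using d
    by (simp add: prod_list_set power_add power2_eq_square power_mult_distrib mult_ac)
qed simp

lemma vandermonde_prod_swap: "vandermonde_prod (y # x # zs) = - vandermonde_prod (x # y # zs)"
proof -
  have "y - x = - (x - y)" by simp
  then show ?thesis
    unfolding vandermonde_prod.simps list.map prod_list.Cons by (simp only: mult_minus_left mult_minus_right mult_ac)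
qed

lemma hom_vandermonde_prod:
  assumes "is_subring S" "hom_on S f" "set xs \<subseteq> S"
  shows "vandermonde_prod xs \<in> S" "f (vandermonde_prod xs) = vandermonde_prod (map f xs)"
proof -
  have l: "prod_list ys \<in> S \<and> f (prod_list ys) = prod_list (map f ys)" if "set ys \<subseteq> S" for ys
    using that by (induction ys) (auto simp: subringD[OF assms(1)] hom_onD[OF assms(1,2)])
  have "vandermonde_prod xs \<in> S \<and> f (vandermonde_prod xs) = vandermonde_prod (map f xs)"
    using assms(3)
  proof (induction xs)
    case Nil then show ?case using subringD[OF assms(1)] hom_onD[OF assms(1,2)] by simp
  next
    case (Cons x xs)
    have "set (map (\<lambda>y. x - y) xs) \<subseteq> S" using Cons.prems subringD(5)[OF assms(1)] by auto
    note 1 = l[OF this]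
    have "map f (map (\<lambda>y. x - y) xs) = map (\<lambda>y. f x - y) (map f xs)"
      using Cons.prems hom_onD(5)[OF assms(1,2)] by auto
    then have "f (prod_list (map (\<lambda>y. x - y) xs)) = prod_list (map (\<lambda>y. f x - y) (map f xs))"
      using 1 by (simp only:)
    then show ?case
      using 1 Cons subringD(6)[OF assms(1)] hom_onD(6)[OF assms(1,2)] by (simp del: map_map)
  qed
  then show "vandermonde_prod xs \<in> S" "f (vandermonde_prod xs) = vandermonde_prod (map f xs)" by auto
qed

lemma discriminant_h:
  assumes "distinct xs" "set xs = roots_h"
  shows "vandermonde_prod xs ^ 2 = 77872 ^ 2"
proof -
  have "length xs = 7" using assms card_roots_h distinct_card by fastforce
  have "proots h_complex = mset_set roots_h"
  proof (rule multiset_eqI)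
    fix a
    have "poly h_complex a = 0 \<Longrightarrow> order a h_complex = 1"
      using rsquarefree_h rsquarefree_root_order[of h_complex a] by (simp add: map_poly_h)
    moreover have "poly h_complex a \<noteq> 0 \<Longrightarrow> order a h_complex = 0" by (rule order_0I)
    moreover have "a \<in> roots_h \<longleftrightarrow> poly h_complex a = 0" by (simp add: roots_of_def map_poly_h)
    ultimately show "count (proots h_complex) a = count (mset_set roots_h) a"
      using finite_roots_h by (cases "a \<in> roots_h") simp_all
  qed
  then have "root_resultant h_complex (pderiv h_complex) = (\<Prod>a\<in>roots_h. poly (pderiv h_complex) a)"
    by (simp add: root_resultant_def prod_unfold_prod_mset)
  also have "\<dots> = (\<Prod>x\<in>set xs. \<Prod>y\<in>set xs - {x}. x - y)"
    using assms(2) by (intro prod.cong) (auto simp: pderiv_h_root)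
  also have "\<dots> = - (vandermonde_prod xs ^ 2)"
    unfolding prod_differences[OF assms(1)] \<open>length xs = 7\<close> by (simp add: numeral_eq_Suc)
  finally show ?thesis using root_resultant_h by simp
qed

text \<open>A transposition of the first two roots would change the sign of the product of the
  differences, which is one of the rational numbers \<open>\<plusminus>77872\<close>.\<close>

lemma Gal_h_no_transposition:
  assumes s: "\<sigma> \<in> carrier (Gal h_poly)" and ab: "a \<in> roots_h" "b \<in> roots_h" "a \<noteq> b" "\<sigma> a = b" "\<sigma> b = a"
  shows "\<exists>c\<in>roots_h - {a, b}. \<sigma> c \<noteq> c"
proof (rule ccontr)
  assume "\<not> ?thesis"
  then have fx: "\<sigma> c = c" if "c \<in> roots_h - {a, b}" for c using that by blast
  obtain zs where zs: "set zs = roots_h - {a, b}" "distinct zs"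
    using finite_distinct_list[of "roots_h - {a, b}"] finite_roots_h by auto
  let ?xs = "a # b # zs" and ?L = "carrier (splitting_field h_poly)"
  have xs: "distinct ?xs" "set ?xs = roots_h" using zs ab by auto
  have D: "vandermonde_prod ?xs ^ 2 = 77872 ^ 2" by (rule discriminant_h[OF xs])
  from this have "vandermonde_prod ?xs = 77872 \<or> vandermonde_prod ?xs = - 77872" by (simp only: power2_eq_iff)
  then have Q: "vandermonde_prod ?xs \<in> \<rat>" by (elim disjE ssubst) simp_all
  note L = is_subfield_splitting_field[of h_poly]
  have h: "hom_on ?L \<sigma>" using s by (simp add: mem_carrier_Gal)
  have "\<sigma> (vandermonde_prod ?xs) = vandermonde_prod (map \<sigma> ?xs)"
    using xs(2) splitting_field_superset[of h_poly]
    by (intro hom_vandermonde_prod[OF subfield_imp_subring[OF L] h]) auto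
  also have "map \<sigma> ?xs = b # a # zs" using ab fx zs by (auto intro: map_idI)
  also have "vandermonde_prod (b # a # zs) = - vandermonde_prod ?xs" by (rule vandermonde_prod_swap)
  also have "\<sigma> (vandermonde_prod ?xs) = vandermonde_prod ?xs"
    using hom_on_Rats[OF L h] Q by (auto elim: Rats_cases)
  finally have neg: "vandermonde_prod ?xs = - vandermonde_prod ?xs" .
  have "v = 0" if "v = - v" for v :: complex using that by simp
  from D this[OF neg] show False by (simp only:) simp
qed

section \<open>The Galois group of \<open>h\<close>\<close>

text \<open>The permutation of the indices \<open>1, \<dots>, n\<close> induced by \<open>\<sigma>\<close> through the numbering \<open>\<alpha>\<close> of the
  roots.\<close>

definition root_perm :: "nat \<Rightarrow> (nat \<Rightarrow> complex) \<Rightarrow> (complex \<Rightarrow> complex) \<Rightarrow> nat \<Rightarrow> nat" where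
  "root_perm n \<alpha> \<sigma> i = (if i \<in> {1..n} then inv_into {1..n} \<alpha> (\<sigma> (\<alpha> i)) else i)"

lemma root_perm_props:
  assumes \<alpha>: "bij_betw \<alpha> {1..n} (roots_of f)" and s: "\<sigma> \<in> carrier (Gal f)"
  shows "i \<in> {1..n} \<Longrightarrow> \<alpha> (root_perm n \<alpha> \<sigma> i) = \<sigma> (\<alpha> i)"
    and "i \<in> {1..n} \<Longrightarrow> root_perm n \<alpha> \<sigma> i \<in> {1..n}"
    and "root_perm n \<alpha> \<sigma> permutes {1..n}"
proof -
  have \<alpha>i: "\<alpha> i \<in> roots_of f" if "i \<in> {1..n}" for i using \<alpha> that by (auto simp: bij_betw_def)
  have \<sigma>\<alpha>: "\<sigma> (\<alpha> i) \<in> \<alpha> ` {1..n}" if "i \<in> {1..n}" for i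
    using Gal_root[OF s \<alpha>i[OF that]] \<alpha> by (simp add: bij_betw_def)
  show 1: "\<alpha> (root_perm n \<alpha> \<sigma> i) = \<sigma> (\<alpha> i)" if "i \<in> {1..n}" for i
    using f_inv_into_f[OF \<sigma>\<alpha>[OF that]] that by (simp add: root_perm_def)
  show 2: "root_perm n \<alpha> \<sigma> i \<in> {1..n}" if "i \<in> {1..n}" for i
    using inv_into_into[OF \<sigma>\<alpha>[OF that]] that by (simp add: root_perm_def)
  have "inj_on (root_perm n \<alpha> \<sigma>) {1..n}"
  proof (rule inj_onI)
    fix i j assume ij: "i \<in> {1..n}" "j \<in> {1..n}" "root_perm n \<alpha> \<sigma> i = root_perm n \<alpha> \<sigma> j"
    then have eq: "\<sigma> (\<alpha> i) = \<sigma> (\<alpha> j)" using 1 by metis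
    have "inj_on \<sigma> (carrier (splitting_field f))" using s by (simp add: mem_carrier_Gal bij_betw_def)
    moreover have "\<alpha> i \<in> carrier (splitting_field f)" "\<alpha> j \<in> carrier (splitting_field f)"
      using \<alpha>i ij splitting_field_superset[of f] by auto
    ultimately have "\<alpha> i = \<alpha> j" using eq by (auto dest: inj_onD)
    then show "i = j" using \<alpha> ij by (auto simp: bij_betw_def dest: inj_onD)
  qed
  then show "root_perm n \<alpha> \<sigma> permutes {1..n}"
    using 2 by (intro inj_imp_permutes) (auto simp: root_perm_def)
qed

lemma root_perm_eqI:
  assumes \<alpha>: "bij_betw \<alpha> {1..n} (roots_of f)" and s: "\<sigma> \<in> carrier (Gal f)"
    and g: "g permutes {1..n}" "\<And>i. i \<in> {1..n} \<Longrightarrow> \<alpha> (g i) = \<sigma> (\<alpha> i)"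
  shows "root_perm n \<alpha> \<sigma> = g"
proof
  fix i
  show "root_perm n \<alpha> \<sigma> i = g i"
  proof (cases "i \<in> {1..n}")
    case True
    then have "\<alpha> (root_perm n \<alpha> \<sigma> i) = \<alpha> (g i)" using root_perm_props(1)[OF \<alpha> s True] g(2) by simp
    moreover have "g i \<in> {1..n}" using permutes_in_image[OF g(1)] True by simp
    ultimately show ?thesis
      using root_perm_props(2)[OF \<alpha> s True] \<alpha> by (auto simp: bij_betw_def dest: inj_onD)
  next
    case False
    then show ?thesis unfolding root_perm_def using permutes_not_in[OF g(1) False] by (simp only: if_False)
  qed
qed

lemma root_perm_compose:
  assumes \<alpha>: "bij_betw \<alpha> {1..n} (roots_of f)" and s: "\<sigma> \<in> carrier (Gal f)" and t: "\<tau> \<in> carrier (Gal f)"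
  shows "root_perm n \<alpha> (compose (carrier (splitting_field f)) \<sigma> \<tau>) = root_perm n \<alpha> \<sigma> \<circ> root_perm n \<alpha> \<tau>"
proof (rule root_perm_eqI[OF \<alpha> Gal_compose[OF s t]])
  note S = root_perm_props[OF \<alpha> s] and T = root_perm_props[OF \<alpha> t]
  show "root_perm n \<alpha> \<sigma> \<circ> root_perm n \<alpha> \<tau> permutes {1..n}" by (rule permutes_compose[OF T(3) S(3)])
  fix i assume i: "i \<in> {1..n}"
  then have "\<alpha> i \<in> carrier (splitting_field f)" using \<alpha> splitting_field_superset[of f] by (auto simp: bij_betw_def)
  then show "\<alpha> ((root_perm n \<alpha> \<sigma> \<circ> root_perm n \<alpha> \<tau>) i) = compose (carrier (splitting_field f)) \<sigma> \<tau> (\<alpha> i)"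
    using S(1)[OF T(2)[OF i]] T(1)[OF i] by (simp add: compose_eq)
qed

lemma inj_on_root_perm:
  assumes \<alpha>: "bij_betw \<alpha> {1..n} (roots_of f)"
  shows "inj_on (root_perm n \<alpha>) (carrier (Gal f))"
proof (rule inj_onI)
  fix \<sigma> \<tau> assume st: "\<sigma> \<in> carrier (Gal f)" "\<tau> \<in> carrier (Gal f)" "root_perm n \<alpha> \<sigma> = root_perm n \<alpha> \<tau>"
  show "\<sigma> = \<tau>"
  proof (rule Gal_eqI[OF st(1,2)])
    fix a :: complex assume "a \<in> roots_of f"
    then have "a \<in> \<alpha> ` {1..n}" using \<alpha> by (simp add: bij_betw_def)
    then obtain i where "i \<in> {1..n}" "a = \<alpha> i" by blast
    then show "\<sigma> a = \<tau> a" using root_perm_props(1)[OF \<alpha> st(1)] root_perm_props(1)[OF \<alpha> st(2)] st(3) by metis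
  qed
qed

text \<open>Inverses come from finiteness: left translation by an element is injective on the set of
  induced permutations, hence reaches the identity.\<close>

lemma perm_group_on_root_perm:
  assumes \<alpha>: "bij_betw \<alpha> {1..n} (roots_of f)" and f: "f \<noteq> 0"
  shows "perm_group_on {1..n} (root_perm n \<alpha> ` carrier (Gal f))" (is "perm_group_on _ ?H")
    and "id \<in> root_perm n \<alpha> ` carrier (Gal f)"
proof -
  have id: "root_perm n \<alpha> (restrict (\<lambda>x. x) (carrier (splitting_field f))) = id"
    using \<alpha> splitting_field_superset[of f]
    by (intro root_perm_eqI[OF \<alpha> Gal_id permutes_id]) (auto simp: bij_betw_def)
  then show idH: "id \<in> ?H" using Gal_id by (metis imageI)
  have comp: "g \<circ> k \<in> ?H" if "g \<in> ?H" "k \<in> ?H" for g k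
  proof -
    obtain \<sigma> \<tau> where "\<sigma> \<in> carrier (Gal f)" "\<tau> \<in> carrier (Gal f)" "g = root_perm n \<alpha> \<sigma>" "k = root_perm n \<alpha> \<tau>"
      using \<open>g \<in> ?H\<close> \<open>k \<in> ?H\<close> by blast
    then show ?thesis using root_perm_compose[OF \<alpha>, of \<sigma> \<tau>] Gal_compose[of \<sigma> f \<tau>] by (metis imageI)
  qed
  have perm: "g permutes {1..n}" if "g \<in> ?H" for g using that root_perm_props(3)[OF \<alpha>] by blast
  have "inv' g \<in> ?H" if g: "g \<in> ?H" for g
  proof -
    have "inj_on ((\<circ>) g) ?H"
      using permutes_inj[OF perm[OF g]] by (auto simp: inj_on_def fun_eq_iff)
    moreover have "(\<circ>) g ` ?H \<subseteq> ?H" using comp[OF g] by blast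
    ultimately have "(\<circ>) g ` ?H = ?H" using finite_Gal[OF f] by (intro endo_inj_surj) auto
    then obtain k where k: "k \<in> ?H" "g \<circ> k = id" using idH by (metis imageE)
    have "inv' g \<circ> (g \<circ> k) = k"
      using permutes_inv_o(2)[OF perm[OF g]] by (simp add: comp_assoc[symmetric])
    then show ?thesis using k by simp
  qed
  with comp perm show "perm_group_on {1..n} ?H" by (simp add: perm_group_on_def)
qed

lemma alt_group_subset_of_all_cycle3:
  assumes H: "perm_group_on {1..n} H" "id \<in> H" and c: "all_cycle3 H {1..n}"
  shows "carrier (alt_group n) \<subseteq> H"
proof
  fix g assume "g \<in> carrier (alt_group n)"
  then have gen: "g \<in> generate (alt_group n) (three_cycles n)" by (simp only: alt_group_carrier_as_three_cycles)
  have three: "k \<in> H" if "k \<in> three_cycles n" for k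
  proof -
    from that obtain cs where cs: "k = cycle_of_list cs" "distinct cs" "length cs = 3" "set cs \<subseteq> {1..n}" by auto
    then obtain x y z where "cs = [x, y, z]" by (auto simp: length_Suc_conv numeral_3_eq_3)
    then show ?thesis using cs c unfolding all_cycle3_def by (auto simp del: cycle_of_list.simps)
  qed
  from gen show "g \<in> H"
  proof (induction rule: generate.induct)
    case one show ?case unfolding alt_group_one by (rule H(2))
  next
    case (incl h) then show ?case by (rule three)
  next
    case (inv h)
    then have "inv\<^bsub>alt_group n\<^esub> h = inv' h"
      using three_cycles_incl by (intro alt_group_inv_equality) blast
    then show ?case using three[OF inv] H(1) by (simp add: perm_group_on_def)
  next
    case (eng h1 h2)
    show ?case unfolding alt_group_mult using eng H(1) unfolding perm_group_on_def by blast
  qed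
qed

lemma image_filter_eq:
  "(\<And>i. i \<in> I \<Longrightarrow> P i \<longleftrightarrow> Q (f i)) \<Longrightarrow> f ` {i \<in> I. P i} = {a \<in> f ` I. Q a}"
  by auto

text \<open>The induced permutation group contains all 3-cycles, hence the alternating group. An odd
  element, multiplied by an even permutation, would give the transposition of 1 and 2.\<close>

theorem Gal_h_iso_alt_group: "Gal h_poly \<cong> alt_group 7"
proof -
  obtain \<alpha> where \<alpha>: "bij_betw \<alpha> {1..7::nat} roots_h"
    using ex_bij_betw_nat_finite_1[OF finite_roots_h] card_roots_h by auto
  define \<theta> where "\<theta> = root_perm 7 \<alpha>"
  let ?G = "carrier (Gal h_poly)"
  let ?H = "\<theta> ` ?G"
  note props = root_perm_props[OF \<alpha>, folded \<theta>_def]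
  have h0: "h_poly \<noteq> 0" by (simp add: h_poly_def)
  note H = perm_group_on_root_perm[OF \<alpha> h0, folded \<theta>_def]
  have \<alpha>R: "\<alpha> i \<in> roots_h" if "i \<in> {1..7}" for i using \<alpha> that by (auto simp: bij_betw_def)
  have \<alpha>inj: "i = j" if "\<alpha> i = \<alpha> j" "i \<in> {1..7}" "j \<in> {1..7}" for i j
    using \<alpha> that by (auto simp: bij_betw_def dest: inj_onD)
  have "all_cycle3 ?H {1..7}"
  proof -
    obtain \<sigma> where s: "\<sigma> \<in> ?G" "\<And>a. a \<in> roots_h \<Longrightarrow> (\<sigma> ^^ 7) a = a" "\<And>a. a \<in> roots_h \<Longrightarrow> \<sigma> a \<noteq> a"
      using exists_seven_cycle by metis
    obtain \<tau> where t: "\<tau> \<in> ?G" "card {a \<in> roots_h. \<tau> a \<noteq> a} = 3" using exists_three_cycle by metis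
    have "\<alpha> ` {i \<in> {1..7}. \<theta> \<tau> i \<noteq> i} = {a \<in> roots_h. \<tau> a \<noteq> a}"
    proof -
      have "\<theta> \<tau> i \<noteq> i \<longleftrightarrow> \<tau> (\<alpha> i) \<noteq> \<alpha> i" if "i \<in> {1..7}" for i
        using props(1,2)[OF t(1) that] \<alpha>inj that by metis
      moreover have "roots_h = \<alpha> ` {1..7}" using \<alpha> by (simp add: bij_betw_def)
      ultimately show ?thesis using image_filter_eq[of "{1..7}" "\<lambda>i. \<theta> \<tau> i \<noteq> i" "\<lambda>a. \<tau> a \<noteq> a" \<alpha>] by simp
    qed
    moreover have "inj_on \<alpha> {i \<in> {1..7}. \<theta> \<tau> i \<noteq> i}"
      using \<alpha> by (auto simp: bij_betw_def intro: inj_on_subset)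
    ultimately have "card {i \<in> {1..7}. \<theta> \<tau> i \<noteq> i} = 3" using t(2) card_image by fastforce
    then obtain u v w where uvw: "\<theta> \<tau> = cycle3 u v w" "distinct [u, v, w]" "{u, v, w} \<subseteq> {1..7}"
      by (rule card_moved_3_imp_cycle3[OF props(3)[OF t(1)]])
    have pow: "\<alpha> ((\<theta> \<sigma> ^^ k) i) = (\<sigma> ^^ k) (\<alpha> i) \<and> (\<theta> \<sigma> ^^ k) i \<in> {1..7}" if "i \<in> {1..7}" for i k
      by (induction k) (use that props(1,2)[OF s(1)] in auto)
    show ?thesis
    proof (rule all_cycle3_of_prime_degree[OF _ _ H(1)])
      show "prime (card {1..7::nat})" by simp
      show "\<theta> \<sigma> \<in> ?H" using s(1) by blast
      show "cycle3 u v w \<in> ?H" using uvw(1) t(1) by (metis imageI)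
      fix i :: nat assume i: "i \<in> {1..7}"
      show "(\<theta> \<sigma> ^^ card {1..7::nat}) i = i" using pow[OF i, of 7] s(2)[OF \<alpha>R[OF i]] \<alpha>inj i by simp
      show "\<theta> \<sigma> i \<noteq> i" using props(1)[OF s(1) i] s(3)[OF \<alpha>R[OF i]] by metis
    qed (use uvw in auto)
  qed
  then have alt: "carrier (alt_group 7) \<subseteq> ?H" by (rule alt_group_subset_of_all_cycle3[OF H])
  have even: "evenperm g" if g: "g \<in> ?H" for g
  proof (rule ccontr)
    assume odd: "\<not> evenperm g"
    let ?t = "Transposition.transpose (1::nat) 2"
    have gp: "g permutes {1..7}" and gi: "inv' g \<in> ?H" using H(1) g by (auto simp: perm_group_on_def)
    have tp: "?t permutes {1..7}" by (rule permutes_swap_id) auto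
    have perm: "permutation g" "permutation ?t"
      using gp tp by (auto simp: permutation_permutes)
    have "evenperm (?t \<circ> g)" using odd perm by (simp add: evenperm_comp evenperm_swap)
    then have "?t \<circ> g \<in> carrier (alt_group 7)"
      using permutes_compose[OF gp tp] by (simp add: alt_group_carrier)
    then have "(?t \<circ> g) \<circ> inv' g \<in> ?H" using alt gi H(1) unfolding perm_group_on_def by blast
    moreover have "(?t \<circ> g) \<circ> inv' g = ?t" using permutes_inv_o(1)[OF gp] by (simp add: comp_assoc)
    ultimately obtain \<sigma> where s: "\<sigma> \<in> ?G" "\<theta> \<sigma> = ?t" by (metis imageE)
    have 12: "(1::nat) \<in> {1..7}" "(2::nat) \<in> {1..7}" by auto
    have "\<sigma> (\<alpha> 1) = \<alpha> 2" "\<sigma> (\<alpha> 2) = \<alpha> 1"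
      using props(1)[OF s(1) 12(1)] props(1)[OF s(1) 12(2)] s(2) by simp_all
    moreover have "\<alpha> 1 \<noteq> \<alpha> 2" using \<alpha>inj[OF _ 12] by auto
    ultimately obtain c where c: "c \<in> roots_h - {\<alpha> 1, \<alpha> 2}" "\<sigma> c \<noteq> c"
      using Gal_h_no_transposition[OF s(1) \<alpha>R[OF 12(1)] \<alpha>R[OF 12(2)]] by blast
    then have "c \<in> \<alpha> ` {1..7}" using \<alpha> by (simp add: bij_betw_def)
    then obtain i where i: "i \<in> {1..7}" "c = \<alpha> i" by blast
    then have "i \<noteq> 1" "i \<noteq> 2" using c by auto
    then have "\<theta> \<sigma> i = i" using s(2) by (simp add: transpose_def)
    then show False using props(1)[OF s(1) i(1)] c i by simp
  qed
  have img: "?H = carrier (alt_group 7)"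
    using alt even H(1) by (auto simp: alt_group_carrier perm_group_on_def)
  have "\<theta> \<in> iso (Gal h_poly) (alt_group 7)"
    unfolding iso_def hom_def
    using img inj_on_root_perm[OF \<alpha>, folded \<theta>_def] root_perm_compose[OF \<alpha>, folded \<theta>_def]
    by (auto simp: bij_betw_def alt_group_mult Gal_mult)
  then show ?thesis by (auto simp: is_iso_def)
qed

section \<open>The real roots of \<open>h\<close>\<close>

abbreviation h_real :: "real \<Rightarrow> real" where
  "h_real t \<equiv> t^7 + t^6 - 8 * t^5 + 3 * t^4 + t^3 - 3 * t^2 + 2 * t - 1"

lemma roots_of_h_real: "roots_of h_poly = {t. h_real t = 0}"
  by (simp add: roots_of_h int_eval_simps algebra_simps power_numeral_reduce)

text \<open>The form \<open>\<Sum>i. c_i * u^i * v^(n-i)\<close>. With \<open>u = x - a\<close> and \<open>v = b - x\<close> it is the Bernstein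
  expansion of a polynomial on an interval, and with \<open>u = x - a\<close> and \<open>v = 1\<close> the Taylor expansion for
  a ray; positive coefficients make the sign of the polynomial evident.\<close>

fun bernstein_form :: "real list \<Rightarrow> real \<Rightarrow> real \<Rightarrow> real" where
  "bernstein_form [] u v = 0"
| "bernstein_form (c # cs) u v = c * v ^ length cs + u * bernstein_form cs u v"

lemma bernstein_form_pos:
  assumes "cs \<noteq> []" "\<forall>c\<in>set cs. c > 0" "u \<ge> 0" "v \<ge> 0" "u > 0 \<or> v > 0"
  shows "bernstein_form cs u v > 0"
  using assms(1,2)
proof (induction cs rule: list_nonempty_induct)
  case (single c) then show ?case by simp
next
  case (cons c cs)
  then have "bernstein_form cs u v > 0" "c > 0" by auto
  then show ?case using assms(3-5)
    by (cases "u > 0") (auto intro: add_nonneg_pos add_pos_nonneg)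
qed

abbreviation h_deriv :: "real \<Rightarrow> real" where
  "h_deriv t \<equiv> 7 * t^6 + 6 * t^5 - 40 * t^4 + 12 * t^3 + 3 * t^2 - 6 * t + 2"

lemma h_real_deriv: "(h_real has_real_derivative h_deriv t) (at t)"
  by (auto intro!: derivative_eq_intros)

lemma pos_if_scaled_pos: "k * y = F \<Longrightarrow> F > 0 \<Longrightarrow> k > 0 \<Longrightarrow> y > 0" for y :: real
  using zero_less_mult_pos by blast

lemma neg_if_scaled_pos: "- k * y = F \<Longrightarrow> F > 0 \<Longrightarrow> k > 0 \<Longrightarrow> y < 0" for y :: real
  using pos_if_scaled_pos[of k "- y" F] by simp

text \<open>The coefficients in this and the following sign conditions are those of the Taylor or
  Bernstein expansion on the interval concerned, scaled to integers.\<close>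

lemma h_real_neg_ray: "x \<le> -4 \<Longrightarrow> h_real x < 0"
proof -
  assume x: "x \<le> -4"
  have "- 1 * h_real x = bernstein_form [3449, 11594, 12271, 6353, 1837, 304, 27, 1] (-4 - x) (1)"
    by (simp add: algebra_simps power_numeral_reduce)
  moreover have "bernstein_form [3449, 11594, 12271, 6353, 1837, 304, 27, 1] (-4 - x) (1) > 0"
    using x by (intro bernstein_form_pos) auto
  ultimately show ?thesis by (rule neg_if_scaled_pos) simp
qed

lemma h_deriv_pos_on_m4_m3: "-4 \<le> x \<Longrightarrow> x \<le> -3 \<Longrightarrow> h_deriv x > 0"
proof -
  assume x: "-4 \<le> x" "x \<le> -3"
  have "1 * h_deriv x = bernstein_form [11594, 45022, 70259, 55348, 22320, 3924, 128] (x + 4) (-3 - x)"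
    by (simp add: algebra_simps power_numeral_reduce)
  moreover have "bernstein_form [11594, 45022, 70259, 55348, 22320, 3924, 128] (x + 4) (-3 - x) > 0"
    using x by (intro bernstein_form_pos) auto
  ultimately show ?thesis by (rule pos_if_scaled_pos) simp
qed

lemma h_real_pos_on_m3_m1: "-3 \<le> x \<Longrightarrow> x \<le> -1 \<Longrightarrow> h_real x > 0"
proof -
  assume x: "-3 \<le> x" "x \<le> -1"
  have "32 * h_real x = bernstein_form [167, 1233, 2313, 1995, 917, 227, 27, 1] (x + 3) (-1 - x)"
    by (simp add: algebra_simps power_numeral_reduce)
  moreover have "bernstein_form [167, 1233, 2313, 1995, 917, 227, 27, 1] (x + 3) (-1 - x) > 0"
    using x by (intro bernstein_form_pos) auto
  ultimately show ?thesis by (rule pos_if_scaled_pos) simp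
qed

lemma h_deriv_neg_on_m1_m45: "-1 \<le> x \<Longrightarrow> x \<le> -4/5 \<Longrightarrow> h_deriv x < 0"
proof -
  assume x: "-1 \<le> x" "x \<le> -4/5"
  have "- 15625 * h_deriv x = bernstein_form [625000, 3212500, 6830000, 7683500, 4819625, 1596430, 217798] (5 * x + 5) (-4 - 5 * x)"
    by (simp add: algebra_simps power_numeral_reduce)
  moreover have "bernstein_form [625000, 3212500, 6830000, 7683500, 4819625, 1596430, 217798] (5 * x + 5) (-4 - 5 * x) > 0"
    using x by (intro bernstein_form_pos) auto
  ultimately show ?thesis by (rule neg_if_scaled_pos) simp
qed

lemma h_real_neg_on_m45_0: "-4/5 \<le> x \<Longrightarrow> x \<le> 0 \<Longrightarrow> h_real x < 0"
proof -
  assume x: "-4/5 \<le> x" "x \<le> 0"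
  have "- 1280000000 * h_real x = bernstein_form [88229, 1488795, 4762825, 6798375, 5399375, 2540625, 671875, 78125] (5 * x + 4) (0 - 5 * x)"
    by (simp add: algebra_simps power_numeral_reduce)
  moreover have "bernstein_form [88229, 1488795, 4762825, 6798375, 5399375, 2540625, 671875, 78125] (5 * x + 4) (0 - 5 * x) > 0"
    using x by (intro bernstein_form_pos) auto
  ultimately show ?thesis by (rule neg_if_scaled_pos) simp
qed

lemma h_real_neg_on_0_1: "0 \<le> x \<Longrightarrow> x \<le> 1 \<Longrightarrow> h_real x < 0"
proof -
  assume x: "0 \<le> x" "x \<le> 1"
  have "- 1 * h_real x = bernstein_form [1, 5, 12, 19, 18, 14, 12, 4] (x) (1 - x)"
    by (simp add: algebra_simps power_numeral_reduce)
  moreover have "bernstein_form [1, 5, 12, 19, 18, 14, 12, 4] (x) (1 - x) > 0"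
    using x by (intro bernstein_form_pos) auto
  ultimately show ?thesis by (rule neg_if_scaled_pos) simp
qed

lemma h_real_neg_on_1_2: "1 \<le> x \<Longrightarrow> x \<le> 2 \<Longrightarrow> h_real x < 0"
proof -
  assume x: "1 \<le> x" "x \<le> 2"
  have "- 1 * h_real x = bernstein_form [4, 44, 206, 522, 755, 598, 217, 17] (x - 1) (2 - x)"
    by (simp add: algebra_simps power_numeral_reduce)
  moreover have "bernstein_form [4, 44, 206, 522, 755, 598, 217, 17] (x - 1) (2 - x) > 0"
    using x by (intro bernstein_form_pos) auto
  ultimately show ?thesis by (rule neg_if_scaled_pos) simp
qed

lemma h_deriv_pos_ray: "2 \<le> x \<Longrightarrow> h_deriv x > 0"
proof -
  assume x: "2 \<le> x"
  have "1 * h_deriv x = bernstein_form [98, 694, 1275, 1052, 440, 90, 7] (x - 2) (1)"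
    by (simp add: algebra_simps power_numeral_reduce)
  moreover have "bernstein_form [98, 694, 1275, 1052, 440, 90, 7] (x - 2) (1) > 0"
    using x by (intro bernstein_form_pos) auto
  ultimately show ?thesis by (rule pos_if_scaled_pos) simp
qed

lemma h_real_pos_ray: "3 \<le> x \<Longrightarrow> h_real x > 0"
proof -
  assume x: "3 \<le> x"
  have "1 * h_real x = bernstein_form [1220, 3656, 4326, 2692, 963, 199, 22, 1] (x - 3) (1)"
    by (simp add: algebra_simps power_numeral_reduce)
  moreover have "bernstein_form [1220, 3656, 4326, 2692, 963, 199, 22, 1] (x - 3) (1) > 0"
    using x by (intro bernstein_form_pos) auto
  ultimately show ?thesis by (rule pos_if_scaled_pos) simp
qed

text \<open>Existence by the intermediate value theorem, uniqueness by the mean value theorem.\<close>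

lemma unique_root_between:
  assumes ab: "a < b" and sgn: "h_real a * h_real b < 0"
    and mono: "(\<forall>x. a \<le> x \<longrightarrow> x \<le> b \<longrightarrow> h_deriv x > 0) \<or> (\<forall>x. a \<le> x \<longrightarrow> x \<le> b \<longrightarrow> h_deriv x < 0)"
  shows "\<exists>!x. a < x \<and> x < b \<and> h_real x = 0"
proof -
  have cont: "\<forall>x. a \<le> x \<and> x \<le> b \<longrightarrow> isCont h_real x" by (auto intro!: continuous_intros)
  have "\<exists>x. a \<le> x \<and> x \<le> b \<and> h_real x = 0"
  proof (cases "h_real a < 0")
    case True
    then have "h_real a \<le> 0" "0 \<le> h_real b" using sgn by (auto simp: mult_less_0_iff)
    then show ?thesis using ab cont by (intro IVT) auto
  next
    case False
    then have "h_real b \<le> 0" "0 \<le> h_real a" using sgn by (auto simp: mult_less_0_iff)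
    then show ?thesis using ab cont by (intro IVT2) auto
  qed
  then obtain x where x: "a \<le> x" "x \<le> b" "h_real x = 0" by blast
  have ends: "h_real a \<noteq> 0" "h_real b \<noteq> 0" using sgn by auto
  have uniq: False if "a < y" "y < z" "z < b" "h_real y = 0" "h_real z = 0" for y z
  proof -
    have "\<exists>w>y. w < z \<and> h_real z - h_real y = (z - y) * h_deriv w"
      using h_real_deriv that(2) by (intro MVT2) auto
    then obtain w where w: "y < w" "w < z" "h_real z - h_real y = (z - y) * h_deriv w" by blast
    from w(3) have "(z - y) * h_deriv w = 0" unfolding that(4,5) by simp
    with w have "h_deriv w = 0" by simp
    moreover have "a \<le> w" "w \<le> b" using w that by linarith+
    ultimately show False using mono by (metis less_irrefl)
  qed
  show ?thesis
  proof (intro ex1I[of _ x] conjI)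
    have "x \<noteq> a" "x \<noteq> b" using x(3) ends by blast+
    then show xab: "a < x" "x < b" "h_real x = 0" using x by auto
    fix y assume "a < y \<and> y < b \<and> h_real y = 0"
    then show "y = x" using uniq[of x y] uniq[of y x] xab
      by (cases x y rule: linorder_cases) blast+
  qed
qed

text \<open>On the rest of the line \<open>h\<close> keeps a sign; the intervals \<open>(-4, -3)\<close>, \<open>(-1, -4/5)\<close> and \<open>(2, 3)\<close>
  contain one root each.\<close>

lemma card_real_roots_h: "card (roots_of h_poly :: real set) = 3"
proof -
  have "\<exists>!x. -4 < x \<and> x < -3 \<and> h_real x = 0"
    by (rule unique_root_between) (use h_deriv_pos_on_m4_m3 in auto)
  then obtain r where r: "-4 < r" "r < -3" "h_real r = 0" "\<And>x. -4 < x \<Longrightarrow> x < -3 \<Longrightarrow> h_real x = 0 \<Longrightarrow> x = r" by blast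
  have "\<exists>!x. -1 < x \<and> x < -4/5 \<and> h_real x = 0"
    by (rule unique_root_between) (use h_deriv_neg_on_m1_m45 in \<open>auto simp: power_divide\<close>)
  then obtain s where s: "-1 < s" "s < -4/5" "h_real s = 0" "\<And>x. -1 < x \<Longrightarrow> x < -4/5 \<Longrightarrow> h_real x = 0 \<Longrightarrow> x = s" by blast
  have "\<exists>!x. 2 < x \<and> x < 3 \<and> h_real x = 0"
    by (rule unique_root_between) (use h_deriv_pos_ray in auto)
  then obtain t where t: "2 < t" "t < 3" "h_real t = 0" "\<And>x. 2 < x \<Longrightarrow> x < 3 \<Longrightarrow> h_real x = 0 \<Longrightarrow> x = t" by blast
  have "x \<in> {r, s, t}" if x: "h_real x = 0" for x
  proof -
    have "\<not> x \<le> -4" using h_real_neg_ray[of x] x by auto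
    moreover have "\<not> (-3 \<le> x \<and> x \<le> -1)" using h_real_pos_on_m3_m1[of x] x by auto
    moreover have "\<not> (-4/5 \<le> x \<and> x \<le> 0)" using h_real_neg_on_m45_0[of x] x by auto
    moreover have "\<not> (0 \<le> x \<and> x \<le> 1)" using h_real_neg_on_0_1[of x] x by auto
    moreover have "\<not> (1 \<le> x \<and> x \<le> 2)" using h_real_neg_on_1_2[of x] x by auto
    moreover have "\<not> x \<ge> 3" using h_real_pos_ray[of x] x by auto
    ultimately consider "-4 < x" "x < -3" | "-1 < x" "x < -4/5" | "2 < x" "x < 3" by linarith
    then show ?thesis using r(4) s(4) t(4) x by cases auto
  qed
  then have "{t. h_real t = 0} = {r, s, t}" using r(3) s(3) t(3) by blast
  moreover have "r \<noteq> s" "s \<noteq> t" "r \<noteq> t" using r(1,2) s(1,2) t(1,2) by linarith+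
  then have "card {r, s, t} = 3" by simp
  ultimately show ?thesis by (simp add: roots_of_h_real)
qed

section \<open>Reflections and the two folds\<close>

lemma reflect_across_hyperplane:
  fixes n A :: "real^2"
  assumes "n \<noteq> 0"
  shows "reflect_across {z. n \<bullet> z = c} A = A - (2 * (n \<bullet> A - c) / (n \<bullet> n)) *\<^sub>R n"
proof -
  let ?l = "{z. n \<bullet> z = c}"
  define x where "x = A - ((n \<bullet> A - c) / (n \<bullet> n)) *\<^sub>R n"
  have nn: "n \<bullet> n \<noteq> 0" using assms by simp
  have xl: "n \<bullet> x = c" using nn by (simp add: x_def inner_diff_right)
  have "closest_point ?l A = x"
  proof (rule closest_point_unique[symmetric])
    show "convex ?l" by (rule convex_hyperplane)
    show "closed ?l" by (rule closed_hyperplane)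
    show "x \<in> ?l" using xl by simp
    show "\<forall>z\<in>?l. dist A x \<le> dist A z"
    proof
      fix z assume "z \<in> ?l"
      then have "n \<bullet> (x - z) = 0" using xl by (simp add: inner_diff_right)
      moreover have "A - x = ((n \<bullet> A - c) / (n \<bullet> n)) *\<^sub>R n" by (simp add: x_def)
      ultimately have "(A - x) \<bullet> (x - z) = 0" by (simp only: inner_scaleR_left mult_zero_right)
      then have "norm (A - z) ^ 2 = norm (A - x) ^ 2 + norm (x - z) ^ 2"
        using norm_add_Pythagorean[of "A - x" "x - z"] by (simp add: orthogonal_def)
      then have "norm (A - x) ^ 2 \<le> norm (A - z) ^ 2" by simp
      then show "dist A x \<le> dist A z" by (simp add: dist_norm power2_le_iff_abs_le)
    qed
  qed
  then show ?thesis
    unfolding reflect_across_def by (simp only:) (simp add: x_def vec_eq_iff)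
qed

lemma is_line_iff: "is_line l \<longleftrightarrow> (\<exists>p q c. (p, q) \<noteq> (0, 0) \<and> l = {A. p * A $ 1 + q * A $ 2 = c})"
proof
  assume l: "is_line l"
  then have "aff_dim l = int (DIM(real^2) - 1)" by (simp add: is_line_def)
  then have "\<exists>n c. n \<noteq> 0 \<and> affine hull l = {x. n \<bullet> x = c}"
    by (simp only: aff_dim_eq_hyperplane)
  then obtain n c where n: "n \<noteq> 0" "affine hull l = {x. n \<bullet> x = c}" by blast
  have "affine hull l = l" using l by (simp add: is_line_def affine_hull_eq)
  with n have "l = {A. n $ 1 * A $ 1 + n $ 2 * A $ 2 = c}" by (simp add: inner_vec_def sum_2)
  moreover have "(n $ 1, n $ 2) \<noteq> (0, 0)" using n(1) by (auto simp: vec_eq_iff forall_2)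
  ultimately show "\<exists>p q c. (p, q) \<noteq> (0, 0) \<and> l = {A. p * A $ 1 + q * A $ 2 = c}" by blast
next
  assume "\<exists>p q c. (p, q) \<noteq> (0, 0) \<and> l = {A. p * A $ 1 + q * A $ 2 = c}"
  then obtain p q c where l: "(p, q) \<noteq> (0, 0)" "l = {A. p * A $ 1 + q * A $ 2 = c}" by blast
  define n :: "real^2" where "n = vector [p, q]"
  have n: "n \<noteq> 0" using l(1) by (auto simp: n_def vec_eq_iff forall_2)
  have "l = {A. n \<bullet> A = c}" by (simp add: l(2) n_def inner_vec_def sum_2)
  then show "is_line l" using n by (simp add: is_line_def affine_hyperplane aff_dim_hyperplane)
qed

lemma reflect_across_coords:
  fixes A :: "real^2"
  assumes "(p, q) \<noteq> (0, 0)"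
  shows "reflect_across {A. p * A $ 1 + q * A $ 2 = c} A =
    vector [A $ 1 - 2 * p * (p * A $ 1 + q * A $ 2 - c) / (p^2 + q^2),
            A $ 2 - 2 * q * (p * A $ 1 + q * A $ 2 - c) / (p^2 + q^2)]"
proof -
  define n :: "real^2" where "n = vector [p, q]"
  have n: "n \<noteq> 0" using assms by (auto simp: n_def vec_eq_iff forall_2)
  have "{A. p * A $ 1 + q * A $ 2 = c} = {A. n \<bullet> A = c}" by (simp add: n_def inner_vec_def sum_2)
  then show ?thesis
    by (simp add: reflect_across_hyperplane[OF n] vec_eq_iff forall_2)
       (simp add: n_def inner_vec_def sum_2 power2_eq_square)
qed

text \<open>The tangents of the parabola with focus \<open>(-4, -1)\<close> and directrix \<open>x = -2\<close>; the
  coefficient 1 is written out to match the general equation of a line.\<close>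

definition fold_line1 :: "real \<Rightarrow> (real^2) set" where
  "fold_line1 s = {A. 1 * A $ 1 + s * A $ 2 = s^2 - s - 3}"

text \<open>The tangents of the parabola with focus \<open>(0, 1)\<close> and directrix \<open>y = -1\<close>, that is
  \<open>x^2 = 4 y\<close>.\<close>

definition fold_line2 :: "real \<Rightarrow> (real^2) set" where
  "fold_line2 t = {A. t * A $ 1 + (-1) * A $ 2 = t^2}"

lemma is_line_fold_line1: "is_line (fold_line1 s)"
  unfolding is_line_iff fold_line1_def
  by (rule exI[of _ 1], rule exI[of _ s], rule exI[of _ "s^2 - s - 3"]) simp

lemma is_line_fold_line2: "is_line (fold_line2 t)"
  unfolding is_line_iff fold_line2_def
  by (rule exI[of _ t], rule exI[of _ "-1"], rule exI[of _ "t^2"]) simp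

lemma reflect_fold_line1:
  "reflect_across (fold_line1 s) A = vector [A $ 1 - 2 * (A $ 1 + s * A $ 2 - (s^2 - s - 3)) / (1 + s^2),
     A $ 2 - 2 * s * (A $ 1 + s * A $ 2 - (s^2 - s - 3)) / (1 + s^2)]"
  unfolding fold_line1_def by (subst reflect_across_coords) simp_all

lemma reflect_fold_line2:
  "reflect_across (fold_line2 t) A = vector [A $ 1 - 2 * t * (t * A $ 1 - A $ 2 - t^2) / (1 + t^2),
     A $ 2 + 2 * (t * A $ 1 - A $ 2 - t^2) / (1 + t^2)]"
  unfolding fold_line2_def
  by (subst reflect_across_coords)
     (simp_all add: add.commute vec_eq_iff forall_2 diff_divide_distrib add_divide_distrib)

lemma one_plus_square: "1 + (s::real)^2 \<noteq> 0" "1 + s^2 > 0"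
  by (auto simp: add_pos_nonneg) (metis add_pos_nonneg less_irrefl zero_le_power2 zero_less_one)

text \<open>The condition on the first coordinate of the reflected point becomes
  \<open>p c = q^2 - 3 p^2 - p q\<close>, which forces \<open>p \<noteq> 0\<close>; the parameter is \<open>s = q / p\<close>.\<close>

lemma fold1_iff:
  "is_line l \<and> reflect_across l (vector [-4, -1]) \<in> {A. A $ 1 = -2} \<longleftrightarrow> (\<exists>s. l = fold_line1 s)"
proof
  assume l: "is_line l \<and> reflect_across l (vector [-4, -1]) \<in> {A. A $ 1 = -2}"
  then obtain p q c where pq: "(p, q) \<noteq> (0, 0)" and leq: "l = {A. p * A $ 1 + q * A $ 2 = c}"
    unfolding is_line_iff by blast
  have pos: "p^2 + q^2 \<noteq> 0" using pq by (auto simp: sum_power2_eq_zero_iff)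
  have "-4 - 2 * p * (p * (-4) + q * (-1) - c) / (p^2 + q^2) = -2"
    using l unfolding leq by (simp add: reflect_across_coords[OF pq])
  then have eq: "p * c = q^2 - 3 * p^2 - p * q" using pos by (simp add: field_simps power2_eq_square)
  have p0: "p \<noteq> 0" using eq pos by auto
  have "A \<in> l \<longleftrightarrow> A \<in> fold_line1 (q / p)" for A :: "real^2"
  proof -
    have "A \<in> l \<longleftrightarrow> p * (p * A $ 1 + q * A $ 2) = p * c" using p0 by (simp add: leq)
    also have "p * (p * A $ 1 + q * A $ 2) = p^2 * (1 * A $ 1 + q / p * A $ 2)"
      using p0 by (simp add: power2_eq_square distrib_left)
    also have "p * c = p^2 * ((q / p)^2 - q / p - 3)"
      using p0 by (simp add: eq power_divide right_diff_distrib) (simp add: power2_eq_square)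
    also have "p^2 * (1 * A $ 1 + q / p * A $ 2) = p^2 * ((q / p)^2 - q / p - 3) \<longleftrightarrow> A \<in> fold_line1 (q / p)"
      using p0 by (simp add: fold_line1_def)
    finally show "A \<in> l \<longleftrightarrow> A \<in> fold_line1 (q / p)" .
  qed
  then show "\<exists>s. l = fold_line1 s" by blast
next
  assume "\<exists>s. l = fold_line1 s"
  then obtain s where "l = fold_line1 s" ..
  then show "is_line l \<and> reflect_across l (vector [-4, -1]) \<in> {A. A $ 1 = -2}"
    using one_plus_square[of s] by (simp add: is_line_fold_line1 reflect_fold_line1 field_simps)
qed

text \<open>The condition on the second coordinate of the reflected point becomes \<open>q c = - p^2\<close>, which
  forces \<open>q \<noteq> 0\<close>; in particular the line is never vertical.\<close>

lemma fold2_iff: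
  "is_line l \<and> reflect_across l (vector [0, 1]) \<in> {A. A $ 2 = -1} \<longleftrightarrow> (\<exists>t. l = fold_line2 t)"
proof
  assume l: "is_line l \<and> reflect_across l (vector [0, 1]) \<in> {A. A $ 2 = -1}"
  then obtain p q c where pq: "(p, q) \<noteq> (0, 0)" and leq: "l = {A. p * A $ 1 + q * A $ 2 = c}"
    unfolding is_line_iff by blast
  have pos: "p^2 + q^2 \<noteq> 0" using pq by (auto simp: sum_power2_eq_zero_iff)
  have "1 - 2 * q * (p * 0 + q * 1 - c) / (p^2 + q^2) = -1"
    using l unfolding leq by (simp add: reflect_across_coords[OF pq])
  then have eq: "q * c = - (p^2)" using pos by (simp add: field_simps power2_eq_square)
  have q0: "q \<noteq> 0" using eq pos by auto
  have "A \<in> l \<longleftrightarrow> A \<in> fold_line2 (- p / q)" for A :: "real^2"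
  proof -
    have "A \<in> l \<longleftrightarrow> q * (p * A $ 1 + q * A $ 2) = q * c" using q0 by (simp add: leq)
    also have "q * (p * A $ 1 + q * A $ 2) = - (q^2) * (- p / q * A $ 1 + (-1) * A $ 2)"
      using q0 by (simp add: power2_eq_square field_simps)
    also have "q * c = - (q^2) * (- p / q)^2"
      using q0 by (simp add: eq power2_eq_square)
    also have "- (q^2) * (- p / q * A $ 1 + (-1) * A $ 2) = - (q^2) * (- p / q)^2 \<longleftrightarrow> A \<in> fold_line2 (- p / q)"
      unfolding fold_line2_def mem_Collect_eq mult_cancel_left using q0 by simp
    finally show "A \<in> l \<longleftrightarrow> A \<in> fold_line2 (- p / q)" .
  qed
  then show "\<exists>t. l = fold_line2 t" by blast
next
  assume "\<exists>t. l = fold_line2 t"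
  then obtain t where "l = fold_line2 t" ..
  then show "is_line l \<and> reflect_across l (vector [0, 1]) \<in> {A. A $ 2 = -1}"
    using one_plus_square[of t] by (simp add: is_line_fold_line2 reflect_fold_line2 field_simps)
qed

lemma AL6ab8_iff:
  "AL6ab8 (vector [-4, -1]) (vector [1, 2]) (vector [0, 1]) (vector [1, 0]) {A. A $ 1 = -2} {A. A $ 2 = -1} l1 l2
    \<longleftrightarrow> (\<exists>s t. l1 = fold_line1 s \<and> l2 = fold_line2 t \<and>
         reflect_across (fold_line1 s) (vector [1, 2]) = reflect_across (fold_line2 t) (vector [1, 0]))"
proof -
  have "AL6ab8 (vector [-4, -1]) (vector [1, 2]) (vector [0, 1]) (vector [1, 0]) {A. A $ 1 = -2} {A. A $ 2 = -1} l1 l2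
    \<longleftrightarrow> (is_line l1 \<and> reflect_across l1 (vector [-4, -1]) \<in> {A. A $ 1 = -2}) \<and>
        (is_line l2 \<and> reflect_across l2 (vector [0, 1]) \<in> {A. A $ 2 = -1}) \<and>
        reflect_across l1 (vector [1, 2]) = reflect_across l2 (vector [1, 0])"
    unfolding AL6ab8_def by blast
  then show ?thesis unfolding fold1_iff fold2_iff by blast
qed

lemma has_slope_fold_line2: "has_slope (fold_line2 t) t' \<longleftrightarrow> t' = t"
proof
  assume "has_slope (fold_line2 t) t'"
  then obtain b where b: "fold_line2 t = {A. A $ 2 = t' * A $ 1 + b}" unfolding has_slope_def ..
  have "vector [0, - (t^2)] \<in> fold_line2 t" "vector [1, t - t^2] \<in> fold_line2 t" by (auto simp: fold_line2_def)
  then show "t' = t" unfolding b by simp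
next
  assume "t' = t"
  then show "has_slope (fold_line2 t) t'"
    unfolding has_slope_def fold_line2_def by (intro exI[of _ "- (t^2)"]) auto
qed

text \<open>Half the second coordinate of the reflection of \<open>(1, 0)\<close> across the fold line of slope \<open>t\<close>.\<close>

definition half_height :: "real \<Rightarrow> real" where "half_height t = (t - t^2) / (1 + t^2)"

lemma reflect_fold_line2_S: "reflect_across (fold_line2 t) (vector [1, 0]) = vector [1 - 2 * t * half_height t, 2 * half_height t]"
  by (simp add: reflect_fold_line2 half_height_def)

lemma reflect_eq_iff:
  "reflect_across (fold_line1 s) (vector [1, 2]) = reflect_across (fold_line2 t) (vector [1, 0]) \<longleftrightarrow>
     t * half_height t * (1 + s^2) = 4 + 3 * s - s^2 \<and> s * (t * half_height t) = 1 - half_height t"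
proof -
  define E where "E = (4 + 3 * s - s^2) / (1 + s^2)"
  have "reflect_across (fold_line1 s) (vector [1, 2]) = vector [1 - 2 * E, 2 - 2 * s * E]"
    by (simp add: reflect_fold_line1 E_def algebra_simps)
  then have "reflect_across (fold_line1 s) (vector [1, 2]) = reflect_across (fold_line2 t) (vector [1, 0]) \<longleftrightarrow>
      E = t * half_height t \<and> s * E = 1 - half_height t"
    by (auto simp: reflect_fold_line2_S vec_eq_iff forall_2)
  also have "\<dots> \<longleftrightarrow> t * half_height t * (1 + s^2) = 4 + 3 * s - s^2 \<and> s * (t * half_height t) = 1 - half_height t"
  proof -
    have "E = t * half_height t \<longleftrightarrow> t * half_height t * (1 + s^2) = 4 + 3 * s - s^2"
      using one_plus_square[of s] by (auto simp: E_def field_simps)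
    then show ?thesis by auto
  qed
  finally show ?thesis .
qed

text \<open>The left-hand side is what remains of the first equation of \<open>reflect_eq_iff\<close> after
  multiplication by \<open>(t \<lambda>)^2\<close>, where \<open>\<lambda>\<close> is \<open>half_height t\<close>, and elimination of \<open>s\<close> by the second
  one. Clearing denominators leaves \<open>- (1 + t^2) h(t)\<close>.\<close>

lemma half_height_cubic:
  "(t * half_height t)^3 + t * half_height t * (1 - half_height t)^2 - 4 * (t * half_height t)^2 - 3 * (t * half_height t) * (1 - half_height t) + (1 - half_height t)^2
     = - h_real t / (1 + t^2)^2"
proof -
  define w where "w = 1 + t^2"
  have w: "w \<noteq> 0" using one_plus_square[of t] by (simp add: w_def)
  have 1: "1 - half_height t = (2 * t^2 - t + 1) / w" using w by (simp add: half_height_def w_def field_simps)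
  have 2: "half_height t = (t - t^2) / w" by (simp add: half_height_def w_def)
  have "w^3 * ((t * half_height t)^3 + t * half_height t * (1 - half_height t)^2 - 4 * (t * half_height t)^2 - 3 * (t * half_height t) * (1 - half_height t) + (1 - half_height t)^2)
    = (t * (t - t^2))^3 + t * (t - t^2) * (2 * t^2 - t + 1)^2
      - w * (4 * (t * (t - t^2))^2 + 3 * (t * (t - t^2)) * (2 * t^2 - t + 1) - (2 * t^2 - t + 1)^2)"
    unfolding 1 unfolding 2 using w by (simp add: field_simps power2_eq_square power3_eq_cube)
  also have "\<dots> = - h_real t * w" unfolding w_def by (simp add: algebra_simps power_numeral_reduce)
  finally have *: "w^3 * ((t * half_height t)^3 + t * half_height t * (1 - half_height t)^2 - 4 * (t * half_height t)^2
      - 3 * (t * half_height t) * (1 - half_height t) + (1 - half_height t)^2) = - h_real t * w" .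
  have "D = H / w^2" if "w^3 * D = H * w" for D H
    using that w by (simp add: field_simps power2_eq_square power3_eq_cube)
  from this[OF *] show ?thesis by (simp only: w_def)
qed

text \<open>The second equation determines \<open>s\<close>, as \<open>t \<lambda> \<noteq> 0\<close> with \<open>\<lambda> = half_height t\<close>: the only zeros
  of \<open>t \<lambda>\<close> are 0 and 1, which are not roots of \<open>h\<close>.\<close>

lemma exists_fold1_parameter_iff:
  "(\<exists>s. t * half_height t * (1 + s^2) = 4 + 3 * s - s^2 \<and> s * (t * half_height t) = 1 - half_height t) \<longleftrightarrow> h_real t = 0"
proof
  assume "\<exists>s. t * half_height t * (1 + s^2) = 4 + 3 * s - s^2 \<and> s * (t * half_height t) = 1 - half_height t"
  then obtain s where s: "t * half_height t * (1 + s^2) = 4 + 3 * s - s^2" "1 - half_height t = s * (t * half_height t)" by auto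
  have "(t * half_height t)^3 + t * half_height t * (1 - half_height t)^2 - 4 * (t * half_height t)^2 - 3 * (t * half_height t) * (1 - half_height t) + (1 - half_height t)^2
     = (t * half_height t)^2 * (t * half_height t * (1 + s^2) - (4 + 3 * s - s^2))"
    unfolding s(2) by (simp add: power2_eq_square power3_eq_cube algebra_simps)
  then show "h_real t = 0" using s(1) one_plus_square[of t] unfolding half_height_cubic by simp
next
  assume h: "h_real t = 0"
  have "t \<noteq> 0" "t \<noteq> 1" using h by auto
  then have tl: "t * half_height t \<noteq> 0" using one_plus_square[of t] by (auto simp: half_height_def power2_eq_square)
  define s where "s = (1 - half_height t) / (t * half_height t)"
  have s: "1 - half_height t = s * (t * half_height t)" using tl by (simp add: s_def)
  have "(t * half_height t)^2 * (t * half_height t * (1 + s^2) - (4 + 3 * s - s^2)) =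
    (t * half_height t)^3 + t * half_height t * (1 - half_height t)^2 - 4 * (t * half_height t)^2 - 3 * (t * half_height t) * (1 - half_height t) + (1 - half_height t)^2"
    unfolding s by (simp add: power2_eq_square power3_eq_cube algebra_simps)
  also have "\<dots> = 0" unfolding half_height_cubic h by simp
  finally have "t * half_height t * (1 + s^2) = 4 + 3 * s - s^2" using tl by simp
  then show "\<exists>s. t * half_height t * (1 + s^2) = 4 + 3 * s - s^2 \<and> s * (t * half_height t) = 1 - half_height t" using s by auto
qed

definition fold_point :: "real \<Rightarrow> real^2" where
  "fold_point t = reflect_across (fold_line2 t) (vector [1, 0])"

text \<open>The coordinates \<open>1 - 2 t \<lambda>\<close> and \<open>2 \<lambda>\<close>, with \<open>\<lambda> = half_height t \<noteq> 0\<close>, determine \<open>t\<close>.\<close>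

lemma inj_on_fold_point: "inj_on fold_point {t. h_real t = 0}"
proof (rule inj_onI)
  fix t u assume t: "t \<in> {t. h_real t = 0}" and u: "u \<in> {t. h_real t = 0}" and eq: "fold_point t = fold_point u"
  have "t \<noteq> 0" "t \<noteq> 1" using t by auto
  then have "half_height t \<noteq> 0" using one_plus_square[of t] by (auto simp: half_height_def power2_eq_square)
  moreover have "half_height t = half_height u" "t * half_height t = u * half_height u"
    using eq by (auto simp: fold_point_def reflect_fold_line2_S vec_eq_iff forall_2)
  ultimately show "t = u" by simp
qed

theorem mainTheorem3:
  fixes P Q R S :: "real^2" and m n :: "(real^2) set"
  assumes "m = {A. A $ 1 = -2}" and "P = vector [-4, -1]" and "Q = vector [1, 2]"
    and "n = {A. A $ 2 = -1}" and "R = vector [0, 1]" and "S = vector [1, 0]"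
  shows "(\<forall>l1 l2. AL6ab8 P Q R S m n l1 l2 \<longrightarrow> (\<exists>t. has_slope l2 t \<and> t \<in> roots_of h_poly))
    \<and> Gal h_poly \<cong> alt_group 7
    \<and> card (roots_of h_poly :: real set) = 3
    \<and> (\<exists>\<phi>. bij_betw \<phi> (roots_of h_poly :: real set)
              {G. \<exists>l1 l2. AL6ab8 P Q R S m n l1 l2 \<and>
                  reflect_across l1 Q = G \<and> G = reflect_across l2 S}
          \<and> (\<forall>l1 l2 t. AL6ab8 P Q R S m n l1 l2 \<and> has_slope l2 t \<longrightarrow>
                \<phi> t = reflect_across l1 Q))"
proof -
  have AL: "AL6ab8 P Q R S m n l1 l2 \<longleftrightarrow> (\<exists>s t. l1 = fold_line1 s \<and> l2 = fold_line2 t \<and>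
         reflect_across (fold_line1 s) Q = reflect_across (fold_line2 t) S)" for l1 l2
    unfolding assms by (rule AL6ab8_iff)
  have root: "(\<exists>s. reflect_across (fold_line1 s) Q = reflect_across (fold_line2 t) S) \<longleftrightarrow> t \<in> roots_of h_poly" for t
    unfolding assms reflect_eq_iff exists_fold1_parameter_iff by (simp add: roots_of_h_real)
  have "bij_betw fold_point (roots_of h_poly)
      {G. \<exists>l1 l2. AL6ab8 P Q R S m n l1 l2 \<and> reflect_across l1 Q = G \<and> G = reflect_across l2 S}"
    unfolding bij_betw_def
  proof
    show "inj_on fold_point (roots_of h_poly)" unfolding roots_of_h_real by (rule inj_on_fold_point)
    have "{G. \<exists>l1 l2. AL6ab8 P Q R S m n l1 l2 \<and> reflect_across l1 Q = G \<and> G = reflect_across l2 S} =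
      {reflect_across (fold_line2 t) S | t. \<exists>s. reflect_across (fold_line1 s) Q = reflect_across (fold_line2 t) S}"
      unfolding AL by auto
    also have "\<dots> = fold_point ` roots_of h_poly"
      unfolding root by (auto simp: fold_point_def assms(6))
    finally show "fold_point ` roots_of h_poly =
      {G. \<exists>l1 l2. AL6ab8 P Q R S m n l1 l2 \<and> reflect_across l1 Q = G \<and> G = reflect_across l2 S}" ..
  qed
  moreover have "\<forall>l1 l2 t. AL6ab8 P Q R S m n l1 l2 \<and> has_slope l2 t \<longrightarrow> fold_point t = reflect_across l1 Q"
    unfolding AL by (auto simp: has_slope_fold_line2 fold_point_def assms(6))
  moreover have "\<forall>l1 l2. AL6ab8 P Q R S m n l1 l2 \<longrightarrow> (\<exists>t. has_slope l2 t \<and> t \<in> roots_of h_poly)"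
    unfolding AL using root has_slope_fold_line2 by blast
  ultimately show ?thesis using Gal_h_iso_alt_group card_real_roots_h by blast
qed

end
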